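(* Let $K$ be an infinite field. If $\Delta$ is a $(d-1)$-dimensional simplicial complex that is uniformly Cohen--Macaulay over $K$, with $h$-vector $h(\Delta)=(h_0,h_1,\dots,h_d)$, then $$h_d+h_{d-1}+\cdots+h_{d-i}\ \ge\ h_0+h_1+\cdots+h_i$$ for all $i=0,1,\dots,d$.
   Context: A simplicial complex $\Delta$ on $[n]=\{1,\dots,n\}$ is a collection of subsets of $[n]$ (containing $\emptyset$) closed under taking subsets. Its elements are called faces, its inclusion-maximal faces facets, and $\dim\Delta=\max\{\#F:F\in\Delta\}-1$. The Stanley--Reisner ring is $K[\Delta]=K[x_1,\dots,x_n]/(\prod_{i\in F}x_i: F\subset[n],\ F\notin\Delta)$; $\Delta$ is Cohen--Macaulay (CM) over $K$ if $K[\Delta]$ is a Cohen--Macaulay ring. For a face $F$, $\mathrm{cost}_\Delta(F)=\{G\in\Delta: G\not\supset F\}$. An $e$-dimensional simplicial complex $\Delta$ is uniformly Cohen--Macaulay if $\Delta$ is CM and, for every facet $F$ of $\Delta$, $\mathrm{cost}_\Delta(F)=\Delta\setminus\{F\}$ is CM of dimension $e$. For a $(d-1)$-dimensional $\Delta$, let $f_i(\Delta)=\#\{F\in\Delta:\#F=i+1\}$ (so $f_{-1}(\Delta)=1$). The $h$-vector $(h_0,\dots,h_d)$ is defined by $\sum_{k=0}^d f_{k-1}(\Delta)(t-1)^{d-k}=\sum_{k=0}^d h_k t^{d-k}$. *)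

theory Defs
  imports
    "HOL-Library.Poly_Mapping"
    "HOL-Library.Extended_Nat"
    "HOL-Computational_Algebra.Polynomial"
    "HOL-Algebra.QuotRing"
    "HOL-Algebra.Ring_Divisibility"
begin

section \<open>Cohen--Macaulay rings\<close>

text \<open>
  \<open>x\<^sub>1, \<dots>, x\<^sub>r\<close> is a regular sequence on \<open>R\<close> if each \<open>x\<^sub>i\<close> is a nonzerodivisor on
  \<open>R/(x\<^sub>1, \<dots>, x\<^sub>i\<^sub>-\<^sub>1)\<close> and \<open>(x\<^sub>1, \<dots>, x\<^sub>r) \<noteq> R\<close>. The nonzerodivisor condition is written with
  representatives in \<open>R\<close>.
\<close>

definition regular_sequence :: "('a, 'b) ring_scheme \<Rightarrow> 'a list \<Rightarrow> bool" where
  "regular_sequence R xs \<longleftrightarrow>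
     set xs \<subseteq> carrier R \<and>
     (\<forall>i<length xs. \<forall>a\<in>carrier R.
        (xs ! i) \<otimes>\<^bsub>R\<^esub> a \<in> Idl\<^bsub>R\<^esub> (set (take i xs)) \<longrightarrow> a \<in> Idl\<^bsub>R\<^esub> (set (take i xs))) \<and>
     Idl\<^bsub>R\<^esub> (set xs) \<noteq> carrier R"

definition ideal_depth :: "('a, 'b) ring_scheme \<Rightarrow> 'a set \<Rightarrow> enat" where
  "ideal_depth R I = Sup {enat (length xs) | xs. regular_sequence R xs \<and> set xs \<subseteq> I}"

definition prime_height :: "('a, 'b) ring_scheme \<Rightarrow> 'a set \<Rightarrow> enat" where
  "prime_height R P =
     Sup {enat (length Qs - 1) | Qs.
            Qs \<noteq> [] \<and> (\<forall>Q\<in>set Qs. primeideal Q R) \<and> sorted_wrt (\<subset>) Qs \<and> last Qs = P}"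

text \<open>
  A Noetherian commutative ring is Cohen--Macaulay if depth and height (codimension) agree at
  every maximal ideal; this is the definition in Eisenbud, \<^emph>\<open>Commutative Algebra\<close>, Section 18.2.
\<close>

definition cohen_macaulay_ring :: "('a, 'b) ring_scheme \<Rightarrow> bool" where
  "cohen_macaulay_ring R \<longleftrightarrow>
     cring R \<and> noetherian_ring R \<and>
     (\<forall>M. maximalideal M R \<longrightarrow> ideal_depth R M = prime_height R M)"


section \<open>Simplicial complexes\<close>

definition simplicial_complex :: "nat \<Rightarrow> nat set set \<Rightarrow> bool" where
  "simplicial_complex n \<Delta> \<longleftrightarrow>
     \<Delta> \<subseteq> Pow {1..n} \<and> {} \<in> \<Delta> \<and> (\<forall>F\<in>\<Delta>. \<forall>G. G \<subseteq> F \<longrightarrow> G \<in> \<Delta>)"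

definition facets :: "nat set set \<Rightarrow> nat set set" where
  "facets \<Delta> = {F \<in> \<Delta>. \<forall>G\<in>\<Delta>. F \<subseteq> G \<longrightarrow> G = F}"

definition complex_dim :: "nat set set \<Rightarrow> int" where
  "complex_dim \<Delta> = int (Max (card ` \<Delta>)) - 1"

definition cost :: "nat set set \<Rightarrow> nat set \<Rightarrow> nat set set" where
  "cost \<Delta> F = {G \<in> \<Delta>. \<not> F \<subseteq> G}"

lemma cost_facet: "F \<in> facets \<Delta> \<Longrightarrow> cost \<Delta> F = \<Delta> - {F}"
  by (auto simp: cost_def facets_def)


section \<open>The Stanley--Reisner ring\<close>

text \<open>
  A polynomial is a finitely supported map from exponent vectors \<open>nat \<Rightarrow>\<^sub>0 nat\<close> to coefficients;
  only the variables \<open>x\<^sub>1, \<dots>, x\<^sub>n\<close> may occur.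
\<close>

definition poly_ring :: "nat \<Rightarrow> ((nat \<Rightarrow>\<^sub>0 nat) \<Rightarrow>\<^sub>0 'k::field) ring" where
  "poly_ring n =
     \<lparr>carrier = {p. \<forall>m\<in>Poly_Mapping.keys p. Poly_Mapping.keys m \<subseteq> {1..n}},
      mult = (*), one = 1, zero = 0, add = (+)\<rparr>"

definition var_poly :: "nat \<Rightarrow> (nat \<Rightarrow>\<^sub>0 nat) \<Rightarrow>\<^sub>0 'k::field" where
  "var_poly i = Poly_Mapping.single (Poly_Mapping.single i 1) 1"

definition stanley_reisner_ideal ::
    "nat \<Rightarrow> nat set set \<Rightarrow> ((nat \<Rightarrow>\<^sub>0 nat) \<Rightarrow>\<^sub>0 'k::field) set" where
  "stanley_reisner_ideal n \<Delta> =
     Idl\<^bsub>poly_ring n\<^esub> {\<Prod>i\<in>F. var_poly i | F. F \<subseteq> {1..n} \<and> F \<notin> \<Delta>}"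

definition stanley_reisner_ring ::
    "nat \<Rightarrow> nat set set \<Rightarrow> ((nat \<Rightarrow>\<^sub>0 nat) \<Rightarrow>\<^sub>0 'k::field) set ring" where
  "stanley_reisner_ring n \<Delta> = poly_ring n Quot stanley_reisner_ideal n \<Delta>"

lemma cring_poly_ring: "cring (poly_ring n :: ((nat \<Rightarrow>\<^sub>0 nat) \<Rightarrow>\<^sub>0 'k::field) ring)"
proof -
  let ?C = "{p :: (nat \<Rightarrow>\<^sub>0 nat) \<Rightarrow>\<^sub>0 'k. \<forall>m\<in>Poly_Mapping.keys p. Poly_Mapping.keys m \<subseteq> {1..n}}"
  have add: "p + q \<in> ?C" if "p \<in> ?C" "q \<in> ?C" for p q
    using that Poly_Mapping.keys_add[of p q] by blast
  have mult: "p * q \<in> ?C" if "p \<in> ?C" "q \<in> ?C" for p q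
  proof -
    have "Poly_Mapping.keys m \<subseteq> {1..n}" if m: "m \<in> Poly_Mapping.keys (p * q)" for m
    proof -
      obtain a b where ab: "m = a + b" "a \<in> Poly_Mapping.keys p" "b \<in> Poly_Mapping.keys q"
        using Poly_Mapping.keys_mult[of p q] m by blast
      then have "Poly_Mapping.keys a \<subseteq> {1..n}" "Poly_Mapping.keys b \<subseteq> {1..n}"
        using \<open>p \<in> ?C\<close> \<open>q \<in> ?C\<close> by auto
      then show ?thesis
        using Poly_Mapping.keys_add[of a b] ab(1) by blast
    qed
    then show ?thesis by simp
  qed
  have neg: "- p \<in> ?C" if "p \<in> ?C" for p
    using that by simp
  have one: "1 \<in> ?C" and zero: "0 \<in> ?C"
    by simp_all
  have carrier: "carrier (poly_ring n) = ?C"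
    by (simp add: poly_ring_def)
  have ops: "mult (poly_ring n) = ((*) :: _ \<Rightarrow> _ \<Rightarrow> (nat \<Rightarrow>\<^sub>0 nat) \<Rightarrow>\<^sub>0 'k)"
    "add (poly_ring n) = ((+) :: _ \<Rightarrow> _ \<Rightarrow> (nat \<Rightarrow>\<^sub>0 nat) \<Rightarrow>\<^sub>0 'k)"
    "one (poly_ring n) = (1 :: (nat \<Rightarrow>\<^sub>0 nat) \<Rightarrow>\<^sub>0 'k)"
    "zero (poly_ring n) = (0 :: (nat \<Rightarrow>\<^sub>0 nat) \<Rightarrow>\<^sub>0 'k)"
    by (simp_all add: poly_ring_def)
  have "abelian_group (poly_ring n :: ((nat \<Rightarrow>\<^sub>0 nat) \<Rightarrow>\<^sub>0 'k) ring)"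
  proof (rule abelian_groupI, unfold carrier ops)
    show "\<exists>y\<in>?C. y + x = 0" if "x \<in> ?C" for x
      using neg[OF that] by (intro bexI[of _ "- x"]) simp_all
  qed (rule add zero add.assoc add.commute add_0_left; assumption)+
  moreover have "Group.comm_monoid (poly_ring n :: ((nat \<Rightarrow>\<^sub>0 nat) \<Rightarrow>\<^sub>0 'k) ring)"
    by (rule Group.comm_monoidI, unfold carrier ops)
      (rule mult one mult.assoc mult.commute mult_1_left; assumption)+
  ultimately show ?thesis
    by (rule cringI) (simp add: ops distrib_right)
qed

lemma var_poly_prod_closed:
  assumes "F \<subseteq> {1..n}"
  shows "(\<Prod>i\<in>F. var_poly i) \<in> carrier (poly_ring n :: ((nat \<Rightarrow>\<^sub>0 nat) \<Rightarrow>\<^sub>0 'k::field) ring)"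
proof -
  interpret R: cring "poly_ring n :: ((nat \<Rightarrow>\<^sub>0 nat) \<Rightarrow>\<^sub>0 'k) ring"
    by (rule cring_poly_ring)
  have "finite F" using assms finite_subset by blast
  then show ?thesis
    using assms
  proof (induction F)
    case empty
    then show ?case using R.one_closed by (simp add: poly_ring_def)
  next
    case (insert i F)
    have "var_poly i \<in> carrier (poly_ring n :: ((nat \<Rightarrow>\<^sub>0 nat) \<Rightarrow>\<^sub>0 'k) ring)"
      using insert.prems by (simp add: poly_ring_def var_poly_def)
    with insert R.m_closed[of "var_poly i" "\<Prod>i\<in>F. var_poly i"] show ?case
      by (simp add: poly_ring_def)
  qed
qed

lemma ideal_stanley_reisner:
  "ideal (stanley_reisner_ideal n \<Delta>) (poly_ring n :: ((nat \<Rightarrow>\<^sub>0 nat) \<Rightarrow>\<^sub>0 'k::field) ring)"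
proof -
  interpret R: cring "poly_ring n :: ((nat \<Rightarrow>\<^sub>0 nat) \<Rightarrow>\<^sub>0 'k) ring"
    by (rule cring_poly_ring)
  show ?thesis
    unfolding stanley_reisner_ideal_def
    by (rule R.genideal_ideal) (use var_poly_prod_closed in blast)
qed

lemma cring_stanley_reisner_ring:
  "cring (stanley_reisner_ring n \<Delta> :: ((nat \<Rightarrow>\<^sub>0 nat) \<Rightarrow>\<^sub>0 'k::field) set ring)"
  unfolding stanley_reisner_ring_def
  by (rule ideal.quotient_is_cring[OF ideal_stanley_reisner cring_poly_ring])


section \<open>(Uniformly) Cohen--Macaulay complexes\<close>

text \<open>
  The coefficient field is passed as a type argument. Being a simplicial complex is part of the
  predicate, so that the empty collection (which arises as \<open>cost {{}} {}\<close>, whose dimension is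
  meaningless) does not count as Cohen--Macaulay.
\<close>

definition CM_complex :: "'k::field itself \<Rightarrow> nat \<Rightarrow> nat set set \<Rightarrow> bool" where
  "CM_complex K n \<Delta> \<longleftrightarrow>
     simplicial_complex n \<Delta> \<and>
     cohen_macaulay_ring (stanley_reisner_ring n \<Delta> :: ((nat \<Rightarrow>\<^sub>0 nat) \<Rightarrow>\<^sub>0 'k) set ring)"

definition uniformly_CM :: "'k::field itself \<Rightarrow> nat \<Rightarrow> nat set set \<Rightarrow> bool" where
  "uniformly_CM K n \<Delta> \<longleftrightarrow>
     CM_complex K n \<Delta> \<and>
     (\<forall>F\<in>facets \<Delta>. CM_complex K n (cost \<Delta> F) \<and> complex_dim (cost \<Delta> F) = complex_dim \<Delta>)"


section \<open>Face numbers\<close>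

definition f_vec :: "nat set set \<Rightarrow> int \<Rightarrow> nat" where
  "f_vec \<Delta> i = card {F \<in> \<Delta>. int (card F) = i + 1}"

text \<open>\<open>h_poly d \<Delta>\<close> is \<open>\<Sum>k\<le>d. f\<^sub>k\<^sub>-\<^sub>1 (t - 1)\<^sup>d\<^sup>-\<^sup>k\<close>, with \<open>[:- 1, 1:]\<close> being \<open>t - 1\<close>.\<close>

definition h_poly :: "nat \<Rightarrow> nat set set \<Rightarrow> int Polynomial.poly" where
  "h_poly d \<Delta> = (\<Sum>k\<le>d. of_nat (f_vec \<Delta> (int k - 1)) * [:- 1, 1:] ^ (d - k))"

definition h_vec :: "nat set set \<Rightarrow> nat \<Rightarrow> int" where
  "h_vec \<Delta> k =
     (let d = nat (complex_dim \<Delta> + 1) in Polynomial.coeff (h_poly d \<Delta>) (d - k))"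

lemma h_vec_eq:
  assumes "complex_dim \<Delta> = int d - 1"
  shows "(\<Sum>k\<le>d. of_nat (f_vec \<Delta> (int k - 1)) * [:- 1, 1:] ^ (d - k)) =
         (\<Sum>k\<le>d. Polynomial.monom (h_vec \<Delta> k) (d - k))"
proof -
  have "degree (of_nat c * [:- 1, 1 :: int:] ^ (d - k)) \<le> d" for c k
    by (rule order.trans[OF degree_mult_le]) (simp add: degree_linear_power)
  then have deg: "degree (h_poly d \<Delta>) \<le> d"
    unfolding h_poly_def by (intro degree_sum_le) auto
  have "h_poly d \<Delta> = (\<Sum>j\<le>d. Polynomial.monom (Polynomial.coeff (h_poly d \<Delta>) j) j)"
    using poly_as_sum_of_monoms'[OF deg] by simp
  also have "\<dots> = (\<Sum>k\<le>d. Polynomial.monom (Polynomial.coeff (h_poly d \<Delta>) (d - k)) (d - k))"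
    by (rule sum.nat_diff_reindex[symmetric, of _ "Suc d", simplified lessThan_Suc_atMost diff_Suc_Suc])
  finally show ?thesis
    using assms by (simp add: h_vec_def h_poly_def)
qed

end

theory Submission
  imports Defs
    "HOL-Library.Function_Algebras"
    "HOL-Computational_Algebra.Polynomial_FPS"
begin

text \<open>
  For distinct \<open>t\<^sub>1, \<dots>, t\<^sub>n \<in> K\<close> the forms \<open>\<theta>\<^sub>j = \<Sum>\<^sub>i t\<^sub>i\<^sup>j x\<^sub>i\<close>, \<open>j < d\<close>, are a linear system of
  parameters for every complex of dimension \<open>d - 1\<close>, and the affine subspace
  \<open>\<theta>\<^sub>0 = \<dots> = \<theta>\<^sub>d\<^sub>-\<^sub>2 = 0\<close>, \<open>\<theta>\<^sub>d\<^sub>-\<^sub>1 = 1\<close> meets each coordinate subspace of a face \<open>F\<close> of size \<open>d\<close> in exactly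
  one point, given by Lagrange interpolation. If \<open>\<Delta>\<close> is Cohen--Macaulay, the Koszul complex shows that
  the \<open>\<theta>\<^sub>j\<close> form a regular sequence on \<open>K[\<Delta>]\<close>, so the space \<open>V\<^sub>D\<close> of functions on these points
  induced by forms of degree \<open>D\<close> has dimension \<open>h\<^sub>0 + \<dots> + h\<^sub>D\<close> for \<open>D \<le> d\<close>.

  Deleting a facet \<open>F\<close> does not change \<open>h\<^sub>0, \<dots>, h\<^sub>d\<^sub>-\<^sub>1\<close>; when \<open>\<Delta>\<close> without \<open>F\<close> is again Cohen--Macaulay of
  the same dimension, the indicator function of the point of \<open>F\<close> is therefore not in \<open>V\<^sub>d\<^sub>-\<^sub>1\<close>. As \<open>K\<close>
  is infinite, some functional \<open>\<phi>\<close> annihilates \<open>V\<^sub>d\<^sub>-\<^sub>1\<close> and has no zero coordinate. The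
  nondegenerate form \<open>(u, v) \<mapsto> \<phi>(u v)\<close> makes \<open>V\<^sub>i\<close> and \<open>V\<^sub>d\<^sub>-\<^sub>1\<^sub>-\<^sub>i\<close> orthogonal, whence
  \<open>dim V\<^sub>i + dim V\<^sub>d\<^sub>-\<^sub>1\<^sub>-\<^sub>i \<le> h\<^sub>0 + \<dots> + h\<^sub>d\<close>. This replaces the usual embedding of \<open>K[\<Delta>]\<close> into its
  canonical module.
\<close>


section \<open>Koszul complexes and regular sequences\<close>

text \<open>The hypothesis supplies some regular sequence of length at least d in the ideal of the
  variables, with no control over its members, while the dimension count needs the particular forms
  theta_j to be regular in a fixed order. The way back from exactness to regularity is a Nakayama
  argument; induction on the polynomial degree takes the place of a local ring, which is why cycles
  become homogeneous there. The kernel of evaluation is found first in degree d: the squarefree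
  monomials of the faces of size d already separate the points, so every function occurs, and
  comparison with the Hilbert function modulo theta_0, ..., theta_(d-2) leaves no room for a larger
  kernel. Lower degrees follow because theta_(d-1) is a nonzerodivisor. That K is infinite also
  provides the distinct t_i.\<close>

global_interpretation ring_ideal: Modules.module "(*) :: 'a::comm_ring_1 \<Rightarrow> 'a \<Rightarrow> 'a"
  by unfold_locales (simp_all add: algebra_simps)

declare ring_ideal.scale_scale [simp del] \<comment> \<open>loops together with \<open>mult.assoc\<close>\<close>

text \<open>
  A chain of the Koszul complex of \<open>ts\<close> is a function on Boolean lists: the entry at \<open>bs\<close> is the
  coefficient of the wedge product of the basis vectors \<open>e\<^sub>k\<close> with \<open>bs ! k\<close>. Recursion on \<open>ts\<close>
  is the mapping cone construction, which avoids sign bookkeeping.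
\<close>

fun kdiff :: "'a::comm_ring_1 list \<Rightarrow> (bool list \<Rightarrow> 'a) \<Rightarrow> bool list \<Rightarrow> 'a" where
  "kdiff [] z bs = 0"
| "kdiff (t # ts) z [] = 0"
| "kdiff (t # ts) z (True # bs) = - kdiff ts (\<lambda>cs. z (True # cs)) bs"
| "kdiff (t # ts) z (False # bs) = kdiff ts (\<lambda>cs. z (False # cs)) bs + t * z (True # bs)"

text \<open>Left exterior multiplication by the 1-chain with coefficients \<open>es\<close>; the
  minus sign comes from moving that chain past the first basis vector. It will be the contracting
  homotopy for the contraction \<open>kdiff\<close>.\<close>

fun kwedge :: "'a::comm_ring_1 list \<Rightarrow> (bool list \<Rightarrow> 'a) \<Rightarrow> bool list \<Rightarrow> 'a" where
  "kwedge [] z bs = 0"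
| "kwedge (b # es) z [] = 0"
| "kwedge (b # es) z (True # bs) = b * z (False # bs) - kwedge es (\<lambda>cs. z (True # cs)) bs"
| "kwedge (b # es) z (False # bs) = kwedge es (\<lambda>cs. z (False # cs)) bs"

definition kchain :: "nat \<Rightarrow> nat \<Rightarrow> (bool list \<Rightarrow> 'a::zero) \<Rightarrow> bool" where
  "kchain n i z \<longleftrightarrow> (\<forall>bs. z bs \<noteq> 0 \<longrightarrow> length bs = n \<and> count_list bs True = i)"

lemma kdiff_add: "kdiff ts (\<lambda>bs. y bs + z bs) bs = kdiff ts y bs + kdiff ts z bs"
proof (induction ts arbitrary: y z bs)
  case (Cons t ts)
  then show ?case
    by (cases bs rule: list.exhaust; cases "hd bs") (simp_all add: distrib_left Cons.IH)
qed simp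

lemma kdiff_mult: "kdiff ts (\<lambda>bs. c * z bs) bs = c * kdiff ts z bs"
proof (induction ts arbitrary: z bs)
  case (Cons t ts)
  then show ?case
    by (cases bs rule: list.exhaust; cases "hd bs") (simp_all add: distrib_left Cons.IH mult.left_commute)
qed simp

lemma kdiff_minus: "kdiff ts (\<lambda>bs. - z bs) bs = - kdiff ts z bs"
  using kdiff_mult[of ts "-1" z bs] by simp

lemma kdiff_diff: "kdiff ts (\<lambda>bs. y bs - z bs) bs = kdiff ts y bs - kdiff ts z bs"
  using kdiff_add[of ts y "\<lambda>bs. - z bs" bs] by (simp add: kdiff_minus)

lemma kdiff_0: "kdiff ts (\<lambda>bs. 0) bs = 0"
  using kdiff_mult[of ts 0 "\<lambda>_. 0" bs] by simp

lemma kdiff_kdiff: "kdiff ts (kdiff ts z) bs = 0"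
proof (induction ts z bs rule: kdiff.induct)
  case (4 t ts z bs)
  then show ?case by (simp add: kdiff_add kdiff_mult)
qed (simp_all add: kdiff_minus)

lemma kwedge_add: "kwedge es (\<lambda>bs. y bs + z bs) bs = kwedge es y bs + kwedge es z bs"
proof (induction es arbitrary: y z bs)
  case (Cons b es)
  then show ?case
    by (cases bs rule: list.exhaust; cases "hd bs") (simp_all add: distrib_left Cons.IH)
qed simp

lemma kwedge_mult: "kwedge es (\<lambda>bs. c * z bs) bs = c * kwedge es z bs"
proof (induction es arbitrary: z bs)
  case (Cons b es)
  then show ?case
    by (cases bs rule: list.exhaust; cases "hd bs")
      (simp_all add: right_diff_distrib Cons.IH mult.left_commute)
qed simp

lemma kwedge_minus: "kwedge es (\<lambda>bs. - z bs) bs = - kwedge es z bs"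
  using kwedge_mult[of es "-1" z bs] by simp

text \<open>Hence multiplication by an element of the ideal \<open>(ts)\<close> is null-homotopic.\<close>

lemma kdiff_kwedge:
  assumes "length es = length ts" "length bs = length ts"
  shows "kdiff ts (kwedge es z) bs + kwedge es (kdiff ts z) bs =
    (\<Sum>(b, t)\<leftarrow>zip es ts. b * t) * z bs"
  using assms
proof (induction es ts arbitrary: z bs rule: list_induct2)
  case (Cons b es t ts)
  from Cons.prems obtain c cs where bs: "bs = c # cs" "length cs = length ts"
    by (cases bs) auto
  define S where "S = (\<Sum>(b, t)\<leftarrow>zip es ts. b * t)"
  have IH: "kdiff ts (kwedge es y) cs + kwedge es (kdiff ts y) cs = S * y cs" for y
    using Cons.IH[OF bs(2)] unfolding S_def .
  define zF where "zF = (\<lambda>cs. z (False # cs))"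
  define zT where "zT = (\<lambda>cs. z (True # cs))"
  have S: "(\<Sum>(b, t)\<leftarrow>zip (b # es) (t # ts). b * t) = b * t + S"
    by (simp add: S_def)
  show ?case
  proof (cases c)
    case True
    have "kdiff (t # ts) (kwedge (b # es) z) bs = - kdiff ts (\<lambda>cs. b * zF cs - kwedge es zT cs) cs"
      by (simp add: True bs(1) zF_def zT_def)
    also have "\<dots> = kdiff ts (kwedge es zT) cs - b * kdiff ts zF cs"
      by (simp only: kdiff_diff kdiff_mult minus_diff_eq)
    finally have 1: "kdiff (t # ts) (kwedge (b # es) z) bs = \<dots>" .
    have "kwedge (b # es) (kdiff (t # ts) z) bs =
        b * (kdiff ts zF cs + t * zT cs) - kwedge es (\<lambda>cs. - kdiff ts zT cs) cs"
      by (simp add: True bs(1) zF_def zT_def)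
    also have "\<dots> = b * kdiff ts zF cs + b * t * zT cs + kwedge es (kdiff ts zT) cs"
      by (simp only: kwedge_minus distrib_left mult.assoc diff_minus_eq_add)
    finally have "kdiff (t # ts) (kwedge (b # es) z) bs + kwedge (b # es) (kdiff (t # ts) z) bs =
        b * t * zT cs + (kdiff ts (kwedge es zT) cs + kwedge es (kdiff ts zT) cs)"
      unfolding 1 by (simp only: algebra_simps)
    then show ?thesis
      unfolding IH S by (simp add: True bs(1) zT_def distrib_right)
  next
    case False
    have 1: "kdiff (t # ts) (kwedge (b # es) z) bs =
        kdiff ts (kwedge es zF) cs + t * (b * zF cs - kwedge es zT cs)"
      by (simp add: False bs(1) zF_def zT_def)
    have "kwedge (b # es) (kdiff (t # ts) z) bs = kwedge es (\<lambda>cs. kdiff ts zF cs + t * zT cs) cs"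
      by (simp add: False bs(1) zF_def zT_def)
    also have "\<dots> = kwedge es (kdiff ts zF) cs + t * kwedge es zT cs"
      by (simp only: kwedge_add kwedge_mult)
    finally have "kdiff (t # ts) (kwedge (b # es) z) bs + kwedge (b # es) (kdiff (t # ts) z) bs =
        b * t * zF cs + (kdiff ts (kwedge es zF) cs + kwedge es (kdiff ts zF) cs)"
      unfolding 1 by (simp only: algebra_simps)
    then show ?thesis
      unfolding IH S by (simp add: False bs(1) zF_def distrib_right)
  qed
qed simp

lemma kchainD: "kchain n i z \<Longrightarrow> z bs \<noteq> 0 \<Longrightarrow> length bs = n \<and> count_list bs True = i"
  by (simp add: kchain_def)

lemma kchain_Cons:
  assumes "kchain (Suc n) i z"
  shows "kchain n i (\<lambda>cs. z (False # cs))" "kchain n (i - 1) (\<lambda>cs. z (True # cs))"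
proof -
  show "kchain n i (\<lambda>cs. z (False # cs))"
    unfolding kchain_def using kchainD[OF assms, of "False # _"] by auto
  have "length cs = n \<and> count_list cs True = i - 1" if "z (True # cs) \<noteq> 0" for cs
    using kchainD[OF assms that] by auto
  then show "kchain n (i - 1) (\<lambda>cs. z (True # cs))" unfolding kchain_def by blast
qed

lemma kchain_0: "kchain n i (\<lambda>_. 0)"
  by (simp add: kchain_def)

lemma kchain_add: "kchain n i y \<Longrightarrow> kchain n i z \<Longrightarrow> kchain n i (\<lambda>bs. y bs + z bs :: 'a::comm_ring_1)"
  unfolding kchain_def by (metis add_0)

lemma kchain_diff: "kchain n i y \<Longrightarrow> kchain n i z \<Longrightarrow> kchain n i (\<lambda>bs. y bs - z bs :: 'a::comm_ring_1)"
  unfolding kchain_def by (metis diff_zero)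

lemma kchain_map: "kchain n i z \<Longrightarrow> f 0 = 0 \<Longrightarrow> kchain n i (\<lambda>bs. f (z bs))"
  unfolding kchain_def by metis

lemma kchain_mult: "kchain n i z \<Longrightarrow> kchain n i (\<lambda>bs. c * z bs :: 'a::comm_ring_1)"
  by (rule kchain_map) simp_all

text \<open>Phrased through nonzero entries so that \<open>i = 0\<close> is covered as well: there
  \<open>Suc (count_list bs True) = i\<close> is impossible, hence the differential
  vanishes.\<close>

lemma kdiff_nonzero:
  assumes "kchain (length ts) i z" "kdiff ts z bs \<noteq> 0"
  shows "length bs = length ts \<and> Suc (count_list bs True) = i"
  using assms
proof (induction ts z bs arbitrary: i rule: kdiff.induct)
  case (3 t ts z bs)
  have "length bs = length ts \<and> Suc (count_list bs True) = i - 1"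
    using 3(1)[of "i - 1"] kchain_Cons(2)[of "length ts" i z] 3(2,3) by simp
  then show ?case by auto
next
  case (4 t ts z bs)
  show ?case
  proof (cases "kdiff ts (\<lambda>cs. z (False # cs)) bs = 0")
    case True
    then have "z (True # bs) \<noteq> 0" using 4(3) by auto
    then show ?thesis using kchainD[OF 4(2)] by fastforce
  next
    case False
    then show ?thesis using 4(1)[of i] kchain_Cons(1)[of "length ts" i z] 4(2) by simp
  qed
qed simp_all

lemma kchain_kdiff:
  assumes "kchain (length ts) (Suc i) z"
  shows "kchain (length ts) i (kdiff ts z)"
  unfolding kchain_def using kdiff_nonzero[OF assms] by auto

lemma kdiff_chain_0: "kchain (length ts) 0 z \<Longrightarrow> kdiff ts z bs = 0"
  using kdiff_nonzero by blast

lemma kchain_kwedge: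
  assumes "kchain (length ts) i z" "length es = length ts"
  shows "kchain (length ts) (Suc i) (kwedge es z)"
proof -
  have "length bs = length es \<and> count_list bs True = Suc i"
    if "kchain (length es) i z" "kwedge es z bs \<noteq> 0" for bs
    using that
  proof (induction es z bs arbitrary: i rule: kwedge.induct)
    case (3 b es z bs)
    show ?case
    proof (cases "kwedge es (\<lambda>cs. z (True # cs)) bs = 0")
      case True
      then have "z (False # bs) \<noteq> 0" using 3(3) by auto
      then show ?thesis using kchainD[OF 3(2)] by fastforce
    next
      case False
      then have *: "length bs = length es \<and> count_list bs True = Suc (i - 1)"
        using 3(1)[of "i - 1"] kchain_Cons(2)[of "length es" i z] 3(2) by simp
      \<comment> \<open>For \<open>i = 0\<close> the truncated \<open>i - 1\<close> would give the
        wrong degree. In that case no list beginning with \<open>True\<close> is in the support, so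
        the inner wedge vanishes, against the case assumption.\<close>
      have "i \<noteq> 0"
      proof
        assume "i = 0"
        then have "z (True # cs) = 0" for cs
          using kchainD[OF 3(2), of "True # cs"] by auto
        then have "(\<lambda>cs. z (True # cs)) = (\<lambda>cs. 0 * 0)" by auto
        then show False using False kwedge_mult[of es 0 "\<lambda>_. 0" bs] by simp
      qed
      then show ?thesis using * by simp
    qed
  next
    case (4 b es z bs)
    then show ?case using 4(1)[of i] kchain_Cons(1)[of "length es" i z] 4(2) by simp
  qed simp_all
  then show ?thesis using assms unfolding kchain_def by simp
qed

section \<open>Koszul exactness modulo an ideal, and its dependence on depth\<close>

lemma kchain_big: "kchain n i z \<Longrightarrow> i > n \<Longrightarrow> z bs = 0"
  using kchainD[of n i z bs] count_le_length[of bs True] by linarith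

text \<open>Vanishing of the \<open>i\<close>-th Koszul homology with coefficients in the quotient
  by \<open>J\<close>, expressed with representatives. The ideal \<open>J\<close> can thus grow
  during an induction while all chains stay over one ring.\<close>

definition kexact :: "nat \<Rightarrow> 'a::comm_ring_1 list \<Rightarrow> 'a set \<Rightarrow> bool" where
  "kexact i ts J \<longleftrightarrow>
     (\<forall>z. kchain (length ts) i z \<longrightarrow> (\<forall>bs. kdiff ts z bs \<in> J) \<longrightarrow>
        (\<exists>w. kchain (length ts) (Suc i) w \<and> (\<forall>bs. z bs - kdiff ts w bs \<in> J)))"

lemma ring_ideal_mult_right:
  "ring_ideal.subspace J \<Longrightarrow> x \<in> J \<Longrightarrow> x * c \<in> J"
  using ring_ideal.subspace_scale[of J x c] by (simp add: mult.commute)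

lemma kdiff_in_ideal:
  assumes J: "ring_ideal.subspace J" and "\<And>bs. z bs \<in> J"
  shows "kdiff ts z bs \<in> J"
  using assms(2)
proof (induction ts arbitrary: z bs)
  case Nil
  then show ?case by (simp add: ring_ideal.subspace_0[OF J])
next
  case (Cons t ts)
  then show ?case
    by (cases bs rule: list.exhaust; cases "hd bs")
      (simp_all add: ring_ideal.subspace_0[OF J] ring_ideal.subspace_neg[OF J]
        ring_ideal.subspace_add[OF J] ring_ideal.subspace_scale[OF J])
qed

lemma kwedge_in_ideal:
  assumes J: "ring_ideal.subspace J" and "\<And>bs. z bs \<in> J"
  shows "kwedge ts z bs \<in> J"
  using assms(2)
proof (induction ts arbitrary: z bs)
  case Nil
  then show ?case by (simp add: ring_ideal.subspace_0[OF J])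
next
  case (Cons t ts)
  then show ?case
    by (cases bs rule: list.exhaust; cases "hd bs")
      (simp_all add: ring_ideal.subspace_0[OF J] ring_ideal.subspace_diff[OF J]
        ring_ideal.subspace_scale[OF J])
qed

lemma span_list_combination:
  assumes "a \<in> ring_ideal.span (set ts)"
  obtains es where "length es = length ts" "a = (\<Sum>(b, t)\<leftarrow>zip es ts. b * t)"
  using assms
proof (induction ts arbitrary: a thesis)
  case Nil
  then have "a = 0" by simp
  then show ?case using Nil.prems(1)[of "[]"] by simp
next
  case (Cons t ts)
  obtain k where "a - k * t \<in> ring_ideal.span (set ts)"
    using Cons.prems(2) by (auto simp: ring_ideal.span_insert)
  then obtain es where es: "length es = length ts" "a - k * t = (\<Sum>(b, t)\<leftarrow>zip es ts. b * t)"
    using Cons.IH by blast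
  have "a = (\<Sum>(b, t)\<leftarrow>zip (k # es) (t # ts). b * t)"
    using es(2) by (simp add: algebra_simps)
  then show ?case using Cons.prems(1)[of "k # es"] es(1) by simp
qed

text \<open>\<open>kdiff_kwedge\<close> speaks about lists of the right length only; at all other
  lists both sides vanish because of the supports of the chains.\<close>

lemma span_homotopy:
  assumes "a \<in> ring_ideal.span (set ts)"
  obtains es where "length es = length ts"
    "\<And>z i bs. kchain (length ts) i z \<Longrightarrow>
       kdiff ts (kwedge es z) bs + kwedge es (kdiff ts z) bs = a * z bs"
proof -
  obtain es where es: "length es = length ts" "a = (\<Sum>(b, t)\<leftarrow>zip es ts. b * t)"
    using span_list_combination[OF assms] by blast
  have "kdiff ts (kwedge es z) bs + kwedge es (kdiff ts z) bs = a * z bs"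
    if z: "kchain (length ts) i z" for z i bs
  proof (cases "length bs = length ts")
    case True
    then show ?thesis using kdiff_kwedge[OF es(1) True] es(2) by simp
  next
    case False
    have "kdiff ts (kwedge es z) bs = 0"
      using kchain_kdiff[OF kchain_kwedge[OF z es(1)]] False unfolding kchain_def by blast
    moreover have "kwedge es (kdiff ts z) bs = 0"
    proof (cases i)
      case 0
      then have "kdiff ts z = (\<lambda>cs. 0 * 0)" using kdiff_chain_0 z by fastforce
      then show ?thesis using kwedge_mult[of es 0 "\<lambda>_. 0" bs] by simp
    next
      case (Suc j)
      then show ?thesis
        using kchain_kwedge[OF kchain_kdiff, of ts j z es] z es(1) False unfolding kchain_def by blast
    qed
    moreover have "z bs = 0" using z False unfolding kchain_def by blast
    ultimately show ?thesis by simp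
  qed
  then show ?thesis using es(1) that by blast
qed

definition ideal_insert :: "'a::comm_ring_1 \<Rightarrow> 'a set \<Rightarrow> 'a set" where
  "ideal_insert a J = {y. \<exists>c. y - c * a \<in> J}"

lemma subspace_ideal_insert:
  assumes "ring_ideal.subspace J" shows "ring_ideal.subspace (ideal_insert a J)"
proof (rule ring_ideal.subspaceI)
  show "0 \<in> ideal_insert a J"
    using ring_ideal.subspace_0[OF assms] unfolding ideal_insert_def by (auto intro!: exI[of _ 0])
next
  fix x y assume "x \<in> ideal_insert a J" "y \<in> ideal_insert a J"
  then obtain c e where "x - c * a \<in> J" "y - e * a \<in> J" unfolding ideal_insert_def by blast
  then have "(x - c * a) + (y - e * a) \<in> J" by (rule ring_ideal.subspace_add[OF assms])
  moreover have "(x - c * a) + (y - e * a) = x + y - (c + e) * a" by (simp add: algebra_simps)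
  ultimately have "x + y - (c + e) * a \<in> J" by simp
  then show "x + y \<in> ideal_insert a J" unfolding ideal_insert_def by blast
next
  fix k x assume "x \<in> ideal_insert a J"
  then obtain c where "x - c * a \<in> J" unfolding ideal_insert_def by blast
  then have "k * (x - c * a) \<in> J" by (rule ring_ideal.subspace_scale[OF assms])
  then have "k * x - (k * c) * a \<in> J" by (simp only: right_diff_distrib mult.assoc)
  then show "k * x \<in> ideal_insert a J" unfolding ideal_insert_def by blast
qed

text \<open>Regularity on the quotient by \<open>J\<close>, each further quotient being encoded by a
  larger ideal of the same ring.\<close>

fun regular_mod :: "'a::comm_ring_1 set \<Rightarrow> 'a list \<Rightarrow> bool" where
  "regular_mod J [] \<longleftrightarrow> True"
| "regular_mod J (a # as) \<longleftrightarrow> (\<forall>x. a * x \<in> J \<longrightarrow> x \<in> J) \<and> regular_mod (ideal_insert a J) as"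

text \<open>Depth sensitivity. For a cycle z modulo J, wedging with e, where e represents a, gives a
  z = d(e z) modulo J. Hence e z is a cycle modulo J + (a), one degree higher, and by induction e z
  = d w + a u modulo J. Applying d yields a z = a d u modulo J, and a cancels. At the end of the
  induction the degree exceeds \<open>length ts\<close> and no nonzero chains are left.\<close>

lemma kexact_regular:
  assumes "ring_ideal.subspace J" "regular_mod J as" "set as \<subseteq> ring_ideal.span (set ts)"
    "length as + i > length ts"
  shows "kexact i ts J"
  using assms
proof (induction as arbitrary: J i)
  case Nil
  show ?case
    unfolding kexact_def
  proof (intro allI impI)
    fix z :: "bool list \<Rightarrow> 'a" assume "kchain (length ts) i z"
    then have "z bs = 0" for bs using kchain_big Nil.prems(4) by fastforce
    then show "\<exists>w. kchain (length ts) (Suc i) w \<and> (\<forall>bs. z bs - kdiff ts w bs \<in> J)"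
      using Nil.prems(1) by (intro exI[of _ "\<lambda>_. 0"]) (simp add: kdiff_0 kchain_0 ring_ideal.subspace_0)
  qed
next
  case (Cons a as)
  note J = Cons.prems(1)
  let ?J' = "ideal_insert a J"
  have ex: "kexact (Suc i) ts ?J'"
    using Cons.prems by (intro Cons.IH subspace_ideal_insert) auto
  obtain es where es: "length es = length ts" and hom: "\<And>z i bs. kchain (length ts) i z \<Longrightarrow>
       kdiff ts (kwedge es z) bs + kwedge es (kdiff ts z) bs = a * z bs"
    using span_homotopy[of a ts] Cons.prems(3) by (metis list.set_intros(1) subsetD)
  show ?case
    unfolding kexact_def
  proof (intro allI impI)
    fix z :: "bool list \<Rightarrow> 'a" assume z: "kchain (length ts) i z" and cyc: "\<forall>bs. kdiff ts z bs \<in> J"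
    have w1: "a * z bs - kdiff ts (kwedge es z) bs \<in> J" for bs
    proof -
      have "a * z bs - kdiff ts (kwedge es z) bs = kwedge es (kdiff ts z) bs"
        using hom[OF z, of bs] by (simp add: algebra_simps)
      then show ?thesis using kwedge_in_ideal[OF J] cyc by simp
    qed
    have "kdiff ts (kwedge es z) bs \<in> ?J'" for bs
    proof -
      have "kdiff ts (kwedge es z) bs - z bs * a = - (a * z bs - kdiff ts (kwedge es z) bs)"
        by (simp add: algebra_simps)
      then show ?thesis
        using ring_ideal.subspace_neg[OF J w1[of bs]] unfolding ideal_insert_def
        by (intro CollectI exI[of _ "z bs"]) metis
    qed
    then obtain w where w: "kchain (length ts) (Suc (Suc i)) w"
      "\<And>bs. kwedge es z bs - kdiff ts w bs \<in> ?J'"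
      using ex kchain_kwedge[OF z es] unfolding kexact_def by blast
    define y where "y = (\<lambda>bs. kwedge es z bs - kdiff ts w bs)"
    have y: "kchain (length ts) (Suc i) y"
      unfolding y_def by (intro kchain_diff kchain_kwedge[OF z es] kchain_kdiff[OF w(1)])
    have "\<forall>bs. \<exists>c. y bs - c * a \<in> J"
      using w(2) unfolding y_def ideal_insert_def by blast
    then obtain u0 where u0: "\<And>bs. y bs - u0 bs * a \<in> J" by metis
    \<comment> \<open>The chosen coefficients are reset to 0 wherever \<open>y\<close> vanishes;
      this confines \<open>u\<close> to the support of \<open>y\<close> and makes it a chain of the
      same degree.\<close>
    define u where "u = (\<lambda>bs. if y bs = 0 then 0 else u0 bs)"
    have u: "kchain (length ts) (Suc i) u"
      using y unfolding kchain_def u_def by auto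
    have yu: "y bs - u bs * a \<in> J" for bs
      using u0 ring_ideal.subspace_0[OF J] unfolding u_def by auto
    have "kdiff ts (\<lambda>bs. y bs - a * u bs) bs \<in> J" for bs
      by (rule kdiff_in_ideal[OF J]) (use yu in \<open>simp add: mult.commute\<close>)
    then have dy: "kdiff ts (kwedge es z) bs - a * kdiff ts u bs \<in> J" for bs
      unfolding y_def by (simp add: kdiff_diff kdiff_mult kdiff_kdiff)
    have "a * (z bs - kdiff ts u bs) \<in> J" for bs
      using ring_ideal.subspace_add[OF J w1[of bs] dy[of bs]] by (simp add: algebra_simps)
    then have "z bs - kdiff ts u bs \<in> J" for bs using Cons.prems(2) by simp
    then show "\<exists>w. kchain (length ts) (Suc i) w \<and> (\<forall>bs. z bs - kdiff ts w bs \<in> J)"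
      using u by blast
  qed
qed

definition kcone :: "(bool list \<Rightarrow> 'a::zero) \<Rightarrow> (bool list \<Rightarrow> 'a) \<Rightarrow> bool list \<Rightarrow> 'a" where
  "kcone u v bs = (case bs of [] \<Rightarrow> 0 | b # cs \<Rightarrow> if b then v cs else u cs)"

lemma kcone_simps [simp]: "kcone u v [] = 0" "kcone u v (True # cs) = v cs" "kcone u v (False # cs) = u cs"
  by (simp_all add: kcone_def)

lemma kchain_kcone:
  assumes "kchain n (Suc i) u" "kchain n i v"
  shows "kchain (Suc n) (Suc i) (kcone u v)"
  using assms unfolding kchain_def kcone_def by (auto split: list.splits)

text \<open>Multiplication by \<open>x\<close> is injective on the \<open>i\<close>-th homology of
  \<open>ts\<close>: if x z = d w modulo J, then (-w, z) is a cycle of the mapping cone, and a chain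
  bounding it has a component that bounds z up to sign. On the other hand the homotopy shows that
  \<open>x ^ N\<close> annihilates this homology. Cancelling the \<open>N\<close> factors one at a
  time shows that it is zero.\<close>

lemma kexact_remove:
  assumes J: "ring_ideal.subspace J" and ex: "kexact (Suc i) (x # ts) J"
    and nil: "x ^ N \<in> ring_ideal.span (set ts \<union> J)"
  shows "kexact i ts J"
proof -
  have step: "\<exists>w. kchain (length ts) (Suc i) w \<and> (\<forall>bs. z bs - kdiff ts w bs \<in> J)"
    if z: "kchain (length ts) i z" "\<forall>bs. kdiff ts z bs \<in> J"
      and w: "kchain (length ts) (Suc i) w" "\<forall>bs. x * z bs - kdiff ts w bs \<in> J" for z w
  proof -
    define c where "c = kcone (\<lambda>bs. - w bs) z"
    have c: "kchain (length (x # ts)) (Suc i) c"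
      unfolding c_def using kchain_kcone[OF kchain_map[OF w(1), of uminus] z(1)] by simp
    have "kdiff (x # ts) c bs \<in> J" for bs
    proof (cases bs)
      case Nil
      then show ?thesis using ring_ideal.subspace_0[OF J] by simp
    next
      case (Cons b cs)
      then show ?thesis
        using z(2) w(2) ring_ideal.subspace_neg[OF J]
        by (cases b) (auto simp: c_def kdiff_minus algebra_simps)
    qed
    then obtain e where e: "kchain (length (x # ts)) (Suc (Suc i)) e"
      "\<forall>bs. c bs - kdiff (x # ts) e bs \<in> J"
      using ex c unfolding kexact_def by blast
    have "z bs - kdiff ts (\<lambda>cs. - e (True # cs)) bs \<in> J" for bs
      using e(2)[rule_format, of "True # bs"] by (simp add: c_def kdiff_minus)
    moreover have "kchain (length ts) (Suc i) (\<lambda>cs. - e (True # cs))"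
      using kchain_Cons(2)[of "length ts" "Suc (Suc i)" e] e(1) by (intro kchain_map[where f=uminus]) simp_all
    ultimately show ?thesis by blast
  qed
  show ?thesis
    unfolding kexact_def
  proof (intro allI impI)
    fix z :: "bool list \<Rightarrow> 'a" assume z: "kchain (length ts) i z" "\<forall>bs. kdiff ts z bs \<in> J"
    obtain a j where aj: "x ^ N = a + j" "a \<in> ring_ideal.span (set ts)" "j \<in> J"
      using nil J ring_ideal.span_eq_iff[of J] unfolding ring_ideal.span_Un by blast
    obtain es where es: "length es = length ts" and hom: "\<And>z i bs. kchain (length ts) i z \<Longrightarrow>
       kdiff ts (kwedge es z) bs + kwedge es (kdiff ts z) bs = a * z bs"
      using span_homotopy[OF aj(2)] by blast
    have "\<exists>w. kchain (length ts) (Suc i) w \<and> (\<forall>bs. x ^ N * z bs - kdiff ts w bs \<in> J)"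
    proof (intro exI conjI allI)
      show "kchain (length ts) (Suc i) (kwedge es z)" by (rule kchain_kwedge[OF z(1) es])
      fix bs
      have "x ^ N * z bs - kdiff ts (kwedge es z) bs = kwedge es (kdiff ts z) bs + z bs * j"
        using hom[OF z(1), of bs] aj(1) by (simp add: algebra_simps)
      then show "x ^ N * z bs - kdiff ts (kwedge es z) bs \<in> J"
        using kwedge_in_ideal[OF J] z(2) aj(3) J
        by (simp add: ring_ideal.subspace_add ring_ideal.subspace_scale)
    qed
    then show "\<exists>w. kchain (length ts) (Suc i) w \<and> (\<forall>bs. z bs - kdiff ts w bs \<in> J)"
    proof (induction N)
      case (Suc N)
      have "kchain (length ts) i (\<lambda>bs. x ^ N * z bs)" by (rule kchain_mult[OF z(1)])
      moreover have "\<forall>bs. kdiff ts (\<lambda>bs. x ^ N * z bs) bs \<in> J"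
        using z(2) ring_ideal.subspace_scale[OF J] unfolding kdiff_mult by blast
      moreover obtain w where "kchain (length ts) (Suc i) w"
        "\<forall>bs. x * (x ^ N * z bs) - kdiff ts w bs \<in> J"
        using Suc.prems unfolding power_Suc mult.assoc by blast
      ultimately show ?case by (intro Suc.IH step)
    qed simp
  qed
qed

text \<open>Each dropped form costs one homological degree, hence the shift by
  \<open>length xs\<close>.\<close>

lemma kexact_remove_list:
  assumes J: "ring_ideal.subspace J" and "kexact (i + length xs) (xs @ ts) J"
    and nil: "\<And>x. x \<in> set xs \<Longrightarrow> x ^ N \<in> ring_ideal.span (set ts \<union> J)"
  shows "kexact i ts J"
  using assms(2,3)
proof (induction xs)
  case (Cons x xs)
  have "ring_ideal.span (set ts \<union> J) \<subseteq> ring_ideal.span (set (xs @ ts) \<union> J)"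
    by (rule ring_ideal.span_mono) auto
  then have "x ^ N \<in> ring_ideal.span (set (xs @ ts) \<union> J)"
    using Cons.prems(2) by auto
  then have "kexact (i + length xs) (xs @ ts) J"
    using Cons.prems(1) kexact_remove[OF J] by simp
  then show ?case using Cons.IH Cons.prems(2) by simp
qed simp

text \<open>Apply depth sensitivity to \<open>xs @ ts\<close>, whose span contains the regular
  sequence. Since \<open>as\<close> is at least as long as \<open>ts\<close>, exactness starts just
  above degree \<open>length xs\<close>; dropping \<open>xs\<close> brings this down to all positive
  degrees.\<close>

theorem kexact_parameters:
  assumes J: "ring_ideal.subspace J" and "regular_mod J as"
    and "set as \<subseteq> ring_ideal.span (set xs)" and "length ts \<le> length as" and "i > 0"
    and "\<And>x. x \<in> set xs \<Longrightarrow> x ^ N \<in> ring_ideal.span (set ts \<union> J)"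
  shows "kexact i ts J"
proof (rule kexact_remove_list[OF J])
  have "ring_ideal.span (set xs) \<subseteq> ring_ideal.span (set (xs @ ts))"
    by (rule ring_ideal.span_mono) auto
  then show "kexact (i + length xs) (xs @ ts) J"
    using assms by (intro kexact_regular[of J as]) auto
qed (rule assms(6))


section \<open>Graded Koszul exactness\<close>

text \<open>One projection with three roles: homogeneous component, restriction to a coordinate
  subspace, and normal form modulo the face ideal.\<close>

definition mrestrict :: "('a \<Rightarrow> bool) \<Rightarrow> ('a \<Rightarrow>\<^sub>0 'b::zero) \<Rightarrow> 'a \<Rightarrow>\<^sub>0 'b" where
  "mrestrict P f = Abs_poly_mapping (\<lambda>m. Poly_Mapping.lookup f m when P m)"

lemma lookup_mrestrict: "Poly_Mapping.lookup (mrestrict P f) m = (Poly_Mapping.lookup f m when P m)"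
proof -
  have "finite {m. (Poly_Mapping.lookup f m when P m) \<noteq> 0}"
    by (rule finite_subset[OF _ finite_lookup[of f]]) auto
  then show ?thesis by (simp add: mrestrict_def)
qed

lemma keys_mrestrict: "Poly_Mapping.keys (mrestrict P f) = {m \<in> Poly_Mapping.keys f. P m}"
  by (auto simp: in_keys_iff lookup_mrestrict)

lemma mrestrict_0 [simp]: "mrestrict P 0 = 0"
  by (rule poly_mapping_eqI) (simp add: lookup_mrestrict)

lemma mrestrict_add: "mrestrict P (f + g) = mrestrict P f + mrestrict P (g :: 'a \<Rightarrow>\<^sub>0 'b::monoid_add)"
  by (rule poly_mapping_eqI) (simp add: lookup_mrestrict lookup_add when_def)

lemma mrestrict_minus: "mrestrict P (- f) = - mrestrict P (f :: 'a \<Rightarrow>\<^sub>0 'b::ab_group_add)"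
  by (rule poly_mapping_eqI) (simp add: lookup_mrestrict when_def)

lemma mrestrict_diff: "mrestrict P (f - g) = mrestrict P f - mrestrict P (g :: 'a \<Rightarrow>\<^sub>0 'b::ab_group_add)"
  by (rule poly_mapping_eqI) (simp add: lookup_mrestrict lookup_minus when_def)

lemma mrestrict_id: "(\<And>m. m \<in> Poly_Mapping.keys f \<Longrightarrow> P m) \<Longrightarrow> mrestrict P f = f"
  by (rule poly_mapping_eqI) (auto simp: lookup_mrestrict when_def in_keys_iff)

lemma mrestrict_eq_0: "(\<And>m. m \<in> Poly_Mapping.keys f \<Longrightarrow> \<not> P m) \<Longrightarrow> mrestrict P f = 0"
  by (rule poly_mapping_eqI) (auto simp: lookup_mrestrict when_def in_keys_iff)

lemma mrestrict_mrestrict: "mrestrict P (mrestrict Q f) = mrestrict (\<lambda>m. P m \<and> Q m) f"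
  by (rule poly_mapping_eqI) (auto simp: lookup_mrestrict when_def)

lemma mrestrict_split: "f = mrestrict P f + mrestrict (\<lambda>m. \<not> P m) (f :: 'a \<Rightarrow>\<^sub>0 'b::monoid_add)"
  by (rule poly_mapping_eqI) (simp add: lookup_mrestrict lookup_add when_def)

lemma mrestrict_sum:
  "mrestrict P (\<Sum>i\<in>I. f i :: 'a \<Rightarrow>\<^sub>0 'b::comm_monoid_add) = (\<Sum>i\<in>I. mrestrict P (f i))"
  by (induction I rule: infinite_finite_induct) (simp_all add: mrestrict_add)

lemma mrestrict_single: "mrestrict P (Poly_Mapping.single m c) = (if P m then Poly_Mapping.single m c else 0)"
  by (rule poly_mapping_eqI) (auto simp: lookup_mrestrict when_def lookup_single)

lemma poly_mapping_as_sum: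
  "f = (\<Sum>m\<in>Poly_Mapping.keys f. Poly_Mapping.single m (Poly_Mapping.lookup f m))"
  by (rule poly_mapping_eqI) (auto simp: lookup_sum lookup_single when_def in_keys_iff)

lemma keys_add_nat: "Poly_Mapping.keys (a + b) = Poly_Mapping.keys a \<union> Poly_Mapping.keys (b :: 'a \<Rightarrow>\<^sub>0 nat)"
  by (auto simp: in_keys_iff lookup_add)

definition mdeg :: "(nat \<Rightarrow>\<^sub>0 nat) \<Rightarrow> nat" where
  "mdeg m = (\<Sum>i\<in>Poly_Mapping.keys m. Poly_Mapping.lookup m i)"

lemma mdeg_superset: "finite A \<Longrightarrow> Poly_Mapping.keys m \<subseteq> A \<Longrightarrow> mdeg m = (\<Sum>i\<in>A. Poly_Mapping.lookup m i)"
  unfolding mdeg_def by (rule sum.mono_neutral_left) (auto simp: in_keys_iff)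

lemma mdeg_add: "mdeg (a + b) = mdeg a + mdeg b"
proof -
  let ?A = "Poly_Mapping.keys a \<union> Poly_Mapping.keys b"
  show ?thesis
    by (simp add: mdeg_superset[of ?A] keys_add_nat lookup_add sum.distrib)
qed

lemma mdeg_0 [simp]: "mdeg 0 = 0" by (simp add: mdeg_def)

lemma mdeg_single [simp]: "mdeg (Poly_Mapping.single i k) = k"
  by (simp add: mdeg_def)

lemma mdeg_eq_0 [simp]: "mdeg m = 0 \<longleftrightarrow> m = 0"
  unfolding mdeg_def by (auto simp: in_keys_iff intro!: poly_mapping_eqI)

definition homogeneous :: "nat \<Rightarrow> ((nat \<Rightarrow>\<^sub>0 nat) \<Rightarrow>\<^sub>0 'k::zero) \<Rightarrow> bool" where
  "homogeneous D f \<longleftrightarrow> (\<forall>m\<in>Poly_Mapping.keys f. mdeg m = D)"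

definition hcomp :: "nat \<Rightarrow> ((nat \<Rightarrow>\<^sub>0 nat) \<Rightarrow>\<^sub>0 'k::zero) \<Rightarrow> (nat \<Rightarrow>\<^sub>0 nat) \<Rightarrow>\<^sub>0 'k" where
  "hcomp D = mrestrict (\<lambda>m. mdeg m = D)"

lemma homogeneous_hcomp: "homogeneous D (hcomp D f)"
  by (auto simp: homogeneous_def hcomp_def keys_mrestrict)

lemma hcomp_id: "homogeneous D f \<Longrightarrow> hcomp D f = f"
  unfolding hcomp_def homogeneous_def by (rule mrestrict_id) auto

lemma hcomp_0 [simp]: "hcomp D 0 = 0" by (simp add: hcomp_def)

lemma hcomp_add: "hcomp D (f + g) = hcomp D f + hcomp D (g :: _ \<Rightarrow>\<^sub>0 'k::monoid_add)"
  by (simp add: hcomp_def mrestrict_add)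

lemma hcomp_diff: "hcomp D (f - g) = hcomp D f - hcomp D (g :: _ \<Rightarrow>\<^sub>0 'k::ab_group_add)"
  by (simp add: hcomp_def mrestrict_diff)

lemma hcomp_minus: "hcomp D (- f) = - hcomp D (f :: _ \<Rightarrow>\<^sub>0 'k::ab_group_add)"
  by (simp add: hcomp_def mrestrict_minus)

lemma homogeneous_0 [simp]: "homogeneous D 0" by (simp add: homogeneous_def)

lemma homogeneous_add:
  "homogeneous D f \<Longrightarrow> homogeneous D g \<Longrightarrow> homogeneous D (f + g :: _ \<Rightarrow>\<^sub>0 'k::monoid_add)"
  unfolding homogeneous_def using Poly_Mapping.keys_add[of f g] by blast

lemma homogeneous_sum:
  "(\<And>i. i \<in> I \<Longrightarrow> homogeneous D (f i)) \<Longrightarrow> homogeneous D (\<Sum>i\<in>I. f i :: _ \<Rightarrow>\<^sub>0 'k::comm_monoid_add)"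
  by (induction I rule: infinite_finite_induct) (simp_all add: homogeneous_add)

lemma homogeneous_mult:
  "homogeneous D f \<Longrightarrow> homogeneous E g \<Longrightarrow> homogeneous (D + E) (f * g :: _ \<Rightarrow>\<^sub>0 'k::comm_ring_1)"
  unfolding homogeneous_def using Poly_Mapping.keys_mult[of f g] by (fastforce simp: mdeg_add)

lemma homogeneous_single: "homogeneous (mdeg m) (Poly_Mapping.single m c)"
  by (simp add: homogeneous_def)

lemma homogeneous_1 [simp]: "homogeneous 0 (1 :: _ \<Rightarrow>\<^sub>0 'k::comm_ring_1)"
  by (simp add: homogeneous_def)

lemma homogeneous_power:
  "homogeneous D f \<Longrightarrow> homogeneous (N * D) (f ^ N :: _ \<Rightarrow>\<^sub>0 'k::comm_ring_1)"
  by (induction N) (auto dest: homogeneous_mult)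

lemma hcomp_mult:
  fixes t f :: "(nat \<Rightarrow>\<^sub>0 nat) \<Rightarrow>\<^sub>0 'k::comm_ring_1"
  assumes "homogeneous E t"
  shows "hcomp (E + D) (t * f) = t * hcomp D f"
proof -
  let ?g = "mrestrict (\<lambda>m. mdeg m \<noteq> D) f"
  have "mdeg m \<noteq> E + D" if m: "m \<in> Poly_Mapping.keys (t * ?g)" for m
  proof -
    obtain a b where "m = a + b" "a \<in> Poly_Mapping.keys t" "b \<in> Poly_Mapping.keys ?g"
      using m Poly_Mapping.keys_mult[of t ?g] by blast
    then show ?thesis using assms by (auto simp: homogeneous_def mdeg_add keys_mrestrict)
  qed
  then have "hcomp (E + D) (t * ?g) = 0"
    unfolding hcomp_def by (rule mrestrict_eq_0)
  moreover have "t * f = t * hcomp D f + t * ?g"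
    using mrestrict_split[of f "\<lambda>m. mdeg m = D"] unfolding hcomp_def by (metis distrib_left)
  moreover have "hcomp (E + D) (t * hcomp D f) = t * hcomp D f"
    by (intro hcomp_id homogeneous_mult assms homogeneous_hcomp)
  ultimately show ?thesis by (simp add: hcomp_add)
qed

lemma hcomp_mult_less:
  fixes t f :: "(nat \<Rightarrow>\<^sub>0 nat) \<Rightarrow>\<^sub>0 'k::comm_ring_1"
  assumes "homogeneous E t" "D < E"
  shows "hcomp D (t * f) = 0"
  unfolding hcomp_def
proof (rule mrestrict_eq_0)
  fix m assume "m \<in> Poly_Mapping.keys (t * f)"
  then obtain a b where "m = a + b" "a \<in> Poly_Mapping.keys t"
    using Poly_Mapping.keys_mult[of t f] by blast
  then show "mdeg m \<noteq> D" using assms by (auto simp: homogeneous_def mdeg_add)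
qed

lemma kdiff_hcomp:
  assumes "\<And>t. t \<in> set ts \<Longrightarrow> homogeneous 1 t"
  shows "hcomp (Suc D) (kdiff ts z bs) = kdiff ts (\<lambda>cs. hcomp D (z cs)) bs"
  using assms
proof (induction ts arbitrary: z bs)
  case (Cons t ts)
  then show ?case
    using hcomp_mult[of 1 t D]
    by (cases bs rule: list.exhaust; cases "hd bs") (simp_all add: hcomp_add hcomp_minus)
qed simp

lemma kdiff_hcomp_0:
  assumes "\<And>t. t \<in> set ts \<Longrightarrow> homogeneous 1 t"
  shows "hcomp 0 (kdiff ts z bs) = 0"
  using assms
proof (induction ts arbitrary: z bs)
  case (Cons t ts)
  then show ?case
    using hcomp_mult_less[of 1 t 0]
    by (cases bs rule: list.exhaust; cases "hd bs") (simp_all add: hcomp_add hcomp_minus)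
qed simp

text \<open>Only cycles that are homogeneous in the polynomial grading are tested, which allows
  induction on \<open>D\<close>. The bounding chain \<open>w\<close> is unrestricted; where a degree
  matters, its components are extracted with \<open>hcomp\<close>.\<close>

definition hexact :: "((nat \<Rightarrow>\<^sub>0 nat) \<Rightarrow>\<^sub>0 'k::comm_ring_1) list \<Rightarrow> ((nat \<Rightarrow>\<^sub>0 nat) \<Rightarrow>\<^sub>0 'k) set \<Rightarrow> bool" where
  "hexact ts J \<longleftrightarrow>
     (\<forall>D z. kchain (length ts) 1 z \<longrightarrow> (\<forall>bs. homogeneous D (z bs)) \<longrightarrow> (\<forall>bs. kdiff ts z bs \<in> J) \<longrightarrow>
        (\<exists>w. kchain (length ts) 2 w \<and> (\<forall>bs. z bs - kdiff ts w bs \<in> J)))"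

lemma kexact_imp_hexact: "kexact 1 ts J \<Longrightarrow> hexact ts J"
  unfolding hexact_def kexact_def by (metis Suc_1 One_nat_def)

text \<open>By the cone sequence, exactness for \<open>t # ts\<close> makes multiplication by
  \<open>t\<close> surjective on the first homology of \<open>ts\<close>. As \<open>t\<close> raises
  the degree, graded Nakayama forces this homology to vanish: z = d eF + t eT modulo J with a cycle
  eT of lower degree, which is a boundary d w by induction, so z is bounded by eF + t w.\<close>

lemma hexact_Cons:
  fixes J :: "((nat \<Rightarrow>\<^sub>0 nat) \<Rightarrow>\<^sub>0 'k::comm_ring_1) set"
  assumes J: "ring_ideal.subspace J" "\<And>D f. f \<in> J \<Longrightarrow> hcomp D f \<in> J"
    and hom: "\<And>s. s \<in> set (t # ts) \<Longrightarrow> homogeneous 1 s"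
    and ex: "hexact (t # ts) J"
  shows "hexact ts J"
proof -
  have "\<exists>w. kchain (length ts) 2 w \<and> (\<forall>bs. z bs - kdiff ts w bs \<in> J)"
    if "kchain (length ts) 1 z" "\<forall>bs. homogeneous D (z bs)" "\<forall>bs. kdiff ts z bs \<in> J" for D z
    using that
  proof (induction D arbitrary: z)
    case (0 z)
    define c where "c = kcone z (\<lambda>_. 0)"
    have c: "kchain (length (t # ts)) 1 c"
      unfolding c_def using kchain_kcone[OF _ kchain_0, of "length ts" 0 z] 0(1) by simp
    have ch: "\<forall>bs. homogeneous 0 (c bs)"
      using 0(2) by (simp add: c_def kcone_def split: list.splits)
    have "kdiff (t # ts) c bs \<in> J" for bs
      using 0(3) ring_ideal.subspace_0[OF J(1)]
      by (cases bs rule: list.exhaust; cases "hd bs") (simp_all add: c_def kdiff_0)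
    then obtain e where e: "\<And>bs. c bs - kdiff (t # ts) e bs \<in> J"
      using ex c ch unfolding hexact_def by blast
    \<comment> \<open>All forms have degree one, so a boundary has no component of degree 0 and
      comparison in degree 0 already puts \<open>z\<close> into \<open>J\<close>.\<close>
    have "z bs \<in> J" for bs
    proof -
      have "hcomp 0 (c (False # bs) - kdiff (t # ts) e (False # bs)) \<in> J"
        by (rule J(2)[OF e])
      moreover have "hcomp 0 (kdiff (t # ts) e (False # bs)) = 0"
        by (rule kdiff_hcomp_0) (rule hom)
      ultimately show ?thesis
        using 0(2) by (simp add: c_def hcomp_diff hcomp_id del: kdiff.simps)
    qed
    then show ?case by (intro exI[of _ "\<lambda>_. 0"]) (simp add: kchain_0 kdiff_0)
  next
    case (Suc D z)
    define c where "c = kcone z (\<lambda>_. 0)"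
    have c: "kchain (length (t # ts)) 1 c"
      unfolding c_def using kchain_kcone[OF _ kchain_0, of "length ts" 0 z] Suc.prems(1) by simp
    have ch: "\<forall>bs. homogeneous (Suc D) (c bs)"
      using Suc.prems(2) by (simp add: c_def kcone_def split: list.splits)
    have "kdiff (t # ts) c bs \<in> J" for bs
      using Suc.prems(3) ring_ideal.subspace_0[OF J(1)]
      by (cases bs rule: list.exhaust; cases "hd bs") (simp_all add: c_def kdiff_0)
    then obtain e where e: "kchain (length (t # ts)) 2 e" "\<And>bs. c bs - kdiff (t # ts) e bs \<in> J"
      using ex c ch unfolding hexact_def by blast
    \<comment> \<open>\<open>kdiff\<close> raises the polynomial degree by one, so the components of
      degree \<open>D\<close> of \<open>e\<close> suffice to bound a cycle of degree
      \<open>Suc D\<close>.\<close>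
    define eF where "eF = (\<lambda>bs. hcomp D (e (False # bs)))"
    define eT where "eT = (\<lambda>bs. hcomp D (e (True # bs)))"
    have eF: "kchain (length ts) 2 eF"
      unfolding eF_def using kchain_Cons(1)[of "length ts" 2 e] e(1)
      by (intro kchain_map[where f="hcomp D"]) simp_all
    have eT: "kchain (length ts) 1 eT"
      unfolding eT_def using kchain_Cons(2)[of "length ts" 2 e] e(1)
      by (intro kchain_map[where f="hcomp D"]) simp_all
    have 1: "z bs - (kdiff ts eF bs + t * eT bs) \<in> J" for bs
    proof -
      have "hcomp (Suc D) (c (False # bs) - kdiff (t # ts) e (False # bs)) \<in> J"
        by (rule J(2)[OF e(2)])
      moreover have "hcomp (Suc D) (kdiff (t # ts) e (False # bs)) =
          kdiff (t # ts) (\<lambda>bs. hcomp D (e bs)) (False # bs)"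
        by (rule kdiff_hcomp) (rule hom)
      ultimately show ?thesis
        unfolding hcomp_diff using Suc.prems(2)
        by (simp add: c_def hcomp_id eF_def eT_def)
    qed
    have 2: "kdiff ts eT bs \<in> J" for bs
    proof -
      have "hcomp (Suc D) (c (True # bs) - kdiff (t # ts) e (True # bs)) \<in> J"
        by (rule J(2)[OF e(2)])
      moreover have "hcomp (Suc D) (kdiff (t # ts) e (True # bs)) =
          kdiff (t # ts) (\<lambda>bs. hcomp D (e bs)) (True # bs)"
        by (rule kdiff_hcomp) (rule hom)
      ultimately show ?thesis
        unfolding hcomp_diff by (simp add: c_def eT_def)
    qed
    obtain w where w: "kchain (length ts) 2 w" "\<And>bs. eT bs - kdiff ts w bs \<in> J"
      using Suc.IH[of eT] eT 2 homogeneous_hcomp unfolding eT_def by blast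
    have "z bs - kdiff ts (\<lambda>bs. eF bs + t * w bs) bs \<in> J" for bs
    proof -
      have "z bs - kdiff ts (\<lambda>bs. eF bs + t * w bs) bs =
          (z bs - (kdiff ts eF bs + t * eT bs)) + t * (eT bs - kdiff ts w bs)"
        by (simp add: kdiff_add kdiff_mult right_diff_distrib)
      then show ?thesis
        by (simp only: ring_ideal.subspace_add[OF J(1) 1 ring_ideal.subspace_scale[OF J(1) w(2)]])
    qed
    moreover have "kchain (length ts) 2 (\<lambda>bs. eF bs + t * w bs)"
      by (intro kchain_add eF kchain_mult w(1))
    ultimately show ?case by blast
  qed
  then show ?thesis unfolding hexact_def by blast
qed

lemma kdiff_in_span: "kdiff ts z bs \<in> ring_ideal.span (set ts)"
proof (induction ts arbitrary: z bs)
  case (Cons t ts)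
  have "ring_ideal.span (set ts) \<subseteq> ring_ideal.span (set (t # ts))"
    by (rule ring_ideal.span_mono) auto
  then have *: "kdiff ts y cs \<in> ring_ideal.span (insert t (set ts))" for y cs
    using Cons.IH by auto
  have "t \<in> ring_ideal.span (insert t (set ts))"
    by (rule ring_ideal.span_base) simp
  then have "t * r \<in> ring_ideal.span (insert t (set ts))" for r
    using ring_ideal.span_scale[of t _ r] by (simp add: mult.commute)
  then show ?case
    using * by (cases bs rule: list.exhaust; cases "hd bs")
      (simp_all add: ring_ideal.span_zero ring_ideal.span_neg ring_ideal.span_add)
qed (simp add: ring_ideal.span_zero)

text \<open>A relation t a = s + j with s in the span of \<open>ts\<close> is a 1-cycle of the cone
  modulo J: its coefficient at the basis vector of \<open>t\<close> is a, and the remaining ones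
  come from writing -s in terms of \<open>ts\<close>. If it is a boundary, then its coefficient at
  \<open>t\<close> lies in the ideal of \<open>ts\<close> and J.\<close>

lemma hexact_nonzerodivisor:
  fixes J :: "((nat \<Rightarrow>\<^sub>0 nat) \<Rightarrow>\<^sub>0 'k::comm_ring_1) set"
  assumes J: "ring_ideal.subspace J" "\<And>D f. f \<in> J \<Longrightarrow> hcomp D f \<in> J"
    and hom: "\<And>s. s \<in> set (t # ts) \<Longrightarrow> homogeneous 1 s"
    and ex: "hexact (t # ts) J"
    and a: "homogeneous D a" "t * a \<in> ring_ideal.span (set ts \<union> J)"
  shows "a \<in> ring_ideal.span (set ts \<union> J)"
proof -
  obtain s j where sj: "t * a = s + j" "s \<in> ring_ideal.span (set ts)" "j \<in> J"
    using a(2) J(1) ring_ideal.span_eq_iff[of J] unfolding ring_ideal.span_Un by blast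
  obtain es where es: "length es = length ts" and homt: "\<And>z i bs. kchain (length ts) i z \<Longrightarrow>
     kdiff ts (kwedge es z) bs + kwedge es (kdiff ts z) bs = s * z bs"
    using span_homotopy[OF sj(2)] by blast
  \<comment> \<open>The unit 0-chain: coefficient 1 at the empty wedge product, which is the list
    without \<open>True\<close>.\<close>
  define u where "u = (\<lambda>bs. if bs = replicate (length ts) False then 1 else 0 :: (nat \<Rightarrow>\<^sub>0 nat) \<Rightarrow>\<^sub>0 'k)"
  have u: "kchain (length ts) 0 u"
    unfolding u_def kchain_def by (simp add: count_list_0_iff)
  have "kdiff ts u = (\<lambda>bs. 0 * 0)" using kdiff_chain_0[OF u] by auto
  then have "kwedge es (kdiff ts u) bs = 0" for bs
    using kwedge_mult[of es 0 "\<lambda>_. 0" bs] by simp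
  then have du: "kdiff ts (kwedge es u) bs = s * u bs" for bs
    using homt[OF u, of bs] by simp
  define c where "c = kcone (\<lambda>bs. - kwedge es u bs) (\<lambda>bs. a * u bs)"
  have c: "kchain (length (t # ts)) 1 c"
    using kchain_kcone[OF kchain_map[OF kchain_kwedge[OF u es], of uminus] kchain_mult[OF u, of a]]
    by (simp add: c_def)
  have dc: "kdiff (t # ts) c bs \<in> J" for bs
  proof (cases bs)
    case Nil
    then show ?thesis by (simp add: ring_ideal.subspace_0[OF J(1)])
  next
    case (Cons b cs)
    have "t * (a * u cs) - s * u cs = (t * a - s) * u cs"
      by (simp only: left_diff_distrib mult.assoc)
    also have "\<dots> = u cs * j" unfolding sj(1) by (simp add: mult.commute)
    finally have "t * (a * u cs) - s * u cs = u cs * j" .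
    then have "t * (a * u cs) - s * u cs \<in> J"
      using ring_ideal.subspace_scale[OF J(1) sj(3)] by simp
    then show ?thesis
      using Cons by (cases b)
        (simp_all add: c_def kdiff_minus kdiff_mult du kdiff_chain_0[OF u] ring_ideal.subspace_0[OF J(1)])
  qed
  \<comment> \<open>Passing to degree \<open>D\<close> yields a homogeneous cycle, as
    \<open>hexact\<close> demands, and leaves the decisive coefficient \<open>a\<close> unchanged
    because \<open>a\<close> is homogeneous.\<close>
  let ?c = "\<lambda>bs. hcomp D (c bs)"
  have "kchain (length (t # ts)) 1 ?c"
    by (rule kchain_map[OF c]) simp
  moreover have "\<forall>bs. homogeneous D (?c bs)" by (simp add: homogeneous_hcomp)
  moreover have "\<forall>bs. kdiff (t # ts) ?c bs \<in> J"
    using J(2)[OF dc, of "Suc D"] kdiff_hcomp[of "t # ts" D c] hom by metis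
  ultimately obtain e where e: "\<And>bs. ?c bs - kdiff (t # ts) e bs \<in> J"
    using ex unfolding hexact_def by blast
  let ?f = "replicate (length ts) False"
  let ?d = "kdiff ts (\<lambda>cs. e (True # cs)) ?f"
  have "a + ?d \<in> J"
    using e[of "True # ?f"] hcomp_id[OF a(1)] by (simp add: c_def u_def)
  then have "a + ?d \<in> ring_ideal.span (set ts \<union> J)"
    by (intro ring_ideal.span_base) simp
  moreover have "?d \<in> ring_ideal.span (set ts \<union> J)"
    using kdiff_in_span[of ts] ring_ideal.span_mono[of "set ts" "set ts \<union> J"] by blast
  ultimately show ?thesis using ring_ideal.span_diff by fastforce
qed

section \<open>Evaluation of polynomials at a point\<close>

definition peval :: "(nat \<Rightarrow> 'k) \<Rightarrow> ((nat \<Rightarrow>\<^sub>0 nat) \<Rightarrow>\<^sub>0 'k::comm_ring_1) \<Rightarrow> 'k" where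
  "peval p f = (\<Sum>m\<in>Poly_Mapping.keys f. Poly_Mapping.lookup f m *
     (\<Prod>i\<in>Poly_Mapping.keys m. p i ^ Poly_Mapping.lookup m i))"

lemma peval_superset:
  "finite A \<Longrightarrow> Poly_Mapping.keys f \<subseteq> A \<Longrightarrow> peval p f = (\<Sum>m\<in>A. Poly_Mapping.lookup f m *
     (\<Prod>i\<in>Poly_Mapping.keys m. p i ^ Poly_Mapping.lookup m i))"
  unfolding peval_def by (rule sum.mono_neutral_left) (auto simp: in_keys_iff)

lemma peval_0 [simp]: "peval p 0 = 0"
  by (simp add: peval_def)

lemma peval_add: "peval p (f + g) = peval p f + peval p g"
proof -
  let ?A = "Poly_Mapping.keys f \<union> Poly_Mapping.keys g"
  show ?thesis
    using Poly_Mapping.keys_add[of f g]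
    by (simp add: peval_superset[of ?A] lookup_add distrib_right sum.distrib)
qed

lemma peval_sum: "peval p (\<Sum>i\<in>I. f i) = (\<Sum>i\<in>I. peval p (f i))"
  by (induction I rule: infinite_finite_induct) (simp_all add: peval_add)

lemma peval_single:
  "peval p (Poly_Mapping.single m c) = c * (\<Prod>i\<in>Poly_Mapping.keys m. p i ^ Poly_Mapping.lookup m i)"
  by (simp add: peval_def)

lemma peval_mult: "peval p (f * g) = peval p f * peval p g"
proof -
  have mon: "(\<Prod>i\<in>Poly_Mapping.keys (a + b). p i ^ Poly_Mapping.lookup (a + b) i) =
     (\<Prod>i\<in>Poly_Mapping.keys a. p i ^ Poly_Mapping.lookup a i) *
     (\<Prod>i\<in>Poly_Mapping.keys b. p i ^ Poly_Mapping.lookup b i)" for a b :: "nat \<Rightarrow>\<^sub>0 nat"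
  proof -
    have *: "(\<Prod>i\<in>Poly_Mapping.keys c. p i ^ Poly_Mapping.lookup c i) =
        (\<Prod>i\<in>Poly_Mapping.keys a \<union> Poly_Mapping.keys b. p i ^ Poly_Mapping.lookup c i)"
      if "Poly_Mapping.keys c \<subseteq> Poly_Mapping.keys a \<union> Poly_Mapping.keys b" for c :: "nat \<Rightarrow>\<^sub>0 nat"
      using that by (intro prod.mono_neutral_left) (auto simp: in_keys_iff)
    have "(\<Prod>i\<in>Poly_Mapping.keys (a + b). p i ^ Poly_Mapping.lookup (a + b) i) =
        (\<Prod>i\<in>Poly_Mapping.keys a \<union> Poly_Mapping.keys b.
           p i ^ Poly_Mapping.lookup a i * p i ^ Poly_Mapping.lookup b i)"
      by (simp only: keys_add_nat lookup_add power_add)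
    also have "\<dots> = (\<Prod>i\<in>Poly_Mapping.keys a \<union> Poly_Mapping.keys b. p i ^ Poly_Mapping.lookup a i) *
        (\<Prod>i\<in>Poly_Mapping.keys a \<union> Poly_Mapping.keys b. p i ^ Poly_Mapping.lookup b i)"
      by (rule prod.distrib)
    finally show ?thesis
      by (simp only: *[OF Un_upper1] *[OF Un_upper2])
  qed
  have ss: "peval p (Poly_Mapping.single a c * Poly_Mapping.single b d) =
     peval p (Poly_Mapping.single a c) * peval p (Poly_Mapping.single b d)" for a b c d
    by (simp only: mult_single peval_single mon mult_ac)
  have sg: "peval p (Poly_Mapping.single a c * g) = peval p (Poly_Mapping.single a c) * peval p g" for a c
  proof -
    have "peval p (Poly_Mapping.single a c * g) =
      peval p (\<Sum>m\<in>Poly_Mapping.keys g. Poly_Mapping.single a c * Poly_Mapping.single m (Poly_Mapping.lookup g m))"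
      by (subst poly_mapping_as_sum[of g]) (simp add: sum_distrib_left)
    also have "\<dots> = peval p (Poly_Mapping.single a c) *
        peval p (\<Sum>m\<in>Poly_Mapping.keys g. Poly_Mapping.single m (Poly_Mapping.lookup g m))"
      by (simp only: peval_sum ss sum_distrib_left)
    finally show ?thesis by (simp flip: poly_mapping_as_sum)
  qed
  have "peval p (f * g) =
      peval p (\<Sum>m\<in>Poly_Mapping.keys f. Poly_Mapping.single m (Poly_Mapping.lookup f m) * g)"
    by (subst poly_mapping_as_sum[of f]) (simp add: sum_distrib_right)
  also have "\<dots> = peval p (\<Sum>m\<in>Poly_Mapping.keys f. Poly_Mapping.single m (Poly_Mapping.lookup f m)) * peval p g"
    by (simp only: peval_sum sg sum_distrib_right)
  finally show ?thesis by (simp flip: poly_mapping_as_sum)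
qed

lemma peval_1 [simp]: "peval p 1 = 1"
  by (simp add: peval_def)

lemma peval_var_poly [simp]: "peval p (var_poly i) = p i"
  by (simp add: peval_single var_poly_def)


section \<open>Quotient rings\<close>

text \<open>Presents a ring with explicit carrier as a quotient of a type class ring. Ideals and
  regular sequences can then be pulled back along \<open>q\<close> to the type on which the Koszul
  lemmas work.\<close>

locale ring_epi = cring A for A (structure) +
  fixes q :: "'r::comm_ring_1 \<Rightarrow> 'a"
  assumes q_range: "range q = carrier A"
    and q_add: "q (f + g) = q f \<oplus> q g"
    and q_mult: "q (f * g) = q f \<otimes> q g"
    and q_one: "q 1 = \<one>"
begin

lemma q_closed [simp, intro]: "q f \<in> carrier A"
  using q_range by blast

lemma q_zero: "q 0 = \<zero>"
  using q_add[of 0 0] q_closed[of 0] by (metis add.r_cancel_one' add_0)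

lemma q_minus: "q (- f) = \<ominus> q f"
  using q_add[of "- f" f] by (simp add: q_zero minus_equality)

lemma q_diff: "q (f - g) = q f \<ominus> q g"
  using q_add[of f "- g"] by (simp add: q_minus a_minus_def)

lemma q_eq_iff: "q f = q g \<longleftrightarrow> q (f - g) = \<zero>"
  by (simp add: q_diff)

lemma ideal_image:
  assumes p: "ring_ideal.subspace p" shows "ideal (q ` p) A"
proof (rule idealI[OF ring_axioms])
  show "subgroup (q ` p) (add_monoid A)"
  proof
    fix x y assume "x \<in> q ` p" "y \<in> q ` p"
    then obtain f g where "x = q f" "f \<in> p" "y = q g" "g \<in> p" by blast
    then show "x \<otimes>\<^bsub>add_monoid A\<^esub> y \<in> q ` p"
      using ring_ideal.subspace_add[OF p] by (auto simp flip: q_add)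
  next
    show "\<one>\<^bsub>add_monoid A\<^esub> \<in> q ` p"
      using ring_ideal.subspace_0[OF p] q_zero by force
  next
    fix x assume "x \<in> q ` p"
    then obtain f where f: "x = q f" "f \<in> p" by blast
    then have "\<ominus> x \<in> q ` p"
      using ring_ideal.subspace_neg[OF p] by (auto simp flip: q_minus)
    then show "inv\<^bsub>add_monoid A\<^esub> x \<in> q ` p" by (simp add: a_inv_def)
  qed auto
  have 1: "x \<otimes> a \<in> q ` p" if a: "a \<in> q ` p" and x: "x \<in> carrier A" for a x
  proof -
    obtain f g where "a = q f" "f \<in> p" "x = q g"
      using a x q_range by blast
    then show ?thesis
      using ring_ideal.subspace_scale[OF p, of f g] by (simp flip: q_mult)
  qed
  then show "\<And>a x. a \<in> q ` p \<Longrightarrow> x \<in> carrier A \<Longrightarrow> x \<otimes> a \<in> q ` p" .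
  show "a \<otimes> x \<in> q ` p" if "a \<in> q ` p" "x \<in> carrier A" for a x
    using 1[OF that] that m_comm[of a x] by auto
qed

lemma mem_image_iff:
  assumes "ring_ideal.subspace p" "{f. q f = \<zero>} \<subseteq> p"
  shows "q f \<in> q ` p \<longleftrightarrow> f \<in> p"
proof
  assume "q f \<in> q ` p"
  then obtain g where g: "q f = q g" "g \<in> p" by blast
  then have "f - g \<in> p" using assms(2) q_eq_iff by blast
  then show "f \<in> p" using ring_ideal.subspace_add[OF assms(1) _ g(2)] by fastforce
qed simp

lemma primeideal_image:
  assumes p: "ring_ideal.subspace p" "{f. q f = \<zero>} \<subseteq> p" "1 \<notin> p"
    and "\<And>f g. f * g \<in> p \<Longrightarrow> f \<in> p \<or> g \<in> p"
  shows "primeideal (q ` p) A"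
proof (rule primeidealI[OF ideal_image[OF p(1)] is_cring])
  show "carrier A \<noteq> q ` p"
    using mem_image_iff[OF p(1,2), of 1] p(3) q_closed by blast
  fix a b assume ab: "a \<in> carrier A" "b \<in> carrier A" "a \<otimes> b \<in> q ` p"
  then obtain f g where fg: "a = q f" "b = q g" unfolding q_range[symmetric] by blast
  then have "f * g \<in> p" using ab(3) mem_image_iff[OF p(1,2)] by (simp flip: q_mult)
  then show "a \<in> q ` p \<or> b \<in> q ` p" using assms(4) fg by blast
qed

lemma genideal_insert:
  assumes "a \<in> carrier A" "S \<subseteq> carrier A" "y \<in> Idl (insert a S)"
  obtains c z where "c \<in> carrier A" "z \<in> Idl S" "y = c \<otimes> a \<oplus> z"
proof -
  interpret S: ideal "Idl S" A by (rule genideal_ideal[OF assms(2)])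
  have *: "ideal (PIdl a <+>\<^bsub>A\<^esub> Idl S) A"
    by (intro add_ideals cgenideal_ideal assms genideal_ideal)
  have "a \<in> PIdl a <+>\<^bsub>A\<^esub> Idl S"
  proof -
    have "a = a \<oplus> \<zero>" using assms(1) by simp
    then show ?thesis
      using cgenideal_self[OF assms(1)] S.zero_closed unfolding set_add_def' by blast
  qed
  moreover have "s \<in> PIdl a <+>\<^bsub>A\<^esub> Idl S" if "s \<in> S" for s
  proof -
    have "\<zero> \<in> PIdl a"
      by (rule additive_subgroup.zero_closed[OF ideal.axioms(1)[OF cgenideal_ideal[OF assms(1)]]])
    moreover have "s = \<zero> \<oplus> s" using assms(2) that by auto
    moreover have "s \<in> Idl S" using genideal_self[OF assms(2)] that by blast
    ultimately show ?thesis unfolding set_add_def' by blast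
  qed
  ultimately have "insert a S \<subseteq> PIdl a <+>\<^bsub>A\<^esub> Idl S" by blast
  then have "y \<in> PIdl a <+>\<^bsub>A\<^esub> Idl S"
    using genideal_minimal[OF *] assms(3) by blast
  then show ?thesis
    using that unfolding set_add_def' cgenideal_def by blast
qed

lemma regular_sequence_imp_regular_mod:
  assumes "regular_sequence A (map q as)"
  shows "regular_mod {f. q f = \<zero>} as"
proof -
  let ?S = "\<lambda>k. set (take k (map q as))"
  let ?J = "\<lambda>k. {f. q f \<in> Idl (?S k)}"
  have car: "?S k \<subseteq> carrier A" for k
    using set_take_subset[of k "map q as"] by auto
  have reg: "\<forall>i<length (map q as). \<forall>a\<in>carrier A.
      map q as ! i \<otimes> a \<in> Idl (?S i) \<longrightarrow> a \<in> Idl (?S i)"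
    using assms unfolding regular_sequence_def by blast
  have id: "ideal (Idl (?S k)) A" for k by (rule genideal_ideal[OF car])
  \<comment> \<open>\<open>regular_mod\<close> consumes the list from the front, so the induction
    runs from the end of \<open>as\<close> down to 0; the preimages \<open>?J k\<close> grow exactly
    by \<open>ideal_insert\<close>.\<close>
  have "regular_mod (?J k) (drop k as)" if "k \<le> length as" for k
    using that
  proof (induction k rule: inc_induct)
    case (step k)
    let ?a = "as ! k"
    interpret I: ideal "Idl (?S k)" A by (rule id)
    have S: "?S (Suc k) = insert (q ?a) (?S k)"
      using step(2) by (simp add: take_Suc_conv_app_nth)
    have "ideal_insert ?a (?J k) = ?J (Suc k)"
    proof (intro equalityI subsetI)
      fix y assume "y \<in> ideal_insert ?a (?J k)"
      then obtain c where c: "q (y - c * ?a) \<in> Idl (?S k)"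
        unfolding ideal_insert_def by blast
      interpret I': ideal "Idl (?S (Suc k))" A by (rule id)
      have "Idl (?S k) \<subseteq> Idl (?S (Suc k))"
        by (rule genideal_minimal[OF id]) (use genideal_self[OF car[of "Suc k"]] S in blast)
      then have "q (y - c * ?a) \<in> Idl (?S (Suc k))" using c by blast
      moreover have "q ?a \<in> Idl (?S (Suc k))" using genideal_self[OF car[of "Suc k"]] S by blast
      ultimately have "q (y - c * ?a) \<oplus> q c \<otimes> q ?a \<in> Idl (?S (Suc k))"
        by (intro I'.a_closed I'.I_l_closed q_closed)
      then show "y \<in> ?J (Suc k)" by (simp flip: q_mult q_add)
    next
      fix y assume "y \<in> ?J (Suc k)"
      then have "q y \<in> Idl (insert (q ?a) (?S k))" unfolding S by blast
      then obtain c z where cz: "c \<in> carrier A" "z \<in> Idl (?S k)" "q y = c \<otimes> q ?a \<oplus> z"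
        using genideal_insert[OF q_closed car] by blast
      obtain r where r: "c = q r" using cz(1) q_range by blast
      have zc: "z \<in> carrier A" using cz(2) I.Icarr by blast
      have "q (y - r * ?a) = (c \<otimes> q ?a \<oplus> z) \<ominus> c \<otimes> q ?a"
        unfolding q_diff q_mult cz(3) r ..
      also have "\<dots> = z" using zc cz(1) q_closed[of ?a] by algebra
      finally show "y \<in> ideal_insert ?a (?J k)"
        using cz(2) unfolding ideal_insert_def by blast
    qed
    moreover have "x \<in> ?J k" if "?a * x \<in> ?J k" for x
    proof -
      have "map q as ! k \<otimes> q x \<in> Idl (?S k)"
        using that step(2) by (simp add: q_mult)
      then have "q x \<in> Idl (?S k)"
        using reg step(2) q_closed length_map by metis
      then show ?thesis by blast
    qed
    ultimately show ?case
      using step by (simp add: Cons_nth_drop_Suc[symmetric])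
  qed simp
  from this[of 0] have "regular_mod {f. q f \<in> Idl {}} as" by simp
  moreover have "Idl {} = {\<zero>}"
    using genideal_minimal[OF zeroideal, of "{}"]
      additive_subgroup.zero_closed[OF ideal.axioms(1)[OF genideal_ideal[of "{}"]]] by blast
  ultimately show ?thesis by simp
qed

end


section \<open>Stanley--Reisner rings\<close>

text \<open>Discarding the monomials with a variable outside \<open>F\<close> amounts to
  substituting 0 for those variables, which is a ring homomorphism.\<close>

lemma mrestrict_keys_mult:
  fixes f g :: "('a \<Rightarrow>\<^sub>0 nat) \<Rightarrow>\<^sub>0 'k::comm_ring_1"
  shows "mrestrict (\<lambda>m. Poly_Mapping.keys m \<subseteq> F) (f * g) =
     mrestrict (\<lambda>m. Poly_Mapping.keys m \<subseteq> F) f * mrestrict (\<lambda>m. Poly_Mapping.keys m \<subseteq> F) g"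
proof -
  let ?P = "\<lambda>m :: 'a \<Rightarrow>\<^sub>0 nat. Poly_Mapping.keys m \<subseteq> F"
  let ?f = "mrestrict ?P f" and ?f' = "mrestrict (\<lambda>m. \<not> ?P m) f"
  let ?g = "mrestrict ?P g" and ?g' = "mrestrict (\<lambda>m. \<not> ?P m) g"
  have zero: "mrestrict ?P (r * s) = 0"
    if r: "\<And>m. m \<in> Poly_Mapping.keys r \<Longrightarrow> \<not> ?P m" for r s :: "('a \<Rightarrow>\<^sub>0 nat) \<Rightarrow>\<^sub>0 'k"
  proof (rule mrestrict_eq_0)
    fix m assume "m \<in> Poly_Mapping.keys (r * s)"
    then obtain a b where "m = a + b" "a \<in> Poly_Mapping.keys r"
      using Poly_Mapping.keys_mult[of r s] by blast
    then show "\<not> ?P m" using r by (auto simp: keys_add_nat)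
  qed
  have id: "mrestrict ?P (?f * ?g) = ?f * ?g"
  proof (rule mrestrict_id)
    fix m assume "m \<in> Poly_Mapping.keys (?f * ?g)"
    then obtain a b where "m = a + b" "a \<in> Poly_Mapping.keys ?f" "b \<in> Poly_Mapping.keys ?g"
      using Poly_Mapping.keys_mult[of ?f ?g] by blast
    then show "?P m" by (auto simp: keys_add_nat keys_mrestrict)
  qed
  have "f * g = ?f * g + ?f' * g"
    by (subst mrestrict_split[of f ?P]) (rule distrib_right)
  also have "?f * g = ?f * ?g + ?g' * ?f"
    by (subst mrestrict_split[of g ?P]) (simp only: distrib_left mult.commute[of ?g' ?f])
  finally have "f * g = ?f * ?g + ?g' * ?f + ?f' * g" .
  then show ?thesis
    using zero[of ?g' ?f] zero[of ?f' g] id by (simp add: mrestrict_add keys_mrestrict)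
qed

lemma mrestrict_1 [simp]: "P 0 \<Longrightarrow> mrestrict P 1 = (1 :: ('a::monoid_add) \<Rightarrow>\<^sub>0 'k::{zero_neq_one})"
  by (rule mrestrict_id) (simp add: keys_def one_poly_mapping.rep_eq when_def split: if_splits)

text \<open>An ideal of the polynomial ring in all variables with index in \<open>nat\<close>. For a
  complex on \<open>{1..n}\<close> it contains the variables outside that range, so its quotient is
  still the Stanley--Reisner ring and no bound on the variables has to be carried along.\<close>

definition face_ideal :: "nat set set \<Rightarrow> ((nat \<Rightarrow>\<^sub>0 nat) \<Rightarrow>\<^sub>0 'k::zero) set" where
  "face_ideal \<Delta> = {f. \<forall>m\<in>Poly_Mapping.keys f. Poly_Mapping.keys m \<notin> \<Delta>}"

text \<open>The prime ideal generated by the variables outside \<open>F\<close>. The face ideal is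
  the intersection of these primes over all faces.\<close>

definition coord_ideal :: "nat set \<Rightarrow> ((nat \<Rightarrow>\<^sub>0 nat) \<Rightarrow>\<^sub>0 'k::zero) set" where
  "coord_ideal F = {f. \<forall>m\<in>Poly_Mapping.keys f. \<not> Poly_Mapping.keys m \<subseteq> F}"

lemma coord_ideal_alt: "coord_ideal F = {f. mrestrict (\<lambda>m. Poly_Mapping.keys m \<subseteq> F) f = 0}"
proof -
  have "f \<in> coord_ideal F" if "mrestrict (\<lambda>m. Poly_Mapping.keys m \<subseteq> F) f = 0"
    for f :: "(nat \<Rightarrow>\<^sub>0 nat) \<Rightarrow>\<^sub>0 'a"
    using arg_cong[OF that, of Poly_Mapping.keys] by (auto simp: keys_mrestrict coord_ideal_def)
  then show ?thesis by (auto simp: coord_ideal_def intro!: mrestrict_eq_0)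
qed

lemma subspace_coord_ideal:
  "ring_ideal.subspace (coord_ideal F :: ((nat \<Rightarrow>\<^sub>0 nat) \<Rightarrow>\<^sub>0 'k::comm_ring_1) set)"
  unfolding coord_ideal_alt
  by (rule ring_ideal.subspaceI) (auto simp: mrestrict_add mrestrict_keys_mult)

lemma coord_ideal_prime:
  fixes f g :: "(nat \<Rightarrow>\<^sub>0 nat) \<Rightarrow>\<^sub>0 'k::idom"
  assumes "f * g \<in> coord_ideal F" shows "f \<in> coord_ideal F \<or> g \<in> coord_ideal F"
  using assms unfolding coord_ideal_alt by (auto simp: mrestrict_keys_mult)

lemma one_notin_coord_ideal: "1 \<notin> (coord_ideal F :: ((nat \<Rightarrow>\<^sub>0 nat) \<Rightarrow>\<^sub>0 'k::comm_ring_1) set)"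
  by (simp add: coord_ideal_def)

lemma var_poly_in_coord_ideal_iff:
  "var_poly i \<in> (coord_ideal F :: ((nat \<Rightarrow>\<^sub>0 nat) \<Rightarrow>\<^sub>0 'k::field) set) \<longleftrightarrow> i \<notin> F"
  by (simp add: coord_ideal_def var_poly_def)

lemma coord_ideal_antimono: "G \<subseteq> F \<Longrightarrow> coord_ideal F \<subseteq> coord_ideal G"
  by (auto simp: coord_ideal_def)

lemma face_ideal_subset_coord_ideal:
  assumes "simplicial_complex n \<Delta>" "F \<in> \<Delta>" shows "face_ideal \<Delta> \<subseteq> coord_ideal F"
  using assms by (auto simp: face_ideal_def coord_ideal_def simplicial_complex_def)

lemma subspace_face_ideal:
  assumes "simplicial_complex n \<Delta>"
  shows "ring_ideal.subspace (face_ideal \<Delta> :: ((nat \<Rightarrow>\<^sub>0 nat) \<Rightarrow>\<^sub>0 'k::comm_ring_1) set)"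
proof -
  have "face_ideal \<Delta> = (\<Inter>F\<in>\<Delta>. coord_ideal F :: ((nat \<Rightarrow>\<^sub>0 nat) \<Rightarrow>\<^sub>0 'k) set)"
    using face_ideal_subset_coord_ideal[OF assms] by (auto simp: face_ideal_def coord_ideal_def)
  then show ?thesis
    using ring_ideal.subspace_Int[of \<Delta> coord_ideal] subspace_coord_ideal by auto
qed

lemma mrestrict_face_ideal: "f \<in> face_ideal \<Delta> \<Longrightarrow> mrestrict P f \<in> face_ideal \<Delta>"
  by (auto simp: face_ideal_def keys_mrestrict)

lemma carrier_poly_ring:
  "f \<in> carrier (poly_ring n) \<longleftrightarrow> (\<forall>m\<in>Poly_Mapping.keys f. Poly_Mapping.keys m \<subseteq> {1..n})"
  by (simp add: poly_ring_def)

lemma poly_ring_ops: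
  "f \<otimes>\<^bsub>poly_ring n\<^esub> g = f * g" "f \<oplus>\<^bsub>poly_ring n\<^esub> g = f + g"
  "\<one>\<^bsub>poly_ring n\<^esub> = 1" "\<zero>\<^bsub>poly_ring n\<^esub> = 0"
  by (simp_all add: poly_ring_def)

lemma poly_ring_a_inv:
  assumes "f \<in> carrier (poly_ring n :: ((nat \<Rightarrow>\<^sub>0 nat) \<Rightarrow>\<^sub>0 'k::field) ring)"
  shows "\<ominus>\<^bsub>poly_ring n\<^esub> f = - f"
proof -
  interpret R: cring "poly_ring n :: ((nat \<Rightarrow>\<^sub>0 nat) \<Rightarrow>\<^sub>0 'k) ring" by (rule cring_poly_ring)
  show ?thesis
    using assms by (intro R.minus_equality) (auto simp: poly_ring_ops carrier_poly_ring)
qed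

lemma var_poly_prod:
  assumes "finite F"
  shows "(\<Prod>i\<in>F. var_poly i :: (nat \<Rightarrow>\<^sub>0 nat) \<Rightarrow>\<^sub>0 'k::field) =
    Poly_Mapping.single (\<Sum>i\<in>F. Poly_Mapping.single i 1) 1"
  using assms by (induction F) (simp_all add: var_poly_def mult_single)

lemma lookup_sum_singles:
  "finite F \<Longrightarrow> Poly_Mapping.lookup (\<Sum>i\<in>F. Poly_Mapping.single i (1 :: nat)) j = (if j \<in> F then 1 else 0)"
  by (simp add: lookup_sum lookup_single when_def)

lemma stanley_reisner_ideal_eq:
  assumes sc: "simplicial_complex n \<Delta>"
  shows "stanley_reisner_ideal n \<Delta> =
    carrier (poly_ring n :: ((nat \<Rightarrow>\<^sub>0 nat) \<Rightarrow>\<^sub>0 'k::field) ring) \<inter> face_ideal \<Delta>"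
proof -
  let ?R = "poly_ring n :: ((nat \<Rightarrow>\<^sub>0 nat) \<Rightarrow>\<^sub>0 'k) ring"
  let ?G = "{\<Prod>i\<in>F. var_poly i | F. F \<subseteq> {1..n} \<and> F \<notin> \<Delta>} :: ((nat \<Rightarrow>\<^sub>0 nat) \<Rightarrow>\<^sub>0 'k) set"
  interpret R: cring ?R by (rule cring_poly_ring)
  interpret I: ideal "stanley_reisner_ideal n \<Delta>" ?R by (rule ideal_stanley_reisner)
  note J = subspace_face_ideal[OF sc, where 'k='k]
  have G: "?G \<subseteq> carrier ?R" using var_poly_prod_closed by blast
  have "ideal (carrier ?R \<inter> face_ideal \<Delta>) ?R"
  proof (rule idealI[OF R.ring_axioms])
    show "subgroup (carrier ?R \<inter> face_ideal \<Delta>) (add_monoid ?R)"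
    proof
      fix x assume "x \<in> carrier ?R \<inter> face_ideal \<Delta>"
      then show "inv\<^bsub>add_monoid ?R\<^esub> x \<in> carrier ?R \<inter> face_ideal \<Delta>"
        using ring_ideal.subspace_neg[OF J, of x] R.a_inv_closed[of x] poly_ring_a_inv[of x n]
        unfolding a_inv_def[symmetric] by simp
    qed (use ring_ideal.subspace_add[OF J] ring_ideal.subspace_0[OF J] R.zero_closed R.a_closed in
          \<open>auto simp: poly_ring_ops\<close>)
    show "x \<otimes>\<^bsub>?R\<^esub> a \<in> carrier ?R \<inter> face_ideal \<Delta>"
      if "a \<in> carrier ?R \<inter> face_ideal \<Delta>" "x \<in> carrier ?R" for a x
      using that R.m_closed[of x a] ring_ideal.subspace_scale[OF J] by (simp add: poly_ring_ops)
    then show "a \<otimes>\<^bsub>?R\<^esub> x \<in> carrier ?R \<inter> face_ideal \<Delta>"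
      if "a \<in> carrier ?R \<inter> face_ideal \<Delta>" "x \<in> carrier ?R" for a x
      using that R.m_comm[of a x] by auto
  qed
  moreover have "?G \<subseteq> carrier ?R \<inter> face_ideal \<Delta>"
  proof
    fix f assume "f \<in> ?G"
    then obtain F where F: "f = (\<Prod>i\<in>F. var_poly i)" "F \<subseteq> {1..n}" "F \<notin> \<Delta>" by blast
    have "finite F" using F(2) finite_subset by blast
    then have "Poly_Mapping.keys (\<Sum>i\<in>F. Poly_Mapping.single i (1 :: nat)) = F"
      by (auto simp: in_keys_iff lookup_sum_singles[unfolded One_nat_def] split: if_splits)
    then have "f \<in> face_ideal \<Delta>"
      unfolding F(1) using F(3) by (simp add: var_poly_prod[OF \<open>finite F\<close>] face_ideal_def)
    then show "f \<in> carrier ?R \<inter> face_ideal \<Delta>" using G \<open>f \<in> ?G\<close> by blast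
  qed
  ultimately have 1: "stanley_reisner_ideal n \<Delta> \<subseteq> carrier ?R \<inter> face_ideal \<Delta>"
    unfolding stanley_reisner_ideal_def by (rule R.genideal_minimal)
  have mono: "Poly_Mapping.single m c \<in> stanley_reisner_ideal n \<Delta>"
    if m: "Poly_Mapping.keys m \<subseteq> {1..n}" "Poly_Mapping.keys m \<notin> \<Delta>" for m and c :: 'k
  proof -
    let ?s = "\<Sum>i\<in>Poly_Mapping.keys m. Poly_Mapping.single i (1 :: nat)"
    let ?p = "\<Prod>i\<in>Poly_Mapping.keys m. var_poly i :: (nat \<Rightarrow>\<^sub>0 nat) \<Rightarrow>\<^sub>0 'k"
    let ?r = "Poly_Mapping.single (m - ?s) c"
    \<comment> \<open>Truncated subtraction is harmless: every exponent on the support of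
      \<open>m\<close> is at least 1. So each monomial with non-face support is a multiple of the
      generator of its support.\<close>
    have "m - ?s + ?s = m"
      by (rule poly_mapping_eqI) (auto simp: lookup_add lookup_minus lookup_sum_singles[unfolded One_nat_def] in_keys_iff)
    then have "?r * ?p = Poly_Mapping.single m c"
      by (simp only: var_poly_prod[OF finite_keys] mult_single mult_1_right)
    moreover have "?p \<in> stanley_reisner_ideal n \<Delta>"
      unfolding stanley_reisner_ideal_def
      by (rule subsetD[OF R.genideal_self[OF G]]) (use m in blast)
    moreover have "?r \<in> carrier ?R"
      using m(1) by (auto simp: carrier_poly_ring in_keys_iff lookup_minus)
    ultimately show ?thesis
      using I.I_l_closed[of ?p ?r]
      by (simp only: poly_ring_ops)
  qed
  have sums: "(\<Sum>m\<in>M. g m) \<in> stanley_reisner_ideal n \<Delta>"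
    if "finite M" "\<And>m. m \<in> M \<Longrightarrow> g m \<in> stanley_reisner_ideal n \<Delta>"
    for M :: "(nat \<Rightarrow>\<^sub>0 nat) set" and g :: "_ \<Rightarrow> (nat \<Rightarrow>\<^sub>0 nat) \<Rightarrow>\<^sub>0 'k"
    using that
  proof (induction M)
    case empty
    then show ?case using I.zero_closed by (simp add: poly_ring_ops)
  next
    case (insert m M)
    then show ?case using I.a_closed[of "g m" "\<Sum>m\<in>M. g m"] by (simp add: poly_ring_ops)
  qed
  have 2: "f \<in> stanley_reisner_ideal n \<Delta>" if "f \<in> carrier ?R \<inter> face_ideal \<Delta>" for f
  proof -
    have "Poly_Mapping.single m (Poly_Mapping.lookup f m) \<in> stanley_reisner_ideal n \<Delta>"
      if "m \<in> Poly_Mapping.keys f" for m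
      using \<open>f \<in> carrier ?R \<inter> face_ideal \<Delta>\<close> that
      by (intro mono) (simp_all add: carrier_poly_ring face_ideal_def)
    then show ?thesis
      by (subst poly_mapping_as_sum[of f]) (rule sums[OF finite_keys])
  qed
  show ?thesis using 1 2 by blast
qed

text \<open>Variables outside \<open>{1..n}\<close> are first set to 0, so that the map is total on
  the polynomial type, as \<open>ring_epi\<close> requires.\<close>

definition sr_map :: "nat \<Rightarrow> nat set set \<Rightarrow> ((nat \<Rightarrow>\<^sub>0 nat) \<Rightarrow>\<^sub>0 'k::field) \<Rightarrow> ((nat \<Rightarrow>\<^sub>0 nat) \<Rightarrow>\<^sub>0 'k) set" where
  "sr_map n \<Delta> f = stanley_reisner_ideal n \<Delta> +>\<^bsub>poly_ring n\<^esub>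
     mrestrict (\<lambda>m. Poly_Mapping.keys m \<subseteq> {1..n}) f"

lemma ring_epi_sr_map:
  assumes sc: "simplicial_complex n \<Delta>"
  shows "ring_epi (stanley_reisner_ring n \<Delta>) (sr_map n \<Delta> :: ((nat \<Rightarrow>\<^sub>0 nat) \<Rightarrow>\<^sub>0 'k::field) \<Rightarrow> _)"
    and "sr_map n \<Delta> f = \<zero>\<^bsub>stanley_reisner_ring n \<Delta>\<^esub> \<longleftrightarrow> (f :: (nat \<Rightarrow>\<^sub>0 nat) \<Rightarrow>\<^sub>0 'k) \<in> face_ideal \<Delta>"
    and "X \<in> carrier (stanley_reisner_ring n \<Delta>) \<Longrightarrow>
      \<exists>f\<in>carrier (poly_ring n :: ((nat \<Rightarrow>\<^sub>0 nat) \<Rightarrow>\<^sub>0 'k) ring). X = sr_map n \<Delta> f"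
proof -
  let ?R = "poly_ring n :: ((nat \<Rightarrow>\<^sub>0 nat) \<Rightarrow>\<^sub>0 'k) ring"
  let ?I = "stanley_reisner_ideal n \<Delta> :: ((nat \<Rightarrow>\<^sub>0 nat) \<Rightarrow>\<^sub>0 'k) set"
  let ?A = "stanley_reisner_ring n \<Delta> :: ((nat \<Rightarrow>\<^sub>0 nat) \<Rightarrow>\<^sub>0 'k) set ring"
  let ?p = "mrestrict (\<lambda>m. Poly_Mapping.keys m \<subseteq> {1..n}) :: ((nat \<Rightarrow>\<^sub>0 nat) \<Rightarrow>\<^sub>0 'k) \<Rightarrow> _"
  interpret R: cring ?R by (rule cring_poly_ring)
  interpret I: ideal ?I ?R by (rule ideal_stanley_reisner)
  interpret A: cring ?A by (rule cring_stanley_reisner_ring)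
  have pc: "?p f \<in> carrier ?R" for f by (auto simp: carrier_poly_ring keys_mrestrict)
  have pid: "?p f = f" if "f \<in> carrier ?R" for f
    by (rule mrestrict_id) (use that in \<open>auto simp: carrier_poly_ring\<close>)
  have hom: "(+>\<^bsub>?R\<^esub>) ?I \<in> ring_hom ?R ?A"
    using I.rcos_ring_hom by (simp add: stanley_reisner_ring_def)
  show surj: "\<exists>f\<in>carrier ?R. X = sr_map n \<Delta> f" if "X \<in> carrier ?A" for X
    using that pid by (auto simp: stanley_reisner_ring_def FactRing_def A_RCOSETS_def' sr_map_def)
  show "ring_epi ?A (sr_map n \<Delta>)"
  proof (intro ring_epi.intro A.cring_axioms ring_epi_axioms.intro)
    show "range (sr_map n \<Delta>) = carrier ?A"
      using surj ring_hom_closed[OF hom pc] by (auto simp: sr_map_def)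
    show "sr_map n \<Delta> (f + g) = sr_map n \<Delta> f \<oplus>\<^bsub>?A\<^esub> sr_map n \<Delta> g" for f g :: "(nat \<Rightarrow>\<^sub>0 nat) \<Rightarrow>\<^sub>0 'k"
      using ring_hom_add[OF hom pc pc] by (simp add: sr_map_def mrestrict_add poly_ring_ops)
    show "sr_map n \<Delta> (f * g) = sr_map n \<Delta> f \<otimes>\<^bsub>?A\<^esub> sr_map n \<Delta> g" for f g :: "(nat \<Rightarrow>\<^sub>0 nat) \<Rightarrow>\<^sub>0 'k"
      using ring_hom_mult[OF hom pc pc] by (simp add: sr_map_def mrestrict_keys_mult poly_ring_ops)
    show "sr_map n \<Delta> 1 = \<one>\<^bsub>?A\<^esub>"
      using ring_hom_one[OF hom] by (simp add: sr_map_def poly_ring_ops)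
  qed
  have zero: "\<zero>\<^bsub>?A\<^esub> = ?I" by (simp add: stanley_reisner_ring_def FactRing_def)
  have "sr_map n \<Delta> f = \<zero>\<^bsub>?A\<^esub> \<longleftrightarrow> ?p f \<in> ?I"
    unfolding zero sr_map_def using I.rcos_const_imp_mem[OF pc] R.a_rcos_zero[OF I.ideal_axioms] by blast
  also have "\<dots> \<longleftrightarrow> f \<in> face_ideal \<Delta>"
    using sc pc unfolding stanley_reisner_ideal_eq[OF sc]
    by (auto simp: face_ideal_def keys_mrestrict simplicial_complex_def)
  finally show "sr_map n \<Delta> f = \<zero>\<^bsub>?A\<^esub> \<longleftrightarrow> f \<in> face_ideal \<Delta>" .
qed

section \<open>From depth at the irrelevant maximal ideal to a regular sequence of
  polynomials\<close>

lemma mem_span_vars: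
  fixes f :: "(nat \<Rightarrow>\<^sub>0 nat) \<Rightarrow>\<^sub>0 'k::field"
  assumes "f \<in> carrier (poly_ring n)" "f \<in> coord_ideal {}"
  shows "f \<in> ring_ideal.span (var_poly ` {1..n})"
proof -
  have "Poly_Mapping.single m c \<in> ring_ideal.span (var_poly ` {1..n})"
    if m: "m \<in> Poly_Mapping.keys f" for m and c :: 'k
  proof -
    have mm: "Poly_Mapping.keys m \<subseteq> {1..n}" "Poly_Mapping.keys m \<noteq> {}"
      using assms m by (auto simp: carrier_poly_ring coord_ideal_def)
    then obtain i where i: "i \<in> Poly_Mapping.keys m" by blast
    have "m - Poly_Mapping.single i 1 + Poly_Mapping.single i 1 = m"
      using i by (intro poly_mapping_eqI) (auto simp: lookup_add lookup_minus lookup_single when_def in_keys_iff)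
    then have "Poly_Mapping.single m c = Poly_Mapping.single (m - Poly_Mapping.single i 1) c * var_poly i"
      by (simp add: var_poly_def mult_single)
    moreover have "var_poly i \<in> ring_ideal.span (var_poly ` {1..n})"
      using i mm(1) by (intro ring_ideal.span_base) blast
    ultimately show ?thesis using ring_ideal.span_scale by metis
  qed
  then show ?thesis
    by (subst poly_mapping_as_sum[of f]) (rule ring_ideal.span_sum)
qed

lemma card_le_dim:
  assumes "simplicial_complex n \<Delta>" "complex_dim \<Delta> = int d - 1"
  shows "finite \<Delta>" "F \<in> \<Delta> \<Longrightarrow> card F \<le> d" "F \<in> \<Delta> \<Longrightarrow> finite F" "\<exists>F\<in>\<Delta>. card F = d"
proof -
  show fin: "finite \<Delta>"
    using assms(1) finite_subset[of \<Delta> "Pow {1..n}"] by (auto simp: simplicial_complex_def)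
  have ne: "card ` \<Delta> \<noteq> {}" using assms(1) by (auto simp: simplicial_complex_def)
  have d: "d = Max (card ` \<Delta>)" using assms(2) by (simp add: complex_dim_def)
  show "F \<in> \<Delta> \<Longrightarrow> card F \<le> d" unfolding d using fin by simp
  show "F \<in> \<Delta> \<Longrightarrow> finite F"
    using assms(1) finite_subset[of F "{1..n}"] by (auto simp: simplicial_complex_def)
  show "\<exists>F\<in>\<Delta>. card F = d" unfolding d using Max_in[OF _ ne] fin by auto
qed

text \<open>Removing the elements of a face of size \<open>d\<close> one at a time produces a strict
  chain of coordinate primes ending at the ideal of all variables. That maximal ideal thus has
  height at least \<open>d\<close>, hence depth at least \<open>d\<close>, and a regular sequence
  inside it is lifted to polynomials.\<close>

lemma CM_regular_mod:
  assumes cm: "CM_complex TYPE('k::field) n \<Delta>" and d: "complex_dim \<Delta> = int d - 1"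
  obtains as :: "((nat \<Rightarrow>\<^sub>0 nat) \<Rightarrow>\<^sub>0 'k::field) list" where "length as \<ge> d"
    "set as \<subseteq> ring_ideal.span (var_poly ` {1..n})" "regular_mod (face_ideal \<Delta>) as"
proof (cases "d = 0")
  case True
  then show ?thesis using that[of "[]"] by simp
next
  case False
  let ?A = "stanley_reisner_ring n \<Delta> :: ((nat \<Rightarrow>\<^sub>0 nat) \<Rightarrow>\<^sub>0 'k) set ring"
  let ?q = "sr_map n \<Delta> :: ((nat \<Rightarrow>\<^sub>0 nat) \<Rightarrow>\<^sub>0 'k) \<Rightarrow> _"
  have sc: "simplicial_complex n \<Delta>" and cmr: "cohen_macaulay_ring ?A"
    using cm by (auto simp: CM_complex_def)
  interpret ring_epi ?A ?q by (rule ring_epi_sr_map[OF sc])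
  have ker: "{f. ?q f = \<zero>\<^bsub>?A\<^esub>} = face_ideal \<Delta>" using ring_epi_sr_map(2)[OF sc] by blast
  define Q where "Q F = ?q ` coord_ideal F" for F
  have sub: "{f. ?q f = \<zero>\<^bsub>?A\<^esub>} \<subseteq> coord_ideal F" if "F \<in> \<Delta>" for F
    using ker face_ideal_subset_coord_ideal[OF sc that] by blast
  have mem: "?q f \<in> Q F \<longleftrightarrow> f \<in> coord_ideal F" if "F \<in> \<Delta>" for F f
    unfolding Q_def by (rule mem_image_iff[OF subspace_coord_ideal sub[OF that]])
  have prime: "primeideal (Q F) ?A" if "F \<in> \<Delta>" for F
    unfolding Q_def
    by (rule primeideal_image[OF subspace_coord_ideal sub[OF that] one_notin_coord_ideal coord_ideal_prime])
  have mono: "Q F \<subset> Q G" if FG: "F \<in> \<Delta>" "G \<subset> F" for F G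
  proof -
    obtain i where i: "i \<in> F" "i \<notin> G" using FG(2) by blast
    have G: "G \<in> \<Delta>" using FG sc by (auto simp: simplicial_complex_def)
    have "?q (var_poly i) \<in> Q G" "?q (var_poly i) \<notin> Q F"
      using i by (simp_all add: mem FG G var_poly_in_coord_ideal_iff)
    moreover have "Q F \<subseteq> Q G" unfolding Q_def using coord_ideal_antimono[of G F] FG(2) by blast
    ultimately show ?thesis by blast
  qed
  have empty: "{} \<in> \<Delta>" using sc by (simp add: simplicial_complex_def)
  have max: "maximalideal (Q {}) ?A"
  proof (rule maximalidealI)
    show "ideal (Q {}) ?A" using prime[OF empty] by (rule primeideal.axioms)
    show "carrier ?A \<noteq> Q {}" using primeideal.I_notcarr[OF prime[OF empty]] .
    fix J assume J: "ideal J ?A" "Q {} \<subseteq> J" "J \<subseteq> carrier ?A"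
    interpret J: ideal J ?A by fact
    have "J = carrier ?A" if ne: "J \<noteq> Q {}"
    proof -
      obtain X where X: "X \<in> J" "X \<notin> Q {}" using ne J(2) by blast
      then obtain f where f: "X = ?q f" using J(3) q_range by blast
      let ?c = "Poly_Mapping.lookup f 0"
      have c: "?c \<noteq> 0"
        using X(2) unfolding f mem[OF empty] by (auto simp: coord_ideal_def in_keys_iff)
      \<comment> \<open>Scaling to constant term 1 puts \<open>1 - ?h\<close> into the ideal of the
        variables, so both summands of \<open>1 = (1 - ?h) + ?h\<close> map into
        \<open>J\<close>.\<close>
      let ?h = "Poly_Mapping.single 0 (inverse ?c) * f"
      have "Poly_Mapping.lookup ?h 0 = 1"
        using c by (simp add: mult_map_scale_conv_mult[symmetric] Poly_Mapping.map.rep_eq)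
      then have "1 - ?h \<in> coord_ideal {}"
        by (auto simp: coord_ideal_def in_keys_iff lookup_minus)
      then have "?q (1 - ?h) \<in> J" using J(2) mem[OF empty] by blast
      moreover have "?q ?h \<in> J"
        unfolding q_mult using X(1) f by (intro J.I_l_closed) auto
      ultimately have "?q (1 - ?h) \<oplus>\<^bsub>?A\<^esub> ?q ?h \<in> J" by (rule J.a_closed)
      then have "\<one>\<^bsub>?A\<^esub> \<in> J" by (simp flip: q_add add: q_one)
      then show ?thesis by (rule J.one_imp_carrier)
    qed
    then show "J = Q {} \<or> J = carrier ?A" by blast
  qed
  have "enat d \<le> prime_height ?A (Q {})"
  proof -
    obtain F where F: "F \<in> \<Delta>" "card F = d" "finite F" using card_le_dim[OF sc d] by blast
    obtain l where l: "set l = F" "distinct l" using finite_distinct_list[OF F(3)] by blast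
    have len: "length l = d" using l F(2) distinct_card by force
    \<comment> \<open>The prefixes of \<open>l\<close> are listed from long to short, because the
      primes grow as the faces shrink; \<open>Suc d\<close> primes make a chain of length
      \<open>d\<close>.\<close>
    define Qs where "Qs = map (\<lambda>k. Q (set (take (d - k) l))) [0..<Suc d]"
    have face: "set (take k l) \<in> \<Delta>" for k
      using F(1) l(1) sc set_take_subset[of k l] by (auto simp: simplicial_complex_def)
    have "sorted_wrt (\<subset>) Qs"
      unfolding sorted_wrt_iff_nth_less
    proof (intro allI impI)
      fix i j assume ij: "i < j" "j < length Qs"
      have "card (set (take k l)) = min k d" for k
        using l(2) len by (simp add: distinct_card min.commute)
      then have "set (take (d - j) l) \<noteq> set (take (d - i) l)"
        using ij by (metis Qs_def Suc_leI diff_le_self diff_less_mono2 length_map length_upt less_Suc_eq_le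
            min.absorb1 minus_nat.diff_0 nat_neq_iff order_le_less_trans not_less_eq)
      moreover have "set (take (d - j) l) \<subseteq> set (take (d - i) l)"
        using ij by (intro set_take_subset_set_take) auto
      ultimately have "Q (set (take (d - i) l)) \<subset> Q (set (take (d - j) l))"
        using mono[OF face] by blast
      then show "Qs ! i \<subset> Qs ! j"
        using ij by (simp add: Qs_def del: upt_Suc)
    qed
    moreover have "last Qs = Q {}" by (simp add: Qs_def)
    moreover have "\<forall>P\<in>set Qs. primeideal P ?A"
      using prime[OF face] prime[OF empty] by (auto simp: Qs_def)
    moreover have "length Qs - 1 = d" "Qs \<noteq> []" by (simp_all add: Qs_def)
    ultimately show ?thesis
      unfolding prime_height_def by (intro Sup_upper) blast
  qed
  then have depth: "enat d \<le> ideal_depth ?A (Q {})"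
    using cmr max unfolding cohen_macaulay_ring_def by metis
  \<comment> \<open>A supremum of at least \<open>d > 0\<close> is reached by a single sequence,
    since otherwise \<open>d - 1\<close> would be an upper bound.\<close>
  have "\<exists>xs. regular_sequence ?A xs \<and> set xs \<subseteq> Q {} \<and> d \<le> length xs"
  proof (rule ccontr)
    assume no: "\<not> ?thesis"
    have "ideal_depth ?A (Q {}) \<le> enat (d - 1)"
      unfolding ideal_depth_def
      by (rule Sup_least) (use no False in \<open>fastforce simp: not_le\<close>)
    then show False using depth False by (metis One_nat_def diff_less enat_ord_simps(1) gr0I not_le order_trans zero_less_one)
  qed
  then obtain xs where xs: "regular_sequence ?A xs" "set xs \<subseteq> Q {}" "d \<le> length xs" by blast
  \<comment> \<open>The lift is taken among polynomials in the first \<open>n\<close> variables: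
    only there does a zero constant term imply membership in the span of finitely many
    variables.\<close>
  have "\<exists>f. f \<in> ring_ideal.span (var_poly ` {1..n}) \<and> ?q f = X" if X: "X \<in> Q {}" for X
  proof -
    have "X \<in> carrier ?A" using X unfolding Q_def by auto
    then obtain f where f: "f \<in> carrier (poly_ring n)" "X = ?q f"
      using ring_epi_sr_map(3)[OF sc] by blast
    then have "f \<in> coord_ideal {}" using X mem[OF empty] by blast
    then show ?thesis using mem_span_vars f by blast
  qed
  then obtain r where r: "\<And>X. X \<in> Q {} \<Longrightarrow> r X \<in> ring_ideal.span (var_poly ` {1..n}) \<and> ?q (r X) = X"
    by metis
  have "map ?q (map r xs) = xs" using r xs(2) by (auto intro!: map_idI)
  then have "regular_mod (face_ideal \<Delta>) (map r xs)"
    using regular_sequence_imp_regular_mod[of "map r xs"] xs(1) unfolding ker by metis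
  moreover have "set (map r xs) \<subseteq> ring_ideal.span (var_poly ` {1..n})" using r xs(2) by auto
  ultimately show thesis using that[of "map r xs"] xs(3) by simp
qed


section \<open>Linear systems of parameters\<close>

definition vand_form :: "nat \<Rightarrow> (nat \<Rightarrow> 'k::field) \<Rightarrow> nat \<Rightarrow> (nat \<Rightarrow>\<^sub>0 nat) \<Rightarrow>\<^sub>0 'k" where
  "vand_form n t j = (\<Sum>i\<in>{1..n}. Poly_Mapping.single (Poly_Mapping.single i 1) (t i ^ j))"

definition lagrange :: "(nat \<Rightarrow> 'k::field) \<Rightarrow> nat set \<Rightarrow> nat \<Rightarrow> 'k Polynomial.poly" where
  "lagrange t F i = (\<Prod>l\<in>F - {i}. Polynomial.smult (inverse (t i - t l)) [:- t l, 1:])"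

lemma homogeneous_vand_form: "homogeneous 1 (vand_form n t j)"
  unfolding vand_form_def by (intro homogeneous_sum) (simp add: homogeneous_def)

lemma poly_lagrange:
  assumes "finite F" "inj_on t F" "i \<in> F" "l \<in> F"
  shows "Polynomial.poly (lagrange t F i) (t l) = (if l = i then 1 else 0)"
proof (cases "l = i")
  case True
  have "t i * inverse (t i - t l) - inverse (t i - t l) * t l = 1" if "l \<in> F - {i}" for l
  proof -
    have "t i - t l \<noteq> 0" using inj_onD[OF assms(2), of i l] assms(3) that by auto
    then have "(t i - t l) * inverse (t i - t l) = 1" by simp
    then show ?thesis by (simp only: left_diff_distrib mult.commute[of "t l"])
  qed
  then show ?thesis
    using True by (simp add: lagrange_def poly_prod)
next
  case False
  then have "l \<in> F - {i}" using assms(4) by blast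
  then show ?thesis
    using False assms(1) by (auto simp: lagrange_def poly_prod intro!: prod_zero)
qed

lemma degree_lagrange:
  assumes "finite F" "i \<in> F"
  shows "Polynomial.degree (lagrange t F i) < card F"
proof -
  have "Polynomial.degree (lagrange t F i) \<le>
      (\<Sum>l\<in>F - {i}. Polynomial.degree (Polynomial.smult (inverse (t i - t l)) [:- t l, 1:]))"
    unfolding lagrange_def by (rule degree_prod_sum_le[unfolded comp_def]) (use assms in auto)
  also have "\<dots> \<le> (\<Sum>l\<in>F - {i}. 1)"
    by (rule sum_mono) (rule order_trans[OF degree_smult_le], simp)
  also have "\<dots> < card F" using assms card_gt_0_iff[of F] by auto
  finally show ?thesis .
qed

text \<open>Taking the coefficients of \<open>L\<close> as weights turns the powers t_i^j into the
  values of \<open>L\<close> at the nodes; a Lagrange polynomial will single out one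
  variable.\<close>

lemma vand_form_combination:
  assumes "Polynomial.degree L < d"
  shows "(\<Sum>j<d. Poly_Mapping.single 0 (Polynomial.coeff L j) * vand_form n t j) =
    (\<Sum>i\<in>{1..n}. Poly_Mapping.single (Poly_Mapping.single i 1) (Polynomial.poly L (t i)))"
proof -
  have L: "Polynomial.poly L x = (\<Sum>j<d. Polynomial.coeff L j * x ^ j)" for x
  proof -
    have "(\<Sum>j\<le>Polynomial.degree L. Polynomial.coeff L j * x ^ j) = (\<Sum>j<d. Polynomial.coeff L j * x ^ j)"
      using assms by (intro sum.mono_neutral_left) (auto simp: coeff_eq_0)
    then show ?thesis by (simp add: poly_altdef)
  qed
  have s: "Poly_Mapping.single m (\<Sum>j<d. g j) = (\<Sum>j<d. Poly_Mapping.single m (g j))"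
    for m :: "nat \<Rightarrow>\<^sub>0 nat" and g :: "nat \<Rightarrow> 'a"
    by (rule poly_mapping_eqI) (simp add: lookup_sum lookup_single when_def)
  have "(\<Sum>j<d. Poly_Mapping.single 0 (Polynomial.coeff L j) * vand_form n t j) =
      (\<Sum>j<d. \<Sum>i\<in>{1..n}. Poly_Mapping.single (Poly_Mapping.single i 1) (Polynomial.coeff L j * t i ^ j))"
    by (simp add: vand_form_def sum_distrib_left mult_single)
  also have "\<dots> = (\<Sum>i\<in>{1..n}. \<Sum>j<d. Poly_Mapping.single (Poly_Mapping.single i 1) (Polynomial.coeff L j * t i ^ j))"
    by (rule sum.swap)
  finally show ?thesis by (simp only: L s)
qed

text \<open>For \<open>i\<close> in \<open>F\<close>, weights from the Lagrange polynomial of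
  \<open>i\<close> on the nodes of \<open>F\<close> combine the forms into x_i plus terms in
  variables outside \<open>F\<close>. The bound \<open>card F \<le> d\<close> ensures that
  \<open>d\<close> forms are enough.\<close>

lemma var_poly_mod_coord_ideal:
  assumes F: "F \<subseteq> {1..n}" "card F \<le> d" and t: "inj_on t {1..n}"
  shows "\<exists>g\<in>ring_ideal.span (vand_form n t ` {..<d}). var_poly i - g \<in> coord_ideal F"
proof (cases "i \<in> F")
  case False
  then show ?thesis
    by (intro bexI[of _ 0]) (simp_all add: ring_ideal.span_zero var_poly_in_coord_ideal_iff)
next
  case True
  have fin: "finite F" using F(1) finite_subset by blast
  have inj: "inj_on t F" using t F(1) inj_on_subset by blast
  let ?L = "lagrange t F i"
  let ?g = "\<Sum>j<d. Poly_Mapping.single 0 (Polynomial.coeff ?L j) * vand_form n t j"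
  have "Polynomial.degree ?L < d" using degree_lagrange[OF fin True, of t] F(2) by linarith
  note g = vand_form_combination[OF this, of n t]
  have "mrestrict (\<lambda>m. Poly_Mapping.keys m \<subseteq> F) ?g =
      (\<Sum>l\<in>{1..n}. if l \<in> F then Poly_Mapping.single (Poly_Mapping.single l 1) (Polynomial.poly ?L (t l)) else 0)"
    unfolding g mrestrict_sum by (intro sum.cong) (simp_all add: mrestrict_single)
  also have "\<dots> = (\<Sum>l\<in>{1..n}. if l = i then var_poly i else 0)"
    using poly_lagrange[OF fin inj True] True by (intro sum.cong) (auto simp: var_poly_def)
  also have "\<dots> = var_poly i" using True F(1) by (simp add: subset_iff)
  finally have "mrestrict (\<lambda>m. Poly_Mapping.keys m \<subseteq> F) ?g = var_poly i" .
  moreover have "mrestrict (\<lambda>m. Poly_Mapping.keys m \<subseteq> F) (var_poly i) = var_poly i"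
    using True by (simp add: var_poly_def mrestrict_single)
  ultimately have "var_poly i - ?g \<in> coord_ideal F" by (simp add: coord_ideal_alt mrestrict_diff)
  moreover have "?g \<in> ring_ideal.span (vand_form n t ` {..<d})"
    by (intro ring_ideal.span_sum ring_ideal.span_scale ring_ideal.span_base) auto
  ultimately show ?thesis by blast
qed

text \<open>Multiply the congruences: the product of all x - g_F lies in every \<open>P F\<close>,
  and its expansion is x^(card S) minus an element of \<open>G\<close>.\<close>

lemma power_mod_Inter:
  fixes x :: "'a::comm_ring_1"
  assumes "finite S" "\<And>F. F \<in> S \<Longrightarrow> ring_ideal.subspace (P F)" "ring_ideal.subspace G"
    and "\<And>F. F \<in> S \<Longrightarrow> \<exists>g\<in>G. x - g \<in> P F"
  shows "\<exists>h\<in>G. x ^ card S - h \<in> (\<Inter>F\<in>S. P F)"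
  using assms(1,2,4)
proof (induction S)
  case empty
  then show ?case using ring_ideal.subspace_0[OF assms(3)] by (intro bexI[of _ 0]) auto
next
  case (insert F S)
  obtain h where h: "h \<in> G" "x ^ card S - h \<in> (\<Inter>F\<in>S. P F)"
    using insert by auto
  obtain g where g: "g \<in> G" "x - g \<in> P F" using insert.prems by blast
  let ?h = "x ^ card S * g + (x - g) * h"
  have eq: "x ^ card (insert F S) - ?h = (x - g) * (x ^ card S - h)"
    using insert.hyps by (simp add: algebra_simps)
  have "?h \<in> G"
    by (intro ring_ideal.subspace_add ring_ideal.subspace_scale assms(3) g h)
  moreover have "x ^ card (insert F S) - ?h \<in> P F'" if "F' \<in> insert F S" for F'
  proof (cases "F' = F")
    case True
    then show ?thesis
      unfolding eq using ring_ideal_mult_right[OF insert.prems(1) g(2)] by simp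
  next
    case False
    then have "x ^ card S - h \<in> P F'" "ring_ideal.subspace (P F')"
      using that h(2) insert.prems(1) by auto
    then show ?thesis unfolding eq using ring_ideal.subspace_scale by blast
  qed
  ultimately show ?case by blast
qed

definition par_ideal :: "nat \<Rightarrow> (nat \<Rightarrow> 'k::field) \<Rightarrow> nat set set \<Rightarrow> nat \<Rightarrow> ((nat \<Rightarrow>\<^sub>0 nat) \<Rightarrow>\<^sub>0 'k) set" where
  "par_ideal n t \<Delta> k = ring_ideal.span (vand_form n t ` {..<k} \<union> face_ideal \<Delta>)"

lemma var_poly_nilpotent:
  assumes sc: "simplicial_complex n \<Delta>" and d: "complex_dim \<Delta> = int d - 1" and t: "inj_on t {1..n}"
  shows "var_poly i ^ card \<Delta> \<in> par_ideal n t \<Delta> d"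
proof -
  let ?G = "ring_ideal.span (vand_form n t ` {..<d})"
  have "\<exists>h\<in>?G. var_poly i ^ card \<Delta> - h \<in> (\<Inter>F\<in>\<Delta>. coord_ideal F)"
  proof (rule power_mod_Inter)
    show "finite \<Delta>" by (rule card_le_dim(1)[OF sc d])
    show "ring_ideal.subspace (coord_ideal F)" for F by (rule subspace_coord_ideal)
    show "ring_ideal.subspace ?G" by simp
    show "\<exists>g\<in>?G. var_poly i - g \<in> coord_ideal F" if "F \<in> \<Delta>" for F
      using var_poly_mod_coord_ideal[OF _ card_le_dim(2)[OF sc d that] t] that sc
      by (auto simp: simplicial_complex_def)
  qed
  then obtain h where h: "h \<in> ?G" "var_poly i ^ card \<Delta> - h \<in> (\<Inter>F\<in>\<Delta>. coord_ideal F)" by blast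
  have "h \<in> par_ideal n t \<Delta> d"
    unfolding par_ideal_def using h(1) ring_ideal.span_mono[of "vand_form n t ` {..<d}"] by blast
  moreover have "(\<Inter>F\<in>\<Delta>. coord_ideal F) \<subseteq> face_ideal \<Delta>"
    by (auto simp: face_ideal_def coord_ideal_def)
  then have "var_poly i ^ card \<Delta> - h \<in> par_ideal n t \<Delta> d"
    unfolding par_ideal_def using h(2) by (intro ring_ideal.span_base) blast
  ultimately show ?thesis
    unfolding par_ideal_def using ring_ideal.span_add by fastforce
qed

text \<open>The list is reversed so that \<open>hexact_Cons\<close> strips the form of highest
  index, descending from the full system of \<open>d\<close> forms. Full exactness holds because
  every variable is nilpotent modulo the forms and the face ideal.\<close>

lemma CM_hexact:
  assumes cm: "CM_complex TYPE('k::field) n \<Delta>" and d: "complex_dim \<Delta> = int d - 1"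
    and t: "inj_on (t :: nat \<Rightarrow> 'k::field) {1..n}" and "k \<le> d"
  shows "hexact (map (vand_form n t) (rev [0..<k])) (face_ideal \<Delta>)"
  using \<open>k \<le> d\<close>
proof (induction k rule: inc_induct)
  case base
  have sc: "simplicial_complex n \<Delta>" using cm by (simp add: CM_complex_def)
  let ?ts = "map (vand_form n t) (rev [0..<d])"
  obtain as :: "((nat \<Rightarrow>\<^sub>0 nat) \<Rightarrow>\<^sub>0 'k) list" where as: "length as \<ge> d"
    "set as \<subseteq> ring_ideal.span (var_poly ` {1..n})" "regular_mod (face_ideal \<Delta>) as"
    by (rule CM_regular_mod[OF cm d])
  have "kexact 1 ?ts (face_ideal \<Delta>)"
  proof (rule kexact_parameters[where xs = "map var_poly [1..<Suc n]" and N = "card \<Delta>"])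
    show "ring_ideal.subspace (face_ideal \<Delta>)" by (rule subspace_face_ideal[OF sc])
    show "regular_mod (face_ideal \<Delta>) as" by (rule as)
    have "set (map var_poly [1..<Suc n]) = var_poly ` {1..n}"
      by (simp add: atLeastLessThanSuc_atLeastAtMost del: upt_Suc)
    then show "set as \<subseteq> ring_ideal.span (set (map var_poly [1..<Suc n]))" using as(2) by metis
    have ts: "set ?ts = vand_form n t ` {..<d}" by (auto simp: lessThan_atLeast0)
    show "x ^ card \<Delta> \<in> ring_ideal.span (set ?ts \<union> face_ideal \<Delta>)"
      if "x \<in> set (map var_poly [1..<Suc n])" for x
      using that var_poly_nilpotent[OF sc d t] unfolding ts par_ideal_def by (auto simp del: upt_Suc)
  qed (use as(1) in simp_all)
  then show ?case by (rule kexact_imp_hexact)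
next
  case (step k)
  show ?case
  proof (rule hexact_Cons)
    show "hexact (vand_form n t k # map (vand_form n t) (rev [0..<k])) (face_ideal \<Delta>)"
      using step.IH by simp
    show "ring_ideal.subspace (face_ideal \<Delta> :: ((nat \<Rightarrow>\<^sub>0 nat) \<Rightarrow>\<^sub>0 'k) set)"
      using cm by (intro subspace_face_ideal[of n]) (simp add: CM_complex_def)
  qed (auto simp: hcomp_def intro: mrestrict_face_ideal homogeneous_vand_form[unfolded One_nat_def])
qed

theorem CM_nonzerodivisor:
  assumes cm: "CM_complex TYPE('k::field) n \<Delta>" and d: "complex_dim \<Delta> = int d - 1"
    and t: "inj_on (t :: nat \<Rightarrow> 'k::field) {1..n}" and "k < d"
    and "homogeneous D f" "vand_form n t k * f \<in> par_ideal n t \<Delta> k"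
  shows "f \<in> par_ideal n t \<Delta> k"
proof -
  have ts: "set (map (vand_form n t) (rev [0..<k])) = vand_form n t ` {..<k}"
    by (auto simp: lessThan_atLeast0)
  show ?thesis
    unfolding par_ideal_def ts[symmetric]
  proof (rule hexact_nonzerodivisor)
    show "hexact (vand_form n t k # map (vand_form n t) (rev [0..<k])) (face_ideal \<Delta>)"
      using CM_hexact[OF cm d t, of "Suc k"] \<open>k < d\<close> by simp
    show "ring_ideal.subspace (face_ideal \<Delta> :: ((nat \<Rightarrow>\<^sub>0 nat) \<Rightarrow>\<^sub>0 'k) set)"
      using cm by (intro subspace_face_ideal[of n]) (simp add: CM_complex_def)
    show "vand_form n t k * f \<in> ring_ideal.span (set (map (vand_form n t) (rev [0..<k])) \<union> face_ideal \<Delta>)"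
      using assms(6) unfolding ts par_ideal_def .
  qed (use assms(5) in \<open>auto simp: hcomp_def intro: mrestrict_face_ideal homogeneous_vand_form[unfolded One_nat_def]\<close>)
qed


section \<open>Linear algebra\<close>

lemma vector_space_field: "vector_space ((*) :: 'k::field \<Rightarrow> 'k \<Rightarrow> 'k)"
  by (rule vector_space.intro) (rule distrib_left distrib_right mult.assoc[symmetric] mult_1_left)+

context vector_space
begin

lemma subspace_basis_exists:
  assumes "subspace W"
  obtains B where "independent B" "span B = W" "dim W = card B"
  using basis_exists[of W] span_minimal[OF _ assms] by (metis antisym)

lemma span_Int_independent:
  assumes "independent C" "B \<subseteq> C" "x \<in> span B" "x \<in> span (C - B)"
  shows "x = 0"
proof -
  have "representation C x = representation B x"
    using representation_extend[OF assms(1,3,2)] .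
  moreover have "representation C x = representation (C - B) x"
    using representation_extend[OF assms(1,4)] by blast
  ultimately have "representation C x b = 0" for b
    using representation_ne_zero[of B x b] representation_ne_zero[of "C - B" x b] by auto
  moreover have "x \<in> span C" using assms(2,3) span_mono by blast
  ultimately show ?thesis
    using sum_nonzero_representation_eq[OF assms(1), of x] by simp
qed

lemma dim_mono_finite:
  assumes "V \<subseteq> W" "W \<subseteq> span S" "finite S"
  shows "dim V \<le> dim W"
proof -
  obtain B where B: "B \<subseteq> W" "independent B" "W \<subseteq> span B" "card B = dim W"
    by (rule basis_exists)
  have "finite B" using independent_span_bound[OF assms(3) B(2)] B(1) assms(2) by blast
  then show ?thesis using dim_le_card[of V B] assms(1) B(3,4) by auto
qed

lemma subspace_eq_of_dim:
  assumes "subspace V" "subspace W" "V \<subseteq> W" "W \<subseteq> span S" "finite S" "dim W \<le> dim V"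
  shows "V = W"
proof (rule ccontr)
  assume "V \<noteq> W"
  then obtain x where x: "x \<in> W" "x \<notin> V" using assms(3) by blast
  obtain B where B: "independent B" "span B = V" "dim V = card B"
    using subspace_basis_exists[OF assms(1)] .
  have xB: "x \<notin> span B" "x \<notin> B" using x B(2) span_base by blast+
  have "B \<subseteq> W" using assms(3) B(2) span_superset[of B] by simp
  then have "insert x B \<subseteq> W" using x(1) by simp
  have ind: "independent (insert x B)" using independent_insertI[OF xB(1) B(1)] .
  have "finite (insert x B)"
    by (rule conjunct1[OF independent_span_bound[OF assms(5) ind order_trans[OF \<open>insert x B \<subseteq> W\<close> assms(4)]]])
  moreover have "dim (insert x B) = card (insert x B)" by (rule dim_eq_card_independent[OF ind])
  moreover have "dim (insert x B) \<le> dim W"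
    by (rule dim_mono_finite[OF \<open>insert x B \<subseteq> W\<close> assms(4,5)])
  ultimately show False using B(3) assms(6) xB(2) by simp
qed

text \<open>An endomorphism with kernel \<open>W\<close> stands in for the projection to the
  quotient by \<open>W\<close>: it kills a basis of \<open>W\<close> and fixes the other vectors of
  an extended basis.\<close>

lemma linear_kernel_exists:
  assumes "subspace W"
  obtains p where "Vector_Spaces.linear scale scale p" "\<And>x. p x = 0 \<longleftrightarrow> x \<in> W"
proof -
  interpret vp: vector_space_pair scale scale ..
  obtain B where B: "independent B" "span B = W"
    using subspace_basis_exists[OF assms] .
  define E where "E = extend_basis B"
  have E: "B \<subseteq> E" "independent E" "span E = UNIV"
    unfolding E_def using extend_basis_superset independent_extend_basis B(1) by auto
  define p where "p = vp.construct E (\<lambda>b. if b \<in> B then 0 else b)"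
  have lin: "Vector_Spaces.linear scale scale p" unfolding p_def by (rule vp.linear_construct[OF E(2)])
  have pE: "p b = (if b \<in> B then 0 else b)" if "b \<in> E" for b
    unfolding p_def using vp.construct_basis[OF E(2) that] .
  have 0: "p x = 0" if "x \<in> span B" for x
  proof (rule vp.linear_eq_on[OF lin vp.linear_zero that])
    show "p b = 0" if "b \<in> B" for b using pE[of b] that E(1) by auto
  qed
  have id: "p x = x" if "x \<in> span (E - B)" for x
  proof (rule vp.linear_eq_on[OF lin linear_ident that])
    show "p b = b" if "b \<in> E - B" for b using pE[of b] that by auto
  qed
  have "x \<in> W" if px: "p x = 0" for x
  proof -
    have "x \<in> span (B \<union> (E - B))" using E(1,3) by (simp add: Un_absorb1)
    then obtain y z where yz: "x = y + z" "y \<in> span B" "z \<in> span (E - B)"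
      unfolding span_Un by blast
    then have "p x = z" using 0 id lin unfolding Vector_Spaces.linear_iff by simp
    then show ?thesis using px yz B(2) by simp
  qed
  then show thesis using that[OF lin] 0 B(2) by blast
qed

lemma functional_exists:
  assumes "subspace V" "x \<notin> V"
  obtains \<phi> where "Vector_Spaces.linear scale (*) \<phi>" "\<And>v. v \<in> V \<Longrightarrow> \<phi> v = 0" "\<phi> x = 1"
proof -
  interpret vp: vector_space_pair scale "(*)"
    by (intro vector_space_pair.intro vector_space_axioms vector_space_field)
  obtain B where B: "independent B" "span B = V"
    using subspace_basis_exists[OF assms(1)] .
  have x: "x \<notin> span B" "x \<notin> B" using B(2) assms(2) span_base by blast+
  have ind: "independent (insert x B)" using independent_insertI[OF x(1) B(1)] .
  define \<phi> where "\<phi> = vp.construct (insert x B) (\<lambda>b. if b = x then 1 else 0)"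
  have lin: "Vector_Spaces.linear scale (*) \<phi>" unfolding \<phi>_def by (rule vp.linear_construct[OF ind])
  have b: "\<phi> b = (if b = x then 1 else 0)" if "b \<in> insert x B" for b
    unfolding \<phi>_def using vp.construct_basis[OF ind that] .
  have "\<phi> v = 0" if "v \<in> V" for v
  proof (rule vp.linear_eq_on[OF lin vp.linear_zero])
    show "v \<in> span B" using that B(2) by simp
    show "\<phi> w = 0" if "w \<in> B" for w using b[of w] that x(2) by auto
  qed
  then show thesis using that[OF lin] b[of x] by simp
qed

end

context vector_space_pair
begin

text \<open>The ambient spaces of polynomials and functions may be infinite-dimensional, so the
  finiteness that \<open>dim\<close> requires comes from the finite set \<open>S\<close> whose span
  contains \<open>U\<close>.\<close>

lemma dim_kernel_image:
  assumes lin: "Vector_Spaces.linear s1 s2 f" and U: "vs1.subspace U" "U \<subseteq> vs1.span S" "finite S"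
  shows "vs1.dim U = vs1.dim {u \<in> U. f u = 0} + vs2.dim (f ` U)"
proof -
  interpret f: Vector_Spaces.linear s1 s2 f by fact
  let ?K = "{u \<in> U. f u = 0}"
  have K: "vs1.subspace ?K"
    using U(1) by (auto simp: vs1.subspace_def f.zero f.add f.scale)
  obtain B where B: "B \<subseteq> ?K" "vs1.independent B" "?K \<subseteq> vs1.span B" "card B = vs1.dim ?K"
    by (rule vs1.basis_exists)
  have "B \<subseteq> U" using B(1) by blast
  then obtain C where C: "B \<subseteq> C" "C \<subseteq> U" "vs1.independent C" "U \<subseteq> vs1.span C"
    using vs1.maximal_independent_subset_extend[OF _ B(2), of U] by blast
  have finC: "finite C" using vs1.independent_span_bound[OF U(3) C(3)] C(2) U(2) by blast
  have dU: "vs1.dim U = card C" using vs1.basis_card_eq_dim[OF C(2,4,3)] by simp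
  have "x = 0" if x: "x \<in> vs1.span (C - B)" "f x = 0" for x
  proof -
    have "x \<in> U" using x(1) vs1.span_minimal[OF _ U(1), of "C - B"] C(2) by blast
    then have "x \<in> vs1.span B" using x(2) B(3) by blast
    then show ?thesis using vs1.span_Int_independent[OF C(3,1)] x(1) by blast
  qed
  then have inj: "inj_on f (vs1.span (C - B))"
    using f.inj_on_iff_eq_0[of "vs1.span (C - B)"] vs1.subspace_span by blast
  have ind: "vs2.independent (f ` (C - B))"
    using f.independent_injective_image[OF _ inj] vs1.independent_mono[OF C(3)] by blast
  have "f u \<in> vs2.span (f ` (C - B))" if "u \<in> U" for u
  proof -
    have "u \<in> vs1.span (B \<union> (C - B))" using that C(1,4) by (auto simp: Un_absorb1)
    then obtain y z where yz: "u = y + z" "y \<in> vs1.span B" "z \<in> vs1.span (C - B)"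
      unfolding vs1.span_Un by blast
    have "y \<in> ?K" using yz(2) vs1.span_minimal[OF B(1) K] by blast
    then have "f u = f z" using yz(1) f.add by simp
    moreover have "f z \<in> f ` vs1.span (C - B)" using yz(3) by blast
    then have "f z \<in> vs2.span (f ` (C - B))" using f.span_image by blast
    ultimately show ?thesis by simp
  qed
  then have "vs2.dim (f ` U) = card (f ` (C - B))"
    using C(2) ind by (intro vs2.basis_card_eq_dim[symmetric]) auto
  also have "\<dots> = card (C - B)"
    using inj_on_subset[OF inj vs1.span_superset] by (rule card_image)
  also have "\<dots> = card C - card B" using C(1) finC finite_subset by (intro card_Diff_subset) auto
  finally show ?thesis using dU B(4) card_mono[OF finC C(1)] by simp
qed

text \<open>With p of kernel \<open>W\<close>, apply rank-nullity to p on f(U) + W and to p composed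
  with f on \<open>U\<close>. The images agree; the kernels are \<open>W\<close> and the preimage of
  \<open>W\<close> in \<open>U\<close>.\<close>

lemma dim_sum_preimage:
  assumes lin: "Vector_Spaces.linear s1 s2 f" and U: "vs1.subspace U" "U \<subseteq> vs1.span S" "finite S"
    and W: "vs2.subspace W" "W \<subseteq> vs2.span T" "finite T"
  shows "vs2.dim {f u + w | u w. u \<in> U \<and> w \<in> W} + vs1.dim {u \<in> U. f u \<in> W} = vs1.dim U + vs2.dim W"
proof -
  interpret f: Vector_Spaces.linear s1 s2 f by fact
  interpret vp: vector_space_pair s2 s2 ..
  obtain p where p: "Vector_Spaces.linear s2 s2 p" "\<And>x. p x = 0 \<longleftrightarrow> x \<in> W"
    by (rule vs2.linear_kernel_exists[OF W(1)]) blast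
  interpret p: Vector_Spaces.linear s2 s2 p by fact
  let ?V = "{f u + w | u w. u \<in> U \<and> w \<in> W}"
  have V_eq: "?V = {x + w | x w. x \<in> f ` U \<and> w \<in> W}" by blast
  have V: "vs2.subspace ?V"
    unfolding V_eq by (intro vs2.subspace_sums f.subspace_image U(1) W(1))
  have "f ` U \<subseteq> vs2.span (f ` S)" using U(2) f.span_image by blast
  then have "f ` U \<subseteq> vs2.span (f ` S \<union> T)" "W \<subseteq> vs2.span (f ` S \<union> T)"
    using W(2) vs2.span_mono[of _ "f ` S \<union> T"] by blast+
  then have "?V \<subseteq> vs2.span (f ` S \<union> T)" using vs2.span_add by blast
  then have "vs2.dim ?V = vs2.dim {x \<in> ?V. p x = 0} + vs2.dim (p ` ?V)"
    using vp.dim_kernel_image[OF p(1) V, of "f ` S \<union> T"] U(3) W(3) by simp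
  moreover have "{x \<in> ?V. p x = 0} = W"
  proof -
    have "w \<in> ?V" if "w \<in> W" for w
      using that vs1.subspace_0[OF U(1)] f.zero add_0[of w] by (metis (mono_tags, lifting) mem_Collect_eq)
    then show ?thesis using p(2) by blast
  qed
  moreover have "p ` ?V = (p \<circ> f) ` U"
  proof -
    have p_sum: "p (f u + w) = (p \<circ> f) u" if "w \<in> W" for u w using p(2)[of w] that p.add by simp
    show ?thesis
    proof (intro equalityI subsetI)
      fix x assume "x \<in> (p \<circ> f) ` U"
      then obtain u where u: "u \<in> U" "x = p (f u + 0)" by auto
      then have "f u + 0 \<in> ?V" using vs2.subspace_0[OF W(1)] by blast
      then show "x \<in> p ` ?V" using u(2) by blast
    qed (use p_sum in auto)
  qed
  moreover have "vs1.dim U = vs1.dim {u \<in> U. (p \<circ> f) u = 0} + vs2.dim ((p \<circ> f) ` U)"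
    by (rule dim_kernel_image[OF Vector_Spaces.linear_compose[OF lin p(1)] U])
  ultimately show ?thesis using p(2) by simp
qed

end

section \<open>Functions supported on a finite set, and orthogonality\<close>

definition fscale :: "'k::field \<Rightarrow> ('x \<Rightarrow> 'k) \<Rightarrow> 'x \<Rightarrow> 'k" where
  "fscale c f = (\<lambda>x. c * f x)"

global_interpretation fs: vector_space "fscale :: 'k::field \<Rightarrow> ('x \<Rightarrow> 'k) \<Rightarrow> 'x \<Rightarrow> 'k"
  by unfold_locales (auto simp: fscale_def algebra_simps plus_fun_def)

definition supported_on :: "'x set \<Rightarrow> ('x \<Rightarrow> 'k::zero) set" where
  "supported_on X = {f. \<forall>x. x \<notin> X \<longrightarrow> f x = 0}"

definition delta :: "'x \<Rightarrow> 'x \<Rightarrow> 'k::zero_neq_one" where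
  "delta x = (\<lambda>y. if y = x then 1 else 0)"

lemma sum_delta_apply: "finite X \<Longrightarrow> (\<Sum>x\<in>X. fscale (c x) (delta x)) y = (if y \<in> X then c y else 0)"
proof -
  have *: "(\<Sum>x\<in>X. g x) y = (\<Sum>x\<in>X. g x y)" for g :: "'a \<Rightarrow> 'a \<Rightarrow> 'b"
    by (induction X rule: infinite_finite_induct) auto
  have "c x * (if y = x then 1 else 0) = (if y = x then c x else 0)" for x by simp
  then show ?thesis if "finite X" using that unfolding * by (simp add: fscale_def delta_def)
qed

lemma supported_on_eq_sum:
  assumes "finite X" "f \<in> supported_on X"
  shows "f = (\<Sum>x\<in>X. fscale (f x) (delta x))"
  using assms(2) by (intro ext) (simp only: sum_delta_apply[OF assms(1)], auto simp: supported_on_def)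

lemma subspace_supported_on: "fs.subspace (supported_on X)"
  by (rule fs.subspaceI) (auto simp: supported_on_def fscale_def)

lemma supported_on_subset_span:
  assumes "finite X"
  shows "(supported_on X :: ('x \<Rightarrow> 'k::field) set) \<subseteq> fs.span (delta ` X)"
proof
  fix f :: "'x \<Rightarrow> 'k" assume "f \<in> supported_on X"
  then show "f \<in> fs.span (delta ` X)"
    by (subst supported_on_eq_sum[OF assms])
      (auto intro!: fs.span_sum fs.span_scale intro: fs.span_base)
qed

lemma dim_supported_on:
  assumes "finite X"
  shows "fs.dim (supported_on X :: ('x \<Rightarrow> 'k::field) set) = card X"
proof (rule fs.dim_unique)
  show "delta ` X \<subseteq> (supported_on X :: ('x \<Rightarrow> 'k) set)"
    by (auto simp: supported_on_def delta_def)
  show "supported_on X \<subseteq> fs.span (delta ` X :: ('x \<Rightarrow> 'k) set)"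
    using supported_on_subset_span[OF assms] .
  have inj: "inj_on (delta :: 'x \<Rightarrow> 'x \<Rightarrow> 'k) X"
    by (rule inj_onI) (metis delta_def zero_neq_one)
  show "card (delta ` X :: ('x \<Rightarrow> 'k) set) = card X" by (rule card_image[OF inj])
  show "fs.independent (delta ` X :: ('x \<Rightarrow> 'k) set)"
  proof (rule fs.independent_if_scalars_zero)
    fix g and h :: "'x \<Rightarrow> 'k"
    assume 0: "(\<Sum>x\<in>delta ` X. fscale (g x) x :: 'x \<Rightarrow> 'k) = 0" and h: "h \<in> delta ` X"
    obtain y where y: "y \<in> X" "h = delta y" using h by blast
    have "(\<Sum>x\<in>delta ` X. fscale (g x) x :: 'x \<Rightarrow> 'k) = (\<Sum>x\<in>X. fscale (g (delta x)) (delta x))"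
      by (rule sum.reindex_cong[OF inj]) auto
    then have "0 = (\<Sum>x\<in>X. fscale (g (delta x)) (delta x)) y"
      using 0 by simp
    then show "g h = 0" using y by (simp add: sum_delta_apply[OF assms])
  qed (use assms in simp)
qed

lemma functional_as_sum:
  assumes "finite X" "f \<in> supported_on X" "Vector_Spaces.linear fscale (*) \<chi>"
  shows "\<chi> f = (\<Sum>x\<in>X. \<chi> (delta x) * f x)"
proof -
  interpret \<chi>: Vector_Spaces.linear fscale "(*)" \<chi> by fact
  show ?thesis
    by (subst supported_on_eq_sum[OF assms(1,2)]) (simp add: \<chi>.sum \<chi>.scale mult.commute)
qed

text \<open>The Gram pairing has full rank on \<open>V\<close>, since a linear relation among its rows would be one
  among the basis vectors of \<open>V\<close>.\<close>

lemma orthogonal_dim_le: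
  fixes V W :: "('x \<Rightarrow> 'k::field) set"
  assumes X: "finite X" and V: "V \<subseteq> supported_on X" and W: "W \<subseteq> supported_on X"
    and \<phi>: "\<And>x. x \<in> X \<Longrightarrow> \<phi> x \<noteq> 0"
    and orth: "\<And>v w. v \<in> V \<Longrightarrow> w \<in> W \<Longrightarrow> (\<Sum>x\<in>X. \<phi> x * v x * w x) = 0"
  shows "fs.dim V + fs.dim W \<le> card X"
proof -
  interpret vp: vector_space_pair "fscale :: 'k \<Rightarrow> ('x \<Rightarrow> 'k) \<Rightarrow> 'x \<Rightarrow> 'k"
    "fscale :: 'k \<Rightarrow> (('x \<Rightarrow> 'k) \<Rightarrow> 'k) \<Rightarrow> ('x \<Rightarrow> 'k) \<Rightarrow> 'k" ..
  note fin = supported_on_subset_span[OF X]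
  obtain B where B: "B \<subseteq> V" "fs.independent B" "V \<subseteq> fs.span B" "card B = fs.dim V"
    by (rule fs.basis_exists)
  have finB: "finite B"
    using fs.independent_span_bound[OF _ B(2), of "delta ` X"] B(1) V fin X by blast
  define T where "T w = (\<lambda>b. if b \<in> B then \<Sum>x\<in>X. \<phi> x * b x * w x else 0)" for w
  have lin: "Vector_Spaces.linear fscale fscale T"
    unfolding Vector_Spaces.linear_iff
    by (intro conjI fs.vector_space_axioms allI)
      (auto simp: T_def fscale_def algebra_simps sum.distrib sum_distrib_left)
  have im: "T ` supported_on X = supported_on B"
  proof (rule ccontr)
    assume ne: "T ` supported_on X \<noteq> supported_on B"
    have sub: "T ` supported_on X \<subseteq> supported_on B" by (auto simp: T_def supported_on_def)
    then obtain y where y: "y \<in> supported_on B" "y \<notin> T ` supported_on X" using ne by blast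
    have "fs.subspace (T ` supported_on X)"
      by (rule vp.linear_subspace_image[OF lin subspace_supported_on])
    then obtain \<psi> where \<psi>: "Vector_Spaces.linear fscale (*) \<psi>" "\<And>v. v \<in> T ` supported_on X \<Longrightarrow> \<psi> v = 0" "\<psi> y = 1"
      by (rule fs.functional_exists[OF _ y(2)]) blast
    let ?c = "\<lambda>b. \<psi> (delta b)"
    \<comment> \<open>Testing the functional on \<open>T (delta x)\<close> gives \<phi> x times the
      value of this combination at \<open>x\<close>, so the value is 0 because \<phi> x is
      not.\<close>
    have "(\<Sum>b\<in>B. fscale (?c b) b) = 0"
    proof
      fix x
      have s: "(\<Sum>b\<in>B. fscale (?c b) b) x = (\<Sum>b\<in>B. ?c b * b x)"
        using finB by (induction B) (simp_all add: fscale_def)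
      show "(\<Sum>b\<in>B. fscale (?c b) b) x = 0 x"
      proof (cases "x \<in> X")
        case True
        have "delta x \<in> supported_on X" using True by (auto simp: supported_on_def delta_def)
        then have "T (delta x) \<in> T ` supported_on X" by blast
        then have "0 = (\<Sum>b\<in>B. ?c b * T (delta x) b)"
          using \<psi>(2) functional_as_sum[OF finB _ \<psi>(1)] sub by (metis subsetD)
        also have "\<dots> = (\<Sum>b\<in>B. ?c b * (\<phi> x * b x))"
        proof (rule sum.cong[OF refl])
          fix b assume "b \<in> B"
          have "(\<Sum>z\<in>X. \<phi> z * b z * delta x z) = (\<Sum>z\<in>X. if z = x then \<phi> z * b z else 0)"
            by (intro sum.cong) (auto simp: delta_def)
          then show "?c b * T (delta x) b = ?c b * (\<phi> x * b x)"
            using True X \<open>b \<in> B\<close> by (simp add: T_def)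
        qed
        also have "\<dots> = \<phi> x * (\<Sum>b\<in>B. ?c b * b x)"
          by (simp add: sum_distrib_left mult.left_commute)
        finally show ?thesis using \<phi>[OF True] s by simp
      next
        case False
        then have "b x = 0" if "b \<in> B" for b
          using that B(1) V by (auto simp: supported_on_def)
        then show ?thesis unfolding s by (simp add: sum.neutral)
      qed
    qed
    then have "?c b = 0" if "b \<in> B" for b
      using fs.independentD[OF B(2) finB order_refl, of ?c] that by simp
    then have "\<psi> y = 0" using functional_as_sum[OF finB y(1) \<psi>(1)] by simp
    then show False using \<psi>(3) by simp
  qed
  have "fs.dim (supported_on X :: ('x \<Rightarrow> 'k) set) =
      fs.dim {u \<in> supported_on X. T u = 0} + fs.dim (T ` supported_on X)"
    by (rule vp.dim_kernel_image[OF lin subspace_supported_on fin]) (use X in simp)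
  then have "card X = fs.dim {u \<in> supported_on X. T u = 0} + fs.dim V"
    unfolding im dim_supported_on[OF X] dim_supported_on[OF finB] B(4) .
  moreover have "W \<subseteq> {u \<in> supported_on X. T u = 0}"
    using W orth B(1) by (auto simp: T_def fun_eq_iff)
  then have "fs.dim W \<le> fs.dim {u \<in> supported_on X. T u = 0}"
    by (rule fs.dim_mono_finite[where S = "delta ` X"]) (use fin X in auto)
  ultimately show ?thesis by simp
qed

text \<open>Each coordinate separately can be made nonzero, because \<open>delta x\<close> is not in
  \<open>V\<close>. Coordinates are then handled one after another: replace \<phi> by \<phi> + c
  \<psi>, where c avoids the finitely many values at which a coordinate would vanish.\<close>

lemma annihilator_nonzero:
  fixes V :: "('x \<Rightarrow> 'k::field) set"
  assumes inf: "infinite (UNIV :: 'k set)" and X: "finite X" and V: "fs.subspace V" "V \<subseteq> supported_on X"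
    and \<delta>: "\<And>x. x \<in> X \<Longrightarrow> delta x \<notin> V"
  obtains \<phi> where "\<And>x. x \<in> X \<Longrightarrow> \<phi> x \<noteq> 0" "\<And>v. v \<in> V \<Longrightarrow> (\<Sum>x\<in>X. \<phi> x * v x) = 0"
proof -
  have single: "\<exists>\<psi>. \<psi> y \<noteq> 0 \<and> (\<forall>v\<in>V. (\<Sum>x\<in>X. \<psi> x * v x) = 0)" if y: "y \<in> X" for y
  proof -
    obtain \<chi> where \<chi>: "Vector_Spaces.linear fscale (*) \<chi>" "\<And>v. v \<in> V \<Longrightarrow> \<chi> v = 0" "\<chi> (delta y) = 1"
      by (rule fs.functional_exists[OF V(1) \<delta>[OF y]]) blast
    show ?thesis
      using \<chi> functional_as_sum[OF X _ \<chi>(1)] V(2)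
      by (intro exI[of _ "\<lambda>x. \<chi> (delta x)"]) (metis subsetD zero_neq_one)
  qed
  have "\<exists>\<phi>. (\<forall>y\<in>Y. \<phi> y \<noteq> 0) \<and> (\<forall>v\<in>V. (\<Sum>x\<in>X. \<phi> x * v x) = 0)" if "finite Y" "Y \<subseteq> X" for Y
    using that
  proof (induction Y)
    case empty
    show ?case by (intro exI[of _ "\<lambda>_. 0"]) simp
  next
    case (insert y Y)
    then obtain \<phi> where \<phi>: "\<forall>y\<in>Y. \<phi> y \<noteq> 0" "\<forall>v\<in>V. (\<Sum>x\<in>X. \<phi> x * v x) = 0" by auto
    obtain \<psi> where \<psi>: "\<psi> y \<noteq> 0" "\<forall>v\<in>V. (\<Sum>x\<in>X. \<psi> x * v x) = 0"
      using single insert.prems by blast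
    \<comment> \<open>Where \<psi> z = 0 the quotient is 0 by convention, which merely excludes c =
      0 as well.\<close>
    have "finite ((\<lambda>z. - \<phi> z / \<psi> z) ` insert y Y)" using insert.hyps by simp
    then obtain c where c: "c \<notin> (\<lambda>z. - \<phi> z / \<psi> z) ` insert y Y"
      using ex_new_if_finite[OF inf] by blast
    have "\<phi> z + c * \<psi> z \<noteq> 0" if "z \<in> insert y Y" for z
    proof
      assume 0: "\<phi> z + c * \<psi> z = 0"
      show False
      proof (cases "\<psi> z = 0")
        case True
        then have "z \<in> Y" using that \<psi>(1) by auto
        then show False using 0 True \<phi>(1) by simp
      next
        case False
        then have "c = - \<phi> z / \<psi> z" using 0 by (simp add: field_simps add_eq_0_iff)
        then show False using c that by blast
      qed
    qed
    moreover have "(\<Sum>x\<in>X. (\<phi> x + c * \<psi> x) * v x) = 0" if "v \<in> V" for v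
    proof -
      have "(\<Sum>x\<in>X. (\<phi> x + c * \<psi> x) * v x) = (\<Sum>x\<in>X. \<phi> x * v x) + c * (\<Sum>x\<in>X. \<psi> x * v x)"
        by (simp add: distrib_right sum.distrib sum_distrib_left mult.assoc)
      then show ?thesis using \<phi>(2) \<psi>(2) that by simp
    qed
    ultimately show ?case by (intro exI[of _ "\<lambda>x. \<phi> x + c * \<psi> x"]) blast
  qed
  from this[OF X order_refl] show thesis using that by blast
qed


section \<open>Face counting\<close>

text \<open>Reversing the coefficients turns (t - 1)^m into (1 - X)^m. This passes from the indexing
  of the h-vector from the top to power series.\<close>

lemma coeff_linear_power_reflect:
  assumes "j \<le> m"
  shows "Polynomial.coeff ([:- 1, 1 :: int:] ^ m) (m - j) = fps_nth ((1 - fps_X) ^ m) j"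
proof -
  have deg: "Polynomial.degree ([:- 1, 1 :: int:] ^ m) = m" by (simp add: degree_linear_power)
  have r: "reflect_poly [:- 1, 1 :: int:] = [:1, - 1:]" by (simp add: reflect_poly_def)
  have "fps_of_poly [:1, - 1 :: int:] = 1 - fps_X" by (simp add: fps_of_poly_pCons)
  then have "fps_nth ((1 - fps_X) ^ m) j = Polynomial.coeff (reflect_poly ([:- 1, 1 :: int:] ^ m)) j"
    unfolding reflect_poly_power r by (metis fps_of_poly_nth fps_of_poly_power)
  then show ?thesis using assms deg by (simp add: coeff_reflect_poly)
qed

lemma h_poly_eq:
  assumes "finite \<Delta>" "\<And>F. F \<in> \<Delta> \<Longrightarrow> card F \<le> d"
  shows "h_poly d \<Delta> = (\<Sum>F\<in>\<Delta>. [:- 1, 1:] ^ (d - card F))"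
proof -
  have "(\<Sum>F\<in>\<Delta>. [:- 1, 1 :: int:] ^ (d - card F)) =
      (\<Sum>k\<in>{..d}. \<Sum>F\<in>{F \<in> \<Delta>. card F = k}. [:- 1, 1:] ^ (d - card F))"
    using assms by (intro sum.group[symmetric]) auto
  also have "\<dots> = (\<Sum>k\<le>d. of_nat (f_vec \<Delta> (int k - 1)) * [:- 1, 1:] ^ (d - k))"
    by (intro sum.cong) (auto simp: f_vec_def)
  finally show ?thesis by (simp add: h_poly_def)
qed

text \<open>In this form the h-vector is recognisable as the numerator of the Hilbert series
  computed in \<open>face_mons_fps\<close>.\<close>

lemma h_vec_fps:
  assumes "finite \<Delta>" "\<And>F. F \<in> \<Delta> \<Longrightarrow> card F \<le> d" "complex_dim \<Delta> = int d - 1" "k \<le> d"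
  shows "h_vec \<Delta> k = (\<Sum>F\<in>\<Delta>. fps_nth (fps_X ^ card F * (1 - fps_X) ^ (d - card F)) k)"
proof -
  have "h_vec \<Delta> k = (\<Sum>F\<in>\<Delta>. Polynomial.coeff ([:- 1, 1:] ^ (d - card F)) (d - k))"
    using assms by (simp add: h_vec_def Let_def h_poly_eq coeff_sum)
  also have "\<dots> = (\<Sum>F\<in>\<Delta>. fps_nth (fps_X ^ card F * (1 - fps_X) ^ (d - card F)) k)"
  proof (rule sum.cong[OF refl])
    fix F assume F: "F \<in> \<Delta>"
    show "Polynomial.coeff ([:- 1, 1 :: int:] ^ (d - card F)) (d - k) =
        fps_nth (fps_X ^ card F * (1 - fps_X) ^ (d - card F)) k"
    proof (cases "k < card F")
      case True
      then have "Polynomial.degree ([:- 1, 1 :: int:] ^ (d - card F)) < d - k"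
        using assms(2)[OF F] by (simp add: degree_linear_power)
      then have "Polynomial.coeff ([:- 1, 1 :: int:] ^ (d - card F)) (d - k) = 0"
        by (rule coeff_eq_0)
      then show ?thesis using True by (simp add: fps_X_power_mult_nth)
    next
      case False
      then have "d - k = (d - card F) - (k - card F)" "k - card F \<le> d - card F"
        using assms(4) by auto
      then show ?thesis
        using False coeff_linear_power_reflect[of "k - card F" "d - card F"]
        by (simp add: fps_X_power_mult_nth)
    qed
  qed
  finally show ?thesis .
qed

text \<open>Evaluation at t = 1 keeps only the faces of size \<open>d\<close>, through
  \<open>0 ^ 0 = 1\<close>.\<close>

lemma sum_h_vec:
  assumes "finite \<Delta>" "\<And>F. F \<in> \<Delta> \<Longrightarrow> card F \<le> d" "complex_dim \<Delta> = int d - 1"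
  shows "(\<Sum>k\<le>d. h_vec \<Delta> k) = int (card {F \<in> \<Delta>. card F = d})"
proof -
  have "(\<Sum>k\<le>d. h_vec \<Delta> k) = (\<Sum>k\<le>d. Polynomial.poly (Polynomial.monom (h_vec \<Delta> k) (d - k)) 1)"
    by (simp add: poly_monom)
  also have "\<dots> = Polynomial.poly (h_poly d \<Delta>) 1"
    using h_vec_eq[OF assms(3)] by (simp add: h_poly_def poly_sum)
  also have "\<dots> = (\<Sum>F\<in>\<Delta>. 0 ^ (d - card F))"
    using assms by (simp add: h_poly_eq poly_sum)
  also have "\<dots> = (\<Sum>F\<in>\<Delta>. if card F = d then 1 else 0)"
  proof (rule sum.cong[OF refl])
    fix F assume "F \<in> \<Delta>"
    then show "(0 :: int) ^ (d - card F) = (if card F = d then 1 else 0)"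
      using assms(2)[of F] by (auto simp: power_0_left)
  qed
  also have "\<dots> = int (card {F \<in> \<Delta>. card F = d})"
    using assms(1) by (simp add: sum.If_cases Int_def)
  finally show ?thesis .
qed

section \<open>Generating functions of monomials supported on faces\<close>

definition mons :: "nat set \<Rightarrow> nat \<Rightarrow> (nat \<Rightarrow>\<^sub>0 nat) set" where
  "mons F D = {m. Poly_Mapping.keys m = F \<and> mdeg m = D}"

text \<open>Divide by x_a: the quotient still contains x_a if its exponent was at least 2, and
  otherwise has support \<open>F\<close>.\<close>

lemma finite_mons_insert:
  assumes "a \<notin> F" "finite (mons (insert a F) D)" "finite (mons F D)"
  shows "finite (mons (insert a F) (Suc D))"
    and "card (mons (insert a F) (Suc D)) = card (mons (insert a F) D) + card (mons F D)"
proof -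
  let ?s = "Poly_Mapping.single a (1 :: nat)"
  have inj: "inj_on (\<lambda>m. m + ?s) S" for S by (rule inj_onI) simp
  have "mons (insert a F) (Suc D) = (\<lambda>m. m + ?s) ` (mons (insert a F) D \<union> mons F D)"
  proof (intro equalityI subsetI)
    fix m assume m: "m \<in> mons (insert a F) (Suc D)"
    then have "a \<in> Poly_Mapping.keys m" by (auto simp: mons_def)
    define r where "r = m - ?s"
    have eq: "m = r + ?s"
      using \<open>a \<in> Poly_Mapping.keys m\<close> unfolding r_def
      by (intro poly_mapping_eqI) (auto simp: lookup_add lookup_minus lookup_single when_def in_keys_iff)
    then have "Poly_Mapping.keys m = insert a (Poly_Mapping.keys r)"
      using keys_add_nat[of r ?s] by simp
    then have "Poly_Mapping.keys r = insert a F \<or> Poly_Mapping.keys r = F"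
      using m assms(1) by (auto simp: mons_def)
    moreover have "mdeg r = D"
      using m unfolding eq by (simp add: mons_def mdeg_add)
    ultimately have "r \<in> mons (insert a F) D \<union> mons F D" by (simp add: mons_def)
    then show "m \<in> (\<lambda>m. m + ?s) ` (mons (insert a F) D \<union> mons F D)" 
      using image_eqI[of m "\<lambda>m. m + ?s" r] eq by simp
  next
    fix m assume "m \<in> (\<lambda>m. m + ?s) ` (mons (insert a F) D \<union> mons F D)"
    then obtain r where r: "m = r + ?s" "r \<in> mons (insert a F) D \<union> mons F D" by (rule imageE)
    then show "m \<in> mons (insert a F) (Suc D)"
      unfolding r(1) mons_def by (auto simp: keys_add_nat mdeg_add simp del: One_nat_def)
  qed
  moreover have "mons (insert a F) D \<inter> mons F D = {}"
    using assms(1) by (auto simp: mons_def)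
  ultimately show "finite (mons (insert a F) (Suc D))"
    "card (mons (insert a F) (Suc D)) = card (mons (insert a F) D) + card (mons F D)"
    using assms(2,3) by (simp_all add: card_image[OF inj[unfolded One_nat_def]] card_Un_disjoint)
qed

lemma mons_0: "a \<in> F \<Longrightarrow> mons F 0 = {}"
  by (auto simp: mons_def)

lemma finite_mons: "finite F \<Longrightarrow> finite (mons F D)"
proof (induction F arbitrary: D rule: finite_induct)
  case empty
  have "mons {} D \<subseteq> {0}" by (auto simp: mons_def)
  then show ?case using finite_subset by blast
next
  case (insert a F)
  show ?case
  proof (induction D)
    case 0
    then show ?case by (simp add: mons_0[of a])
  next
    case (Suc D)
    then show ?case using finite_mons_insert(1) insert by blast
  qed
qed

text \<open>The generating function is (X / (1 - X))^|F|, one factor for each variable, here with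
  the denominator cleared.\<close>

lemma mons_fps:
  "finite F \<Longrightarrow> Abs_fps (\<lambda>D. int (card (mons F D))) * (1 - fps_X) ^ card F = fps_X ^ card F"
proof (induction F rule: finite_induct)
  case empty
  have "mons {} D = (if D = 0 then {0} else {})" for D by (auto simp: mons_def)
  then have "Abs_fps (\<lambda>D. int (card (mons {} D))) = 1" by (intro fps_ext) auto
  then show ?case by simp
next
  case (insert a F)
  let ?G = "\<lambda>F. Abs_fps (\<lambda>D. int (card (mons F D)))"
  have "?G (insert a F) * (1 - fps_X) = fps_X * ?G F"
  proof (rule fps_ext)
    fix D
    have "fps_nth (?G (insert a F) * (1 - fps_X)) D =
        int (card (mons (insert a F) D)) - (if D = 0 then 0 else int (card (mons (insert a F) (D - 1))))"
      by (simp add: right_diff_distrib)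
    then show "fps_nth (?G (insert a F) * (1 - fps_X)) D = fps_nth (fps_X * ?G F) D"
      using finite_mons_insert(2)[OF insert.hyps(2)] finite_mons insert.hyps(1)
      by (cases D) (simp_all add: mons_0[of a])
  qed
  then have "?G (insert a F) * (1 - fps_X) * (1 - fps_X) ^ card F = fps_X * ?G F * (1 - fps_X) ^ card F"
    by simp
  also have "\<dots> = fps_X * fps_X ^ card F"
    by (simp only: mult.assoc insert.IH)
  finally show ?case
    unfolding card_insert_disjoint[OF insert.hyps(1,2)] power_Suc mult.assoc .
qed

definition face_mons :: "nat set set \<Rightarrow> nat \<Rightarrow> (nat \<Rightarrow>\<^sub>0 nat) set" where
  "face_mons \<Delta> D = {m. Poly_Mapping.keys m \<in> \<Delta> \<and> mdeg m = D}"

lemma face_mons_eq: "face_mons \<Delta> D = (\<Union>F\<in>\<Delta>. mons F D)"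
  by (auto simp: face_mons_def mons_def)

lemma finite_face_mons: "finite \<Delta> \<Longrightarrow> (\<And>F. F \<in> \<Delta> \<Longrightarrow> finite F) \<Longrightarrow> finite (face_mons \<Delta> D)"
  by (auto simp: face_mons_eq finite_mons)

lemma face_mons_fps:
  assumes "finite \<Delta>" "\<And>F. F \<in> \<Delta> \<Longrightarrow> finite F" "\<And>F. F \<in> \<Delta> \<Longrightarrow> card F \<le> d"
  shows "Abs_fps (\<lambda>D. int (card (face_mons \<Delta> D))) * (1 - fps_X) ^ d =
    (\<Sum>F\<in>\<Delta>. fps_X ^ card F * (1 - fps_X) ^ (d - card F))"
proof -
  have "card (face_mons \<Delta> D) = (\<Sum>F\<in>\<Delta>. card (mons F D))" for D
    unfolding face_mons_eq by (rule card_UN_disjoint) (use assms finite_mons in \<open>auto simp: mons_def\<close>)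
  then have "Abs_fps (\<lambda>D. int (card (face_mons \<Delta> D))) = (\<Sum>F\<in>\<Delta>. Abs_fps (\<lambda>D. int (card (mons F D))))"
    by (intro fps_ext) (simp add: fps_sum_nth)
  then have "Abs_fps (\<lambda>D. int (card (face_mons \<Delta> D))) * (1 - fps_X) ^ d =
      (\<Sum>F\<in>\<Delta>. Abs_fps (\<lambda>D. int (card (mons F D))) * (1 - fps_X) ^ d)"
    by (simp add: sum_distrib_right)
  also have "\<dots> = (\<Sum>F\<in>\<Delta>. fps_X ^ card F * (1 - fps_X) ^ (d - card F))"
  proof (rule sum.cong[OF refl])
    fix F assume F: "F \<in> \<Delta>"
    have e: "(1 - fps_X :: int fps) ^ d = (1 - fps_X) ^ card F * (1 - fps_X) ^ (d - card F)"
      unfolding power_add[symmetric] using assms(3)[OF F] by simp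
    then show "Abs_fps (\<lambda>D. int (card (mons F D))) * (1 - fps_X) ^ d =
        fps_X ^ card F * (1 - fps_X) ^ (d - card F)"
      by (simp only: e mult.assoc[symmetric] mons_fps[OF assms(2)[OF F]])
  qed
  finally show ?thesis .
qed

text \<open>Omitting one of the \<open>d\<close> factors 1 - X means dividing by 1 - X, which
  replaces coefficients by partial sums.\<close>

lemma sum_h_vec_fps:
  assumes "finite \<Delta>" "\<And>F. F \<in> \<Delta> \<Longrightarrow> finite F" "\<And>F. F \<in> \<Delta> \<Longrightarrow> card F \<le> d"
    and "complex_dim \<Delta> = int d - 1" "d > 0" "D \<le> d"
  shows "fps_nth (Abs_fps (\<lambda>D. int (card (face_mons \<Delta> D))) * (1 - fps_X) ^ (d - 1)) D =
    (\<Sum>k\<le>D. h_vec \<Delta> k)"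
proof -
  let ?g = "Abs_fps (\<lambda>D. int (card (face_mons \<Delta> D))) * (1 - fps_X) ^ (d - 1)"
  have "?g * (1 - fps_X) = Abs_fps (\<lambda>D. int (card (face_mons \<Delta> D))) * (1 - fps_X) ^ d"
    using \<open>d > 0\<close> by (cases d) (simp_all add: mult.assoc mult.commute)
  then have g: "?g * (1 - fps_X) = (\<Sum>F\<in>\<Delta>. fps_X ^ card F * (1 - fps_X) ^ (d - card F))"
    using face_mons_fps[OF assms(1-3)] by simp
  have h: "fps_nth (?g * (1 - fps_X)) k = h_vec \<Delta> k" if "k \<le> d" for k
    unfolding g using h_vec_fps[OF assms(1,3,4) that] by (simp add: fps_sum_nth)
  have nth: "fps_nth (g * (1 - fps_X)) (Suc D) = fps_nth g (Suc D) - fps_nth g D"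
    for g :: "int fps" and D
    by (simp add: right_diff_distrib)
  show ?thesis
    using \<open>D \<le> d\<close>
  proof (induction D)
    case 0
    then show ?case using h[of 0] by simp
  next
    case (Suc D)
    have "fps_nth (?g * (1 - fps_X)) (Suc D) = fps_nth ?g (Suc D) - fps_nth ?g D"
      by (rule nth)
    then show ?case using Suc h[of "Suc D"] by simp
  qed
qed


section \<open>Hilbert functions and evaluation at points\<close>

definition pscale :: "'k::field \<Rightarrow> ((nat \<Rightarrow>\<^sub>0 nat) \<Rightarrow>\<^sub>0 'k) \<Rightarrow> (nat \<Rightarrow>\<^sub>0 nat) \<Rightarrow>\<^sub>0 'k" where
  "pscale c f = Poly_Mapping.single 0 c * f"

global_interpretation pv: vector_space "pscale :: 'k::field \<Rightarrow> ((nat \<Rightarrow>\<^sub>0 nat) \<Rightarrow>\<^sub>0 'k) \<Rightarrow> _"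
  by (rule vector_space.intro)
    (simp_all add: pscale_def distrib_left distrib_right single_add mult_single flip: mult.assoc)

lemma lookup_pscale: "Poly_Mapping.lookup (pscale c f) m = c * Poly_Mapping.lookup f m"
  unfolding pscale_def mult_map_scale_conv_mult[symmetric]
  by (simp add: Poly_Mapping.map.rep_eq when_def)

lemma pv_subspace_ideal: "ring_ideal.subspace J \<Longrightarrow> pv.subspace J"
  unfolding ring_ideal.subspace_def pv.subspace_def pscale_def by blast

lemma mrestrict_pscale: "mrestrict P (pscale c f) = pscale c (mrestrict P f)"
  by (rule poly_mapping_eqI) (simp add: lookup_mrestrict lookup_pscale when_def)

lemma peval_pscale: "peval p (pscale c f) = c * peval p f"
  by (simp add: pscale_def peval_mult peval_single)

definition poly_span :: "(nat \<Rightarrow>\<^sub>0 nat) set \<Rightarrow> ((nat \<Rightarrow>\<^sub>0 nat) \<Rightarrow>\<^sub>0 'k::field) set" where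
  "poly_span M = {f. Poly_Mapping.keys f \<subseteq> M}"

lemma subspace_poly_span: "pv.subspace (poly_span M)"
proof (rule pv.subspaceI)
  show "x + y \<in> poly_span M" if "x \<in> poly_span M" "y \<in> poly_span M"
    for x y :: "(nat \<Rightarrow>\<^sub>0 nat) \<Rightarrow>\<^sub>0 'a"
    using that Poly_Mapping.keys_add[of x y] by (auto simp: poly_span_def)
  show "pscale c x \<in> poly_span M" if "x \<in> poly_span M" for c and x :: "(nat \<Rightarrow>\<^sub>0 nat) \<Rightarrow>\<^sub>0 'a"
    using that by (auto simp: poly_span_def in_keys_iff lookup_pscale)
qed (simp add: poly_span_def)

lemma poly_span_subset:
  "(poly_span M :: ((nat \<Rightarrow>\<^sub>0 nat) \<Rightarrow>\<^sub>0 'k::field) set) \<subseteq> pv.span ((\<lambda>m. Poly_Mapping.single m 1) ` M)"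
proof
  fix f :: "(nat \<Rightarrow>\<^sub>0 nat) \<Rightarrow>\<^sub>0 'k" assume f: "f \<in> poly_span M"
  have "Poly_Mapping.single m (Poly_Mapping.lookup f m) \<in> pv.span ((\<lambda>m. Poly_Mapping.single m 1) ` M)"
    if m: "m \<in> Poly_Mapping.keys f" for m
  proof -
    have "Poly_Mapping.single m (Poly_Mapping.lookup f m) =
        pscale (Poly_Mapping.lookup f m) (Poly_Mapping.single m 1)"
      by (simp add: pscale_def mult_single)
    moreover have "Poly_Mapping.single m 1 \<in> pv.span ((\<lambda>m. Poly_Mapping.single m (1 :: 'k)) ` M)"
      using m f by (intro pv.span_base) (auto simp: poly_span_def)
    ultimately show ?thesis using pv.span_scale by metis
  qed
  then show "f \<in> pv.span ((\<lambda>m. Poly_Mapping.single m 1) ` M)"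
    by (subst poly_mapping_as_sum[of f]) (rule pv.span_sum)
qed

lemma dim_poly_span:
  assumes "finite M"
  shows "pv.dim (poly_span M :: ((nat \<Rightarrow>\<^sub>0 nat) \<Rightarrow>\<^sub>0 'k::field) set) = card M"
proof (rule pv.dim_unique)
  let ?b = "\<lambda>m. Poly_Mapping.single m 1 :: (nat \<Rightarrow>\<^sub>0 nat) \<Rightarrow>\<^sub>0 'k"
  have inj: "inj_on ?b M"
    by (rule inj_onI) (metis lookup_single_eq lookup_single_not_eq zero_neq_one)
  show "?b ` M \<subseteq> poly_span M" by (auto simp: poly_span_def)
  show "poly_span M \<subseteq> pv.span (?b ` M)" by (rule poly_span_subset)
  show "card (?b ` M) = card M" by (rule card_image[OF inj])
  show "pv.independent (?b ` M)"
  proof (rule pv.independent_if_scalars_zero)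
    fix g and x :: "(nat \<Rightarrow>\<^sub>0 nat) \<Rightarrow>\<^sub>0 'k"
    assume 0: "(\<Sum>x\<in>?b ` M. pscale (g x) x) = 0" and "x \<in> ?b ` M"
    then obtain m where m: "m \<in> M" "x = ?b m" by blast
    have "(\<Sum>x\<in>?b ` M. pscale (g x) x) = (\<Sum>m\<in>M. pscale (g (?b m)) (?b m))"
      by (rule sum.reindex_cong[OF inj]) auto
    then have "0 = Poly_Mapping.lookup (\<Sum>k\<in>M. pscale (g (?b k)) (?b k)) m" using 0 by simp
    also have "\<dots> = (\<Sum>k\<in>M. if k = m then g (?b k) else 0)"
      unfolding lookup_sum lookup_pscale lookup_single by (intro sum.cong) (auto simp: when_def)
    finally show "g x = 0" using m assms by simp
  qed (use assms in simp)
qed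

text \<open>The polynomials all of whose components lie in the ideal form an ideal themselves, as a
  monomial factor only shifts components. So generators suffice.\<close>

lemma hcomp_span:
  fixes S :: "((nat \<Rightarrow>\<^sub>0 nat) \<Rightarrow>\<^sub>0 'k::field) set"
  assumes "\<And>s D. s \<in> S \<Longrightarrow> hcomp D s \<in> ring_ideal.span S" and "f \<in> ring_ideal.span S"
  shows "hcomp D f \<in> ring_ideal.span S"
proof -
  let ?P = "{f. \<forall>D. hcomp D f \<in> ring_ideal.span S}"
  have single: "hcomp D (Poly_Mapping.single m a * x) \<in> ring_ideal.span S" if "x \<in> ?P" for m a x D
  proof (cases "mdeg m \<le> D")
    case True
    then have "hcomp D (Poly_Mapping.single m a * x) = Poly_Mapping.single m a * hcomp (D - mdeg m) x"
      using hcomp_mult[OF homogeneous_single, of m "D - mdeg m" a x] by simp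
    moreover have "hcomp (D - mdeg m) x \<in> ring_ideal.span S" using that by blast
    ultimately show ?thesis using ring_ideal.span_scale[of "hcomp (D - mdeg m) x" S] by simp
  next
    case False
    then show ?thesis
      using hcomp_mult_less[OF homogeneous_single, of D m a x] by (simp add: ring_ideal.span_zero)
  qed
  have "ring_ideal.subspace ?P"
  proof (rule ring_ideal.subspaceI)
    fix c x assume x: "x \<in> ?P"
    have "hcomp D (c * x) \<in> ring_ideal.span S" for D
    proof -
      have "c * x = (\<Sum>m\<in>Poly_Mapping.keys c. Poly_Mapping.single m (Poly_Mapping.lookup c m) * x)"
        by (subst poly_mapping_as_sum[of c]) (simp add: sum_distrib_right)
      then have "hcomp D (c * x) =
          (\<Sum>m\<in>Poly_Mapping.keys c. hcomp D (Poly_Mapping.single m (Poly_Mapping.lookup c m) * x))"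
        by (simp add: hcomp_def mrestrict_sum)
      then show ?thesis using single[OF x] by (simp add: ring_ideal.span_sum)
    qed
    then show "c * x \<in> ?P" by blast
  qed (auto simp: ring_ideal.span_zero hcomp_add ring_ideal.span_add)
  then have "ring_ideal.span S \<subseteq> ?P"
    using assms(1) by (intro ring_ideal.span_minimal) auto
  then show ?thesis using assms(2) by blast
qed

text \<open>The points: \<open>lag_point t F\<close> is the point of the coordinate subspace of \<open>F\<close> on which
  \<open>vand_form n t j\<close> is the divided difference of \<open>x\<^sup>j\<close> at the nodes \<open>t i\<close>, \<open>i \<in> F\<close>.\<close>

definition lag_point :: "(nat \<Rightarrow> 'k::field) \<Rightarrow> nat set \<Rightarrow> nat \<Rightarrow> 'k" where
  "lag_point t F i = (if i \<in> F then \<Prod>l\<in>F - {i}. inverse (t i - t l) else 0)"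

lemma lag_point_nonzero:
  assumes "finite F" "inj_on t F" "i \<in> F"
  shows "lag_point t F i \<noteq> 0"
  using assms by (auto simp: lag_point_def inj_on_def)

text \<open>Interpolation at \<open>d\<close> nodes reproduces X^j for j < d, since the error has
  degree below \<open>d\<close> and \<open>d\<close> roots. The claim compares the coefficients of
  X^(d-1), and \<open>lag_point\<close> is the leading coefficient of the Lagrange
  polynomial.\<close>

lemma divided_difference:
  fixes t :: "nat \<Rightarrow> 'k::field"
  assumes F: "finite F" "inj_on t F" "card F = d" and j: "j < d"
  shows "(\<Sum>i\<in>F. t i ^ j * lag_point t F i) = (if j = d - 1 then 1 else 0)"
proof -
  let ?p = "(\<Sum>i\<in>F. Polynomial.smult (t i ^ j) (lagrange t F i)) - Polynomial.monom 1 j"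
  have degl: "Polynomial.degree (Polynomial.smult (t i ^ j) (lagrange t F i)) \<le> d - 1" if "i \<in> F" for i
    using degree_lagrange[OF F(1) that, of t] F(3) degree_smult_le[of "t i ^ j" "lagrange t F i"] by simp
  have "Polynomial.degree ?p \<le> d - 1"
    using j degl by (intro degree_diff_le degree_sum_le F(1)) (auto simp: degree_monom_eq)
  then have deg: "Polynomial.degree ?p < card (t ` F)"
    using j by (simp add: card_image F)
  have "Polynomial.poly ?p x = 0" if "x \<in> t ` F" for x
  proof -
    obtain l where l: "l \<in> F" "x = t l" using \<open>x \<in> t ` F\<close> by blast
    have "(\<Sum>i\<in>F. t i ^ j * Polynomial.poly (lagrange t F i) (t l)) = (\<Sum>i\<in>F. if i = l then t i ^ j else 0)"
      using poly_lagrange[OF F(1,2) _ l(1)] by (intro sum.cong) auto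
    then show ?thesis using l F(1) by (simp add: poly_sum poly_monom)
  qed
  then have "t ` F \<subseteq> {x. Polynomial.poly ?p x = 0}" by blast
  then have "?p = 0"
    using deg card_poly_roots_bound[of ?p] card_mono[OF poly_roots_finite[of ?p]]
    by (metis (no_types, lifting) leD le_trans)
  then have "0 = Polynomial.coeff ?p (d - 1)" by simp
  also have "\<dots> = (\<Sum>i\<in>F. t i ^ j * Polynomial.coeff (lagrange t F i) (d - 1)) - (if j = d - 1 then 1 else 0)"
    by (simp add: coeff_sum)
  also have "(\<Sum>i\<in>F. t i ^ j * Polynomial.coeff (lagrange t F i) (d - 1)) = (\<Sum>i\<in>F. t i ^ j * lag_point t F i)"
  proof (rule sum.cong[OF refl])
    fix i assume i: "i \<in> F"
    let ?q = "\<Prod>l\<in>F - {i}. [:- t l, 1:]"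
    have "lagrange t F i = Polynomial.smult (\<Prod>l\<in>F - {i}. inverse (t i - t l)) ?q"
      unfolding lagrange_def by (rule prod_smult)
    moreover have "Polynomial.degree ?q = d - 1"
      using i F by (subst degree_prod_eq_sum_degree) auto
    moreover have "lead_coeff ?q = 1" by (simp add: lead_coeff_prod)
    ultimately show "t i ^ j * Polynomial.coeff (lagrange t F i) (d - 1) = t i ^ j * lag_point t F i"
      using i by (simp add: lag_point_def)
  qed
  finally show ?thesis by simp
qed

lemma peval_vand_form:
  assumes "F \<subseteq> {1..n}" "inj_on t F" "card F = d" "j < d"
  shows "peval (lag_point t F) (vand_form n t j) = (if j = d - 1 then 1 else 0)"
proof -
  have "peval (lag_point t F) (vand_form n t j) = (\<Sum>i\<in>{1..n}. t i ^ j * lag_point t F i)"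
    by (simp add: vand_form_def peval_sum peval_single)
  also have "\<dots> = (\<Sum>i\<in>F. t i ^ j * lag_point t F i)"
    using assms(1) by (intro sum.mono_neutral_right) (auto simp: lag_point_def)
  also have "\<dots> = (if j = d - 1 then 1 else 0)"
    using divided_difference[OF _ assms(2-4)] assms(1) finite_subset by blast
  finally show ?thesis .
qed

lemma peval_coord_ideal:
  assumes "f \<in> coord_ideal F" "\<And>i. i \<notin> F \<Longrightarrow> p i = 0"
  shows "peval p f = 0"
  unfolding peval_def
proof (rule sum.neutral, rule ballI)
  fix m assume "m \<in> Poly_Mapping.keys f"
  then obtain i where i: "i \<in> Poly_Mapping.keys m" "i \<notin> F" using assms(1) by (auto simp: coord_ideal_def)
  then have "Poly_Mapping.lookup m i \<noteq> 0" by (simp add: in_keys_iff)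
  then have "\<exists>i\<in>Poly_Mapping.keys m. p i ^ Poly_Mapping.lookup m i = 0"
    using i assms(2) by (intro bexI[of _ i]) (simp_all add: power_0_left)
  then have "(\<Prod>i\<in>Poly_Mapping.keys m. p i ^ Poly_Mapping.lookup m i) = 0"
    by (intro prod_zero finite_keys)
  then show "Poly_Mapping.lookup f m * (\<Prod>i\<in>Poly_Mapping.keys m. p i ^ Poly_Mapping.lookup m i) = 0" by simp
qed


section \<open>Restriction of forms to the points of the faces of maximal size\<close>

locale CM_points =
  fixes n d :: nat and \<Delta> :: "nat set set" and t :: "nat \<Rightarrow> 'k::field"
  assumes cm: "CM_complex TYPE('k) n \<Delta>"
    and dim: "complex_dim \<Delta> = int d - 1"
    and inj: "inj_on t {1..n}"
    and d_pos: "d > 0"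
begin

text \<open>The degree \<open>D\<close> part of the Stanley--Reisner ring, with combinations of face
  monomials as normal forms.\<close>

definition A :: "nat \<Rightarrow> ((nat \<Rightarrow>\<^sub>0 nat) \<Rightarrow>\<^sub>0 'k) set" where
  "A D = poly_span (face_mons \<Delta> D)"

text \<open>Normal forms of the degree \<open>D\<close> part of the ideal that the first
  \<open>k\<close> forms generate in the Stanley--Reisner ring.\<close>

definition W :: "nat \<Rightarrow> nat \<Rightarrow> ((nat \<Rightarrow>\<^sub>0 nat) \<Rightarrow>\<^sub>0 'k) set" where
  "W k D = A D \<inter> par_ideal n t \<Delta> k"

definition face_part :: "((nat \<Rightarrow>\<^sub>0 nat) \<Rightarrow>\<^sub>0 'k) \<Rightarrow> (nat \<Rightarrow>\<^sub>0 nat) \<Rightarrow>\<^sub>0 'k" where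
  "face_part = mrestrict (\<lambda>m. Poly_Mapping.keys m \<in> \<Delta>)"

definition top_faces :: "nat set set" where
  "top_faces = {F \<in> \<Delta>. card F = d}"

text \<open>The default value 0 off \<open>top_faces\<close> lets functions for a complex and for
  its deletion of a facet be compared within one type.\<close>

definition E :: "((nat \<Rightarrow>\<^sub>0 nat) \<Rightarrow>\<^sub>0 'k) \<Rightarrow> nat set \<Rightarrow> 'k" where
  "E f = (\<lambda>F. if F \<in> top_faces then peval (lag_point t F) f else 0)"

definition V :: "nat \<Rightarrow> (nat set \<Rightarrow> 'k) set" where
  "V D = E ` A D"

lemma sc: "simplicial_complex n \<Delta>"
  using cm by (simp add: CM_complex_def)

lemmas finite_complex = card_le_dim(1)[OF sc dim]
  and card_face_le = card_le_dim(2)[OF sc dim]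
  and finite_face = card_le_dim(3)[OF sc dim]

lemma finite_A: "finite (face_mons \<Delta> D)"
  by (rule finite_face_mons[OF finite_complex finite_face])

lemma subspace_A: "pv.subspace (A D)"
  unfolding A_def by (rule subspace_poly_span)

lemma A_span: "A D \<subseteq> pv.span ((\<lambda>m. Poly_Mapping.single m 1) ` face_mons \<Delta> D)"
  unfolding A_def by (rule poly_span_subset)

lemma A_iff: "f \<in> A D \<longleftrightarrow> homogeneous D f \<and> face_part f = f"
proof
  assume "f \<in> A D"
  then have "\<forall>m\<in>Poly_Mapping.keys f. Poly_Mapping.keys m \<in> \<Delta> \<and> mdeg m = D"
    by (auto simp: A_def poly_span_def face_mons_def)
  then show "homogeneous D f \<and> face_part f = f"
    unfolding homogeneous_def face_part_def by (auto intro: mrestrict_id)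
next
  assume f: "homogeneous D f \<and> face_part f = f"
  have "Poly_Mapping.keys m \<in> \<Delta> \<and> mdeg m = D" if "m \<in> Poly_Mapping.keys f" for m
  proof -
    have "m \<in> Poly_Mapping.keys (face_part f)" using f that by simp
    then show ?thesis using f that by (simp add: face_part_def keys_mrestrict homogeneous_def)
  qed
  then show "f \<in> A D" by (auto simp: A_def poly_span_def face_mons_def)
qed

lemma face_part_A: "homogeneous D f \<Longrightarrow> face_part f \<in> A D"
  unfolding A_iff by (auto simp: face_part_def homogeneous_def keys_mrestrict mrestrict_mrestrict)

lemma face_part_face_ideal: "f - face_part f \<in> face_ideal \<Delta>"
  by (auto simp: face_ideal_def face_part_def in_keys_iff lookup_minus lookup_mrestrict when_def split: if_splits)

lemma subspace_par: "ring_ideal.subspace (par_ideal n t \<Delta> k)"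
  unfolding par_ideal_def by simp

lemma face_ideal_par: "face_ideal \<Delta> \<subseteq> par_ideal n t \<Delta> k"
  unfolding par_ideal_def using ring_ideal.span_superset[of "vand_form n t ` {..<k} \<union> face_ideal \<Delta>"] by blast

lemma face_part_par_iff: "face_part f \<in> par_ideal n t \<Delta> k \<longleftrightarrow> f \<in> par_ideal n t \<Delta> k"
proof -
  have "f - face_part f \<in> par_ideal n t \<Delta> k" using face_part_face_ideal face_ideal_par by blast
  then show ?thesis
    using ring_ideal.subspace_add[OF subspace_par, of "f - face_part f" k "face_part f"]
      ring_ideal.subspace_diff[OF subspace_par, of f k "f - face_part f"] by auto
qed

lemma hcomp_par:
  assumes "f \<in> par_ideal n t \<Delta> k" shows "hcomp D f \<in> par_ideal n t \<Delta> k"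
  using assms unfolding par_ideal_def
proof (rule hcomp_span[rotated])
  fix s D assume "s \<in> vand_form n t ` {..<k} \<union> face_ideal \<Delta>"
  then show "hcomp D s \<in> ring_ideal.span (vand_form n t ` {..<k} \<union> face_ideal \<Delta>)"
  proof
    assume s: "s \<in> vand_form n t ` {..<k}"
    then have hom: "homogeneous 1 s" using homogeneous_vand_form by blast
    show ?thesis
    proof (cases "D = 1")
      case True
      then show ?thesis using hcomp_id[OF hom] s by (auto intro: ring_ideal.span_base)
    next
      case False
      then have "hcomp D s = 0"
        unfolding hcomp_def by (intro mrestrict_eq_0) (use hom in \<open>auto simp: homogeneous_def\<close>)
      then show ?thesis by (simp add: ring_ideal.span_zero)
    qed
  next
    assume "s \<in> face_ideal \<Delta>"
    then show ?thesis unfolding hcomp_def by (intro ring_ideal.span_base UnI2 mrestrict_face_ideal)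
  qed
qed

lemma par_Suc_iff:
  "f \<in> par_ideal n t \<Delta> (Suc k) \<longleftrightarrow> (\<exists>c. f - c * vand_form n t k \<in> par_ideal n t \<Delta> k)"
proof -
  have "vand_form n t ` {..<Suc k} \<union> face_ideal \<Delta> =
      insert (vand_form n t k) (vand_form n t ` {..<k} \<union> face_ideal \<Delta>)"
    by (auto simp: lessThan_Suc)
  then show ?thesis unfolding par_ideal_def by (simp add: ring_ideal.span_insert)
qed

definition T :: "nat \<Rightarrow> ((nat \<Rightarrow>\<^sub>0 nat) \<Rightarrow>\<^sub>0 'k) \<Rightarrow> (nat \<Rightarrow>\<^sub>0 nat) \<Rightarrow>\<^sub>0 'k" where
  "T k f = face_part (vand_form n t k * f)"

lemma linear_T: "Vector_Spaces.linear pscale pscale (T k)"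
  unfolding Vector_Spaces.linear_iff
  by (intro conjI pv.vector_space_axioms allI)
    (simp_all add: T_def face_part_def distrib_left mrestrict_add mult.left_commute
      flip: mrestrict_pscale, simp add: pscale_def mult.left_commute)

lemma T_A: "f \<in> A D \<Longrightarrow> T k f \<in> A (Suc D)"
  unfolding T_def using homogeneous_mult[OF homogeneous_vand_form, of D f n t k]
  by (intro face_part_A) (simp add: A_iff)

lemma subspace_W: "pv.subspace (W k D)"
  unfolding W_def by (intro pv.subspace_inter subspace_A pv_subspace_ideal subspace_par)

text \<open>An element of the larger ideal is a multiple c theta_k modulo the smaller one. Since the
  ideals are homogeneous, c may be replaced by its component of degree \<open>D\<close>, and then by
  the normal form of that component.\<close>

lemma W_Suc:
  "W (Suc k) (Suc D) = {T k f + w | f w. f \<in> A D \<and> w \<in> W k (Suc D)}"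
proof (intro equalityI subsetI)
  fix g assume g: "g \<in> W (Suc k) (Suc D)"
  then have "g \<in> par_ideal n t \<Delta> (Suc k)" by (simp add: W_def)
  then obtain c where c: "g - c * vand_form n t k \<in> par_ideal n t \<Delta> k"
    unfolding par_Suc_iff by blast
  have gA: "homogeneous (Suc D) g" "face_part g = g" using g by (auto simp: W_def A_iff)
  let ?h = "hcomp D c"
  let ?f = "face_part ?h"
  have "hcomp (Suc D) (vand_form n t k * c) = vand_form n t k * ?h"
    using hcomp_mult[OF homogeneous_vand_form, of D n t k c] by simp
  then have 1: "g - vand_form n t k * ?h \<in> par_ideal n t \<Delta> k"
    using hcomp_par[OF c, of "Suc D"] hcomp_id[OF gA(1)] by (simp add: hcomp_diff mult.commute)
  have "vand_form n t k * (?h - ?f) \<in> par_ideal n t \<Delta> k"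
    using face_part_face_ideal[of ?h] face_ideal_par ring_ideal.subspace_scale[OF subspace_par] by blast
  from ring_ideal.subspace_add[OF subspace_par 1 this]
  have 2: "g - vand_form n t k * ?f \<in> par_ideal n t \<Delta> k" by (simp add: right_diff_distrib)
  have f: "?f \<in> A D" by (rule face_part_A[OF homogeneous_hcomp])
  have "face_part (g - vand_form n t k * ?f) = g - T k ?f"
    using gA(2) by (simp add: T_def face_part_def mrestrict_diff)
  then have "g - T k ?f \<in> par_ideal n t \<Delta> k" using 2 face_part_par_iff by metis
  moreover have "g - T k ?f \<in> A (Suc D)"
    using g T_A[OF f] pv.subspace_diff[OF subspace_A] by (simp add: W_def)
  ultimately have "g - T k ?f \<in> W k (Suc D)" by (simp add: W_def)
  moreover have "g = T k ?f + (g - T k ?f)" by simp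
  ultimately show "g \<in> {T k f + w | f w. f \<in> A D \<and> w \<in> W k (Suc D)}" using f by blast
next
  fix g assume "g \<in> {T k f + w | f w. f \<in> A D \<and> w \<in> W k (Suc D)}"
  then obtain f w where fw: "g = T k f + w" "f \<in> A D" "w \<in> W k (Suc D)" by blast
  have "vand_form n t k * f - f * vand_form n t k \<in> par_ideal n t \<Delta> k"
    using ring_ideal.subspace_0[OF subspace_par] by (simp add: mult.commute)
  then have "vand_form n t k * f \<in> par_ideal n t \<Delta> (Suc k)" unfolding par_Suc_iff by blast
  then have "T k f \<in> par_ideal n t \<Delta> (Suc k)" by (simp add: T_def face_part_par_iff)
  moreover have "w - 0 * vand_form n t k \<in> par_ideal n t \<Delta> k" using fw(3) by (simp add: W_def)
  then have "w \<in> par_ideal n t \<Delta> (Suc k)" unfolding par_Suc_iff by blast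
  ultimately have "g \<in> par_ideal n t \<Delta> (Suc k)"
    unfolding fw(1) by (rule ring_ideal.subspace_add[OF subspace_par])
  moreover have "g \<in> A (Suc D)"
    unfolding fw(1) using T_A[OF fw(2)] fw(3) by (intro pv.subspace_add[OF subspace_A]) (simp_all add: W_def)
  ultimately show "g \<in> W (Suc k) (Suc D)" by (simp add: W_def)
qed

lemma W_Suc_0: "W (Suc k) 0 = W k 0"
proof (intro equalityI subsetI)
  fix g assume g: "g \<in> W (Suc k) 0"
  then have "g \<in> par_ideal n t \<Delta> (Suc k)" by (simp add: W_def)
  then obtain c where c: "g - c * vand_form n t k \<in> par_ideal n t \<Delta> k"
    unfolding par_Suc_iff by blast
  have "homogeneous 0 g" using g by (auto simp: W_def A_iff)
  then have "hcomp 0 (g - c * vand_form n t k) = g"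
    using hcomp_mult_less[OF homogeneous_vand_form, of 0 n t k c]
    by (simp add: hcomp_diff hcomp_id mult.commute)
  then show "g \<in> W k 0" using hcomp_par[OF c, of 0] g by (simp add: W_def)
next
  fix g assume g: "g \<in> W k 0"
  then have "g - 0 * vand_form n t k \<in> par_ideal n t \<Delta> k" by (simp add: W_def)
  then have "g \<in> par_ideal n t \<Delta> (Suc k)" unfolding par_Suc_iff by blast
  then show "g \<in> W (Suc k) 0" using g by (simp add: W_def)
qed

text \<open>Here the regularity of theta_k enters the Hilbert function: without it the preimage
  could be larger than \<open>W k D\<close>.\<close>

lemma T_preimage:
  assumes "k < d" shows "{f \<in> A D. T k f \<in> W k (Suc D)} = W k D"
proof -
  have "T k f \<in> W k (Suc D) \<longleftrightarrow> f \<in> par_ideal n t \<Delta> k" if f: "f \<in> A D" for f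
  proof -
    have "homogeneous D f" using f by (simp add: A_iff)
    then have "vand_form n t k * f \<in> par_ideal n t \<Delta> k \<longleftrightarrow> f \<in> par_ideal n t \<Delta> k"
      using CM_nonzerodivisor[OF cm dim inj assms, of D f]
        ring_ideal.subspace_scale[OF subspace_par, of f k "vand_form n t k"] by blast
    then show ?thesis using T_A[OF f, of k] by (simp add: W_def T_def face_part_par_iff)
  qed
  then show ?thesis unfolding W_def by blast
qed

lemma dim_W_Suc:
  assumes "k < d"
  shows "pv.dim (W (Suc k) (Suc D)) + pv.dim (W k D) = pv.dim (A D) + pv.dim (W k (Suc D))"
proof -
  interpret vp: vector_space_pair pscale "pscale :: 'k \<Rightarrow> _" ..
  have span: "W k (Suc D) \<subseteq> pv.span ((\<lambda>m. Poly_Mapping.single m 1) ` face_mons \<Delta> (Suc D))"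
    using A_span by (auto simp: W_def)
  have "pv.dim {T k f + w | f w. f \<in> A D \<and> w \<in> W k (Suc D)} + pv.dim {f \<in> A D. T k f \<in> W k (Suc D)} =
      pv.dim (A D) + pv.dim (W k (Suc D))"
    by (rule vp.dim_sum_preimage[OF linear_T subspace_A A_span _ subspace_W span])
      (simp_all add: finite_A)
  then show ?thesis unfolding W_Suc T_preimage[OF assms] .
qed

lemma W_0: "W 0 D = {0}"
proof -
  have par: "par_ideal n t \<Delta> 0 = face_ideal \<Delta>"
    unfolding par_ideal_def using subspace_face_ideal[OF sc, where 'k='k] by simp
  have "f = 0" if "f \<in> A D" "f \<in> face_ideal \<Delta>" for f
  proof -
    have "face_part f = 0"
      unfolding face_part_def by (rule mrestrict_eq_0) (use that(2) in \<open>auto simp: face_ideal_def\<close>)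
    then show ?thesis using that(1) by (simp add: A_iff)
  qed
  then show ?thesis
    using pv.subspace_0[OF subspace_W, of 0 D] by (auto simp: W_def par)
qed

text \<open>Each form is a nonzerodivisor of degree one modulo its predecessors, so passing to the
  quotient multiplies the Hilbert series by 1 - X.\<close>

lemma hilbert_fps:
  assumes "k \<le> d"
  shows "Abs_fps (\<lambda>D. int (pv.dim (A D)) - int (pv.dim (W k D))) =
    Abs_fps (\<lambda>D. int (card (face_mons \<Delta> D))) * (1 - fps_X) ^ k"
  using assms
proof (induction k)
  case 0
  have "pv.dim ({0} :: ((nat \<Rightarrow>\<^sub>0 nat) \<Rightarrow>\<^sub>0 'k) set) = 0"
    using pv.dim_le_card[of "{0}" "{}"] by simp
  then show ?case
    by (simp add: W_0 A_def dim_poly_span[OF finite_A])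
next
  case (Suc k)
  let ?B = "\<lambda>k. Abs_fps (\<lambda>D. int (pv.dim (A D)) - int (pv.dim (W k D)))"
  have "?B (Suc k) = ?B k * (1 - fps_X)"
  proof (rule fps_ext)
    fix D
    show "fps_nth (?B (Suc k)) D = fps_nth (?B k * (1 - fps_X)) D"
    proof (cases D)
      case 0
      then show ?thesis by (simp add: W_Suc_0)
    next
      case (Suc D')
      have "int (pv.dim (W (Suc k) (Suc D'))) + int (pv.dim (W k D')) =
          int (pv.dim (A D')) + int (pv.dim (W k (Suc D')))"
        using dim_W_Suc[of k D'] Suc.prems unfolding of_nat_add[symmetric] by simp
      then show ?thesis using Suc by (simp add: right_diff_distrib)
    qed
  qed
  then show ?case using Suc by (simp only: power_Suc2 mult.assoc[symmetric])
qed

lemma hilbert: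
  assumes "D \<le> d"
  shows "int (pv.dim (A D)) - int (pv.dim (W (d - 1) D)) = (\<Sum>k\<le>D. h_vec \<Delta> k)"
  using sum_h_vec_fps[OF finite_complex finite_face card_face_le dim d_pos assms]
    arg_cong[OF hilbert_fps[of "d - 1"], of "\<lambda>g. fps_nth g D"] by simp

lemma linear_E: "Vector_Spaces.linear pscale fscale E"
  unfolding Vector_Spaces.linear_iff
  by (intro conjI pv.vector_space_axioms fs.vector_space_axioms allI)
    (auto simp: E_def fun_eq_iff peval_add peval_pscale fscale_def)

lemma E_mult: "E (f * g) F = E f F * E g F"
  by (simp add: E_def peval_mult)

lemma top_face:
  assumes "F \<in> top_faces" shows "F \<in> \<Delta>" "F \<subseteq> {1..n}" "card F = d" "finite F" "inj_on t F"
  using assms sc inj finite_face inj_on_subset[OF inj]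
  by (auto simp: top_faces_def simplicial_complex_def)

lemma finite_top_faces: "finite top_faces"
  using finite_complex by (simp add: top_faces_def)

lemma E_face_ideal: "f \<in> face_ideal \<Delta> \<Longrightarrow> E f = 0"
proof
  fix F assume f: "f \<in> face_ideal \<Delta>"
  show "E f F = 0 F"
  proof (cases "F \<in> top_faces")
    case True
    have "f \<in> coord_ideal F" using face_ideal_subset_coord_ideal[OF sc top_face(1)[OF True]] f by blast
    then have "peval (lag_point t F) f = 0" by (rule peval_coord_ideal) (simp add: lag_point_def)
    then show ?thesis by (simp add: E_def)
  qed (simp add: E_def)
qed

lemma E_face_part: "E (face_part f) = E f"
proof -
  interpret E: Vector_Spaces.linear pscale fscale E by (rule linear_E)
  have "E (f - face_part f) = 0" by (rule E_face_ideal[OF face_part_face_ideal])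
  then show ?thesis by (simp add: E.diff)
qed

lemma E_vand_form: "F \<in> top_faces \<Longrightarrow> j < d \<Longrightarrow> E (vand_form n t j) F = (if j = d - 1 then 1 else 0)"
  using peval_vand_form[OF top_face(2,5,3)] by (simp add: E_def)

lemma E_par:
  assumes "f \<in> par_ideal n t \<Delta> (d - 1)" shows "E f = 0"
proof -
  interpret E: Vector_Spaces.linear pscale fscale E by (rule linear_E)
  have "ring_ideal.subspace {f. E f = 0}"
    by (rule ring_ideal.subspaceI) (auto simp: E.zero E.add E_mult fun_eq_iff)
  moreover have "E (vand_form n t j) = 0" if "j < d - 1" for j
    using E_vand_form[of _ j] that by (auto simp: fun_eq_iff E_def)
  ultimately have "par_ideal n t \<Delta> (d - 1) \<subseteq> {f. E f = 0}"
    unfolding par_ideal_def by (intro ring_ideal.span_minimal) (auto simp: E_face_ideal)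
  then show ?thesis using assms by blast
qed

lemma subspace_V: "fs.subspace (V D)"
proof -
  interpret E: Vector_Spaces.linear pscale fscale E by (rule linear_E)
  show ?thesis unfolding V_def by (rule E.subspace_image[OF subspace_A])
qed

lemma V_supported: "V D \<subseteq> supported_on top_faces"
  by (auto simp: V_def E_def supported_on_def)

lemma E_in_V: "homogeneous D f \<Longrightarrow> E f \<in> V D"
  unfolding V_def using face_part_A[of D f] E_face_part[of f] by (metis image_eqI)

text \<open>The squarefree monomial of a face F of size \<open>d\<close> has degree
  \<open>d\<close>, is nonzero at the point of F, and vanishes at every other point because no other
  face of size \<open>d\<close> contains F.\<close>

lemma V_top: "V d = supported_on top_faces"
proof (rule antisym[OF V_supported], rule subsetI)
  fix u :: "nat set \<Rightarrow> 'k" assume u: "u \<in> supported_on top_faces"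
  have "delta F \<in> V d" if F: "F \<in> top_faces" for F
  proof -
    let ?x = "\<Prod>i\<in>F. var_poly i :: (nat \<Rightarrow>\<^sub>0 nat) \<Rightarrow>\<^sub>0 'k"
    have ev: "peval p ?x = (\<Prod>i\<in>F. p i)" for p :: "nat \<Rightarrow> 'k"
      using top_face(4)[OF F] by (induction F) (simp_all add: peval_mult)
    have "homogeneous d (\<Prod>i\<in>G. var_poly i :: (nat \<Rightarrow>\<^sub>0 nat) \<Rightarrow>\<^sub>0 'k)" if "finite G" "card G = d" for G d
      using that
    proof (induction G arbitrary: d)
      case (insert i G)
      have "homogeneous 1 (var_poly i :: (nat \<Rightarrow>\<^sub>0 nat) \<Rightarrow>\<^sub>0 'k)"
        by (simp add: homogeneous_def var_poly_def)
      from homogeneous_mult[OF this insert.IH[OF refl]] show ?case using insert by simp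
    qed simp
    then have "E ?x \<in> V d" using top_face(3,4)[OF F] by (intro E_in_V) blast
    moreover have "E ?x = fscale (\<Prod>i\<in>F. lag_point t F i) (delta F)"
    proof
      fix G
      show "E ?x G = fscale (\<Prod>i\<in>F. lag_point t F i) (delta F) G"
      proof (cases "G = F")
        case False
        have "(\<Prod>i\<in>F. lag_point t G i) = 0" if "G \<in> top_faces"
        proof -
          have "\<not> F \<subseteq> G"
            using False top_face(3,4)[OF F] top_face(3,4)[OF that] card_subset_eq by metis
          then obtain i where "i \<in> F" "i \<notin> G" by blast
          then show ?thesis using top_face(4)[OF F] by (intro prod_zero) (auto simp: lag_point_def)
        qed
        then show ?thesis using False by (simp add: E_def ev fscale_def delta_def)
      qed (use F in \<open>simp add: E_def ev fscale_def delta_def\<close>)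
    qed
    moreover have nz: "(\<Prod>i\<in>F. lag_point t F i) \<noteq> 0"
      using lag_point_nonzero[OF top_face(4,5)[OF F]] top_face(4)[OF F] by simp
    ultimately have "fscale (inverse (\<Prod>i\<in>F. lag_point t F i)) (fscale (\<Prod>i\<in>F. lag_point t F i) (delta F)) \<in> V d"
      using fs.subspace_scale[OF subspace_V] by metis
    then show ?thesis using nz by simp
  qed
  then show "u \<in> V d"
    by (subst supported_on_eq_sum[OF finite_top_faces u])
      (intro fs.subspace_sum[OF subspace_V] fs.subspace_scale[OF subspace_V])
qed

lemma kernel_E_eq:
  "int (pv.dim (A D)) = int (pv.dim {f \<in> A D. E f = 0}) + int (fs.dim (V D))"
proof -
  interpret vp: vector_space_pair pscale "fscale :: 'k \<Rightarrow> (nat set \<Rightarrow> 'k) \<Rightarrow> _" ..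
  show ?thesis
    unfolding V_def using vp.dim_kernel_image[OF linear_E subspace_A A_span, of D] finite_A by simp
qed

text \<open>The forms theta_j with j < d - 1 vanish at the points, so \<open>W\<close> lies in the
  kernel. Its codimension h_0 + ... + h_d is the number of faces of size \<open>d\<close>, which is
  also the rank of evaluation by \<open>V_top\<close>.\<close>

lemma kernel_E_top: "{f \<in> A d. E f = 0} = W (d - 1) d"
proof -
  have "(\<Sum>k\<le>d. h_vec \<Delta> k) = int (card top_faces)"
    unfolding top_faces_def by (rule sum_h_vec[OF finite_complex card_face_le dim])
  then have "int (pv.dim (A d)) - int (pv.dim (W (d - 1) d)) = int (fs.dim (V d))"
    using hilbert[of d] dim_supported_on[OF finite_top_faces, where 'k='k] unfolding V_top by simp
  then have dim_eq: "pv.dim {f \<in> A d. E f = 0} \<le> pv.dim (W (d - 1) d)"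
    using kernel_E_eq[of d] by linarith
  interpret E: Vector_Spaces.linear pscale fscale E by (rule linear_E)
  have "{f \<in> A d. E f = 0} = A d \<inter> {f. E f = 0}" by blast
  then have sub: "pv.subspace {f \<in> A d. E f = 0}"
    using pv.subspace_inter[OF subspace_A E.subspace_kernel] by simp
  have "W (d - 1) d = {f \<in> A d. E f = 0}"
    by (rule pv.subspace_eq_of_dim[OF subspace_W sub _ _ _ dim_eq])
      (use A_span finite_A E_par in \<open>auto simp: W_def\<close>)
  then show ?thesis by simp
qed

text \<open>Multiplication by a power of theta_(d-1) moves a form in the kernel up to degree
  \<open>d\<close>, where the kernel is known; the power then cancels because theta_(d-1) is a
  nonzerodivisor modulo the earlier forms.\<close>

lemma kernel_E:
  assumes "D \<le> d" shows "{f \<in> A D. E f = 0} = W (d - 1) D"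
proof (intro equalityI subsetI)
  fix f assume f: "f \<in> {f \<in> A D. E f = 0}"
  let ?y = "vand_form n t (d - 1)"
  let ?g = "?y ^ (d - D) * f"
  have hom: "homogeneous (N + D) (?y ^ N * f)" for N
    using f homogeneous_mult[OF homogeneous_power[OF homogeneous_vand_form], of D f N n t "d - 1"]
    by (simp add: A_iff)
  have "face_part ?g \<in> A d" using hom[of "d - D"] assms by (intro face_part_A) simp
  moreover have "E (face_part ?g) = 0"
    using f unfolding E_face_part by (auto simp: E_mult fun_eq_iff)
  ultimately have "face_part ?g \<in> par_ideal n t \<Delta> (d - 1)" using kernel_E_top by (auto simp: W_def)
  then have "?g \<in> par_ideal n t \<Delta> (d - 1)" by (simp add: face_part_par_iff)
  moreover have "f \<in> par_ideal n t \<Delta> (d - 1)" if "?y ^ N * f \<in> par_ideal n t \<Delta> (d - 1)" for N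
    using that
  proof (induction N)
    case (Suc N)
    have "?y * (?y ^ N * f) \<in> par_ideal n t \<Delta> (d - 1)" using Suc.prems by (simp add: mult.assoc)
    then show ?case using CM_nonzerodivisor[OF cm dim inj _ hom] d_pos Suc.IH by simp
  qed simp
  ultimately have "f \<in> par_ideal n t \<Delta> (d - 1)" by blast
  then show "f \<in> W (d - 1) D" using f by (simp add: W_def)
next
  fix f assume "f \<in> W (d - 1) D"
  then show "f \<in> {f \<in> A D. E f = 0}" using E_par by (auto simp: W_def)
qed

lemma dim_V: "D \<le> d \<Longrightarrow> int (fs.dim (V D)) = (\<Sum>k\<le>D. h_vec \<Delta> k)"
  using kernel_E_eq[of D] kernel_E[of D] hilbert[of D] by simp

lemma V_mult:
  assumes "u \<in> V D" "v \<in> V D'" shows "(\<lambda>F. u F * v F) \<in> V (D + D')"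
proof -
  obtain f g where fg: "u = E f" "f \<in> A D" "v = E g" "g \<in> A D'" using assms by (auto simp: V_def)
  have "E (f * g) \<in> V (D + D')" using fg by (intro E_in_V homogeneous_mult) (simp_all add: A_iff)
  moreover have "E (f * g) = (\<lambda>F. u F * v F)" using fg E_mult by auto
  ultimately show ?thesis by simp
qed

end

section \<open>Deletion of a facet and the inequality\<close>

lemma h_vec_cost_facet:
  assumes "finite \<Delta>" "\<And>G. G \<in> \<Delta> \<Longrightarrow> card G \<le> d" "complex_dim \<Delta> = int d - 1"
    and F: "F \<in> facets \<Delta>" "card F = d" and "complex_dim (cost \<Delta> F) = int d - 1" and "k < d"
  shows "h_vec (cost \<Delta> F) k = h_vec \<Delta> k"
proof -
  let ?g = "\<lambda>G. fps_nth (fps_X ^ card G * (1 - fps_X) ^ (d - card G)) k :: int"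
  have cost: "cost \<Delta> F = \<Delta> - {F}" using cost_facet[OF F(1)] .
  have "h_vec \<Delta> k = sum ?g \<Delta>"
    using assms by (intro h_vec_fps) auto
  also have "\<dots> = ?g F + sum ?g (\<Delta> - {F})"
    using assms(1) F(1) by (intro sum.remove) (auto simp: facets_def)
  \<comment> \<open>A face of size \<open>d\<close> contributes X^d only, hence nothing below degree
    \<open>d\<close>.\<close>
  also have "?g F = 0" using F(2) \<open>k < d\<close> by (simp add: fps_X_power_mult_nth)
  also have "sum ?g (\<Delta> - {F}) = h_vec (cost \<Delta> F) k"
    unfolding cost using assms cost by (intro h_vec_fps[symmetric]) auto
  finally show ?thesis by simp
qed

context CM_points
begin

lemma top_face_facet:
  assumes "F \<in> top_faces" shows "F \<in> facets \<Delta>"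
proof -
  have "G = F" if "G \<in> \<Delta>" "F \<subseteq> G" for G
    using card_seteq[OF finite_face[OF that(1)] that(2)] card_face_le[OF that(1)] top_face(3)[OF assms] by simp
  then show ?thesis using top_face(1)[OF assms] by (auto simp: facets_def)
qed

text \<open>Deleting the facet \<open>F\<close> changes the \<open>h\<close>-vector only in degree \<open>d\<close>, so forgetting the value
  at the point of \<open>F\<close> is injective on forms of degree \<open>d - 1\<close>.\<close>

lemma delta_notin_V:
  assumes F: "F \<in> top_faces" and "CM_complex TYPE('k) n (cost \<Delta> F)"
    and "complex_dim (cost \<Delta> F) = int d - 1"
  shows "delta F \<notin> V (d - 1)"
proof
  assume F_V: "delta F \<in> V (d - 1)"
  interpret C: CM_points n d "cost \<Delta> F" t
    using assms inj d_pos by unfold_locales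
  interpret vp: vector_space_pair "fscale :: 'k \<Rightarrow> (nat set \<Rightarrow> 'k) \<Rightarrow> _"
    "fscale :: 'k \<Rightarrow> (nat set \<Rightarrow> 'k) \<Rightarrow> _" ..
  have cost: "cost \<Delta> F = \<Delta> - {F}" using cost_facet[OF top_face_facet[OF F]] .
  define r :: "(nat set \<Rightarrow> 'k) \<Rightarrow> nat set \<Rightarrow> 'k" where "r u = (\<lambda>G. if G = F then 0 else u G)" for u
  have lin: "Vector_Spaces.linear fscale fscale r"
    unfolding Vector_Spaces.linear_iff
    by (intro conjI fs.vector_space_axioms allI) (auto simp: r_def fscale_def)
  have "(\<Sum>k\<le>d - 1. h_vec (cost \<Delta> F) k) = (\<Sum>k\<le>d - 1. h_vec \<Delta> k)"
    using h_vec_cost_facet[OF finite_complex card_face_le dim top_face_facet[OF F] top_face(3)[OF F]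
        assms(3)] d_pos
    by (intro sum.cong) auto
  then have "fs.dim (C.V (d - 1)) = fs.dim (V (d - 1))"
    using C.dim_V[of "d - 1"] dim_V[of "d - 1"] by simp
  \<comment> \<open>A form in the face monomials of the deletion is also one for \<Delta>, with the
    same values at the remaining points.\<close>
  moreover have "C.V (d - 1) \<subseteq> r ` V (d - 1)"
  proof
    fix u assume "u \<in> C.V (d - 1)"
    then obtain f where f: "f \<in> C.A (d - 1)" "u = C.E f" unfolding C.V_def by blast
    have "face_mons (cost \<Delta> F) (d - 1) \<subseteq> face_mons \<Delta> (d - 1)"
      by (auto simp: face_mons_def cost)
    then have "f \<in> A (d - 1)"
      using f(1) unfolding C.A_def A_def poly_span_def by blast
    moreover have "C.E f G = r (E f) G" for G
      unfolding C.E_def C.top_faces_def by (simp add: r_def E_def top_faces_def cost)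
    then have "u = r (E f)" unfolding f(2) by blast
    ultimately show "u \<in> r ` V (d - 1)" unfolding V_def by blast
  qed
  moreover have fin: "V (d - 1) \<subseteq> fs.span (delta ` top_faces)"
    using V_supported supported_on_subset_span[OF finite_top_faces] by blast
  then have "r ` V (d - 1) \<subseteq> fs.span (r ` delta ` top_faces)"
    using vp.linear_span_image[OF lin] by blast
  ultimately have "fs.dim (V (d - 1)) \<le> fs.dim (r ` V (d - 1))"
    using fs.dim_mono_finite[of "C.V (d - 1)" "r ` V (d - 1)" "r ` delta ` top_faces"]
      finite_top_faces by simp
  then have "fs.dim {u \<in> V (d - 1). r u = 0} = 0"
    using vp.dim_kernel_image[OF lin subspace_V fin] finite_top_faces by simp
  moreover have "r (delta F) = 0" by (auto simp: r_def delta_def fun_eq_iff)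
  then have "fs.dim {delta F :: nat set \<Rightarrow> 'k} \<le> fs.dim {u \<in> V (d - 1). r u = 0}"
    using F_V fin finite_top_faces
    by (intro fs.dim_mono_finite[where S = "delta ` top_faces"]) auto
  moreover have "delta F \<noteq> (0 :: nat set \<Rightarrow> 'k)"
    by (auto simp: delta_def fun_eq_iff)
  then have "fs.dim {delta F :: nat set \<Rightarrow> 'k} = 1"
    using fs.dim_eq_card_independent[of "{delta F :: nat set \<Rightarrow> 'k}"] by simp
  ultimately show False by simp
qed

lemma h_vec_sum_le:
  assumes inf: "infinite (UNIV :: 'k set)" and "i < d"
    and "\<And>F. F \<in> facets \<Delta> \<Longrightarrow> CM_complex TYPE('k) n (cost \<Delta> F) \<and> complex_dim (cost \<Delta> F) = int d - 1"
  shows "(\<Sum>k\<le>i. h_vec \<Delta> k) + (\<Sum>k\<le>d - 1 - i. h_vec \<Delta> k) \<le> (\<Sum>k\<le>d. h_vec \<Delta> k)"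
proof -
  have \<delta>: "delta F \<notin> V (d - 1)" if "F \<in> top_faces" for F
    using delta_notin_V[OF that] assms(3)[OF top_face_facet[OF that]] by blast
  obtain \<phi> where \<phi>: "\<And>F. F \<in> top_faces \<Longrightarrow> \<phi> F \<noteq> 0"
    "\<And>v. v \<in> V (d - 1) \<Longrightarrow> (\<Sum>F\<in>top_faces. \<phi> F * v F) = 0"
    by (rule annihilator_nonzero[OF inf finite_top_faces subspace_V V_supported \<delta>]) blast+
  have "fs.dim (V i) + fs.dim (V (d - 1 - i)) \<le> card top_faces"
  proof (rule orthogonal_dim_le[OF finite_top_faces V_supported V_supported \<phi>(1)])
    fix v w assume "v \<in> V i" "w \<in> V (d - 1 - i)"
    then have "(\<lambda>F. v F * w F) \<in> V (d - 1)" using V_mult[of v i w "d - 1 - i"] \<open>i < d\<close> by simp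
    then show "(\<Sum>F\<in>top_faces. \<phi> F * v F * w F) = 0" using \<phi>(2) by (simp add: mult.assoc)
  qed
  moreover have "(\<Sum>k\<le>d. h_vec \<Delta> k) = int (card top_faces)"
    unfolding top_faces_def by (rule sum_h_vec[OF finite_complex card_face_le dim])
  ultimately show ?thesis
    using dim_V[of i] dim_V[of "d - 1 - i"] \<open>i < d\<close> by simp
qed

end

text \<open>In dimension -1 the empty set is the only face, hence a facet; its deletion is the empty
  collection, which is not a complex.\<close>

lemma uniformly_CM_dim_pos:
  assumes "uniformly_CM TYPE('k::field) n \<Delta>" "complex_dim \<Delta> = int d - 1"
  shows "d > 0"
proof (rule ccontr)
  assume "\<not> d > 0"
  have sc: "simplicial_complex n \<Delta>" using assms(1) by (simp add: uniformly_CM_def CM_complex_def)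
  have "G = {}" if "G \<in> \<Delta>" for G
    using card_le_dim(2,3)[OF sc assms(2) that] \<open>\<not> d > 0\<close> by simp
  then have "{} \<in> facets \<Delta>" using sc by (auto simp: facets_def simplicial_complex_def)
  then have "simplicial_complex n (cost \<Delta> {})"
    using assms(1) by (auto simp: uniformly_CM_def CM_complex_def)
  then show False by (simp add: simplicial_complex_def cost_def)
qed

theorem proposition2p7:
  fixes n d i :: nat and \<Delta> :: "nat set set"
  assumes "infinite (UNIV :: 'k::field set)"
    and "simplicial_complex n \<Delta>"
    and "complex_dim \<Delta> = int d - 1"
    and "uniformly_CM TYPE('k) n \<Delta>"
    and "i \<le> d"
  shows "(\<Sum>j=0..i. h_vec \<Delta> (d - j)) \<ge> (\<Sum>j=0..i. h_vec \<Delta> j)"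
proof -
  have d: "d > 0" by (rule uniformly_CM_dim_pos[OF assms(4,3)])
  obtain t :: "nat \<Rightarrow> 'k" where "inj t"
    using infinite_countable_subset[OF assms(1)] by blast
  then interpret CM_points n d \<Delta> t
    using assms(3,4) d inj_on_subset[of t UNIV] by unfold_locales (auto simp: uniformly_CM_def)
  have rev: "(\<Sum>j=0..i. h_vec \<Delta> (d - j)) = (\<Sum>k=d - i..d. h_vec \<Delta> k)"
    using assms(5) by (intro sum.reindex_bij_witness[of _ "\<lambda>k. d - k" "\<lambda>j. d - j"]) auto
  show ?thesis
  proof (cases "i = d")
    case True
    then show ?thesis unfolding rev by simp
  next
    case False
    then have i: "i < d" using assms(5) by simp
    \<comment> \<open>The entries below degree d - i occur on both sides of
      \<open>h_vec_sum_le\<close> and cancel.\<close>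
    have "{..d} = {..d - 1 - i} \<union> {d - i..d}" "{..d - 1 - i} \<inter> {d - i..d} = {}"
      using i by auto
    then have "(\<Sum>k\<le>d. h_vec \<Delta> k) = (\<Sum>k\<le>d - 1 - i. h_vec \<Delta> k) + (\<Sum>k=d - i..d. h_vec \<Delta> k)"
      by (simp add: sum.union_disjoint)
    moreover have "(\<Sum>k\<le>i. h_vec \<Delta> k) + (\<Sum>k\<le>d - 1 - i. h_vec \<Delta> k) \<le> (\<Sum>k\<le>d. h_vec \<Delta> k)"
      using assms(3,4) by (intro h_vec_sum_le assms(1) i) (auto simp: uniformly_CM_def)
    ultimately show ?thesis unfolding rev by (simp add: atMost_atLeast0)
  qed
qed

end
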